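(* For a symmetric matrix $C'\in\mathbf{R}^{n\times n}$, an integer $r$, and $z\in\{\pm1\}^n$, say that $(C',r)$ has property $\mathcal{R}(z)$ if every second-order critical point $Y\in\mathbf{R}^{n\times r}$ of $$\max_{Y \in \mathbf{R}^{n\times r}}~\langle C', YY^\top\rangle \quad \text{s.t. } \mathrm{ddiag}(YY^\top) = I_n$$ satisfies $Y=zu^\top$ for some unit-norm $u\in\mathbf{R}^r$. Call a symmetric matrix $\Delta^+\in\mathbf{R}^{n\times n}$ a monotone perturbation (with respect to $z$) if $\Delta^+_{ij}z_iz_j\geq 0$ for all $i,j$. Then the following hold. (a) Let $A$ be the adjacency matrix of a connected (possibly weighted) undirected graph on $n$ vertices with algebraic connectivity $\lambda_2$, let $z\in\{\pm1\}^n$, let $\Delta\in\mathbf{R}^{n\times n}$ be symmetric with zero diagonal, let $C=\mathrm{diag}(z)A\,\mathrm{diag}(z)+\Delta$, and let $\rho^\Delta=\max_i\bigl(-z_i\sum_{j\ne i}\Delta_{ij}z_j\bigr)$. Suppose that either $r\ge 4$ is an integer and $$\rho^\Delta+\frac{r+11}{r-3}\lVert\Delta\rVert_{\mathrm{op}}\le\frac{r-3}{r-1}\lambda_2,$$ or $r=3$ and $\Delta=0$. Then, for every monotone perturbation $\Delta^+$, $(C+\Delta^+,r)$ has property $\mathcal{R}(z)$. (b) For each $n$, let $z\in\{\pm1\}^n$, $p\in[0,1]$, $\delta\in(0,1]$, and let $r\ge4$ be an integer (all possibly depending on $n$). Let $G=(V,E)\sim\mathcal{G}(n,p)$ be an Erdős–Rényi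 random graph on $V=\{1,\dots,n\}$, and, independently for each edge $(i,j)\in E$, let $R_{ij}=R_{ji}$ equal $z_iz_j$ with probability $\frac{1+\delta}{2}$ and $-z_iz_j$ with probability $\frac{1-\delta}{2}$. Let $C_{ij}=R_{ij}$ if $(i,j)\in E$ and $C_{ij}=0$ otherwise. Suppose that either, for some $0<\epsilon\le1/3$ independent of $n$, $$\frac{np}{\log n}\left(1-\sqrt{1-\left(\frac{r-3}{r-1}-\epsilon\right)^2\delta^2}\right)\ge1,$$ or, for some $\epsilon>0$ independent of $n$, $\frac1\delta\le\frac{r-3}{r-1}\sqrt{\frac{np}{(2+\epsilon)\log n}}$. Then, with probability $\to1$ as $n\to\infty$, for every monotone perturbation $\Delta^+$, $(C+\Delta^+,r)$ has property $\mathcal{R}(z)$. (c) Let $n$ be even, $z\in\{\pm1\}^n$ with $\langle z,\mathbf{1}\rangle=0$, $0\le q<p\le1$, let $A$ be a realization of the adjacency matrix of the stochastic block model with labels $z$ and parameters $p,q$, so that $\mathbf{E}A=\frac{p-q}{2}zz^\top+\frac{p+q}{2}\mathbf{1}\mathbf{1}^\top-pI_n$, and let $C=A-\frac{p+q}{2}\mathbf{1}\mathbf{1}^\top$. Let $r\ge4$ be an integer, and suppose $$\min_{1\le i\le n}z_i\sum_{j\ne i}A_{ij}z_j\ \ge\ \frac{r+11}{r-3}\lVert A-\mathbf{E}A\rVert_{\mathrm{op}}+\frac{n(p-q)}{r-1}.$$ Then, for every monotone perturbation $\Delta^+$, $(C+\Delta^+,r)$ has property $\mathcal{R}(z)$.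 (d) For each even $n$, let $z\in\{\pm1\}^n$ with $\langle z,\mathbf{1}\rangle=0$, $0\le q<p\le1$, and let $r\ge4$ be an integer (all possibly depending on $n$). Let $A$ be the random adjacency matrix of the stochastic block model with labels $z$ and parameters $p,q$, and let $C=A-\frac{p+q}{2}\mathbf{1}\mathbf{1}^\top$. Suppose that, for some $0<\epsilon\le1/12$ independent of $n$, $$\frac{n}{\log n}\left(\sqrt{p-\left(\frac1{r-1}+\epsilon\right)(p-q)}-\sqrt{q+\left(\frac1{r-1}+\epsilon\right)(p-q)}\right)^2\ge2.$$ Then, with probability $\to1$ as $n\to\infty$, for every monotone perturbation $\Delta^+$, $(C+\Delta^+,r)$ has property $\mathcal{R}(z)$.
   Context: Adjacency matrices are symmetric with nonnegative entries and zero diagonal. The graph Laplacian is $L=\mathrm{diag}(A\mathbf{1})-A$, with eigenvalues $0=\lambda_1\le\lambda_2\le\dots\le\lambda_n$; $\lambda_2$ is the algebraic connectivity. $\mathbf{1}$ is the all-ones vector in $\mathbf{R}^n$; $\mathrm{diag}(v)$ is the diagonal matrix with diagonal $v$; $\lVert\cdot\rVert_{\mathrm{op}}$ is the $\ell_2$ operator norm. $\langle \cdot,\cdot\rangle$ is the Euclidean inner product for vectors and the Frobenius inner product $\langle A,B\rangle = \mathrm{trace}(A^\top B)$ for matrices; $\mathrm{ddiag}\colon \mathbf{R}^{n\times n}\to\mathbf{R}^{n\times n}$ keeps the diagonal of a matrix and sets the off-diagonal entries to zero. In $\mathcal{G}(n,p)$ each possible undirected edge is present with probability $p$ independently of the others.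 In the stochastic block model with labels $z$ and parameters $p,q$, the adjacency matrix $A$ is a symmetric $0/1$ matrix with zero diagonal whose entries $A_{ij}$, $i<j$, are independent with $\mathbf{P}(A_{ij}=1)=p$ if $z_i=z_j$ and $=q$ if $z_i\ne z_j$. The constraint $\mathrm{ddiag}(YY^\top)=I_n$ says that every row of $Y$ is a unit vector in $\mathbf{R}^r$, so the feasible set is a Riemannian manifold (a product of $n$ unit spheres embedded in $\mathbf{R}^r$). A second-order critical point is a feasible $Y$ at which the Riemannian gradient of the objective is zero and the Riemannian Hessian is negative semidefinite. Explicitly, for a symmetric cost matrix $C'$, put $S(Y) = \mathrm{ddiag}(C'YY^\top) - C'$; a feasible $Y$ is second-order critical if and only if (i) $S(Y)Y = 0$, and (ii) $\langle S(Y), \dot Y \dot Y^\top\rangle \ge 0$ for every $\dot Y\in\mathbf{R}^{n\times r}$ such that $\mathrm{ddiag}(Y\dot Y^\top)=0$. "For every monotone perturbation" in the probabilistic parts means that $\Delta^+$ may be chosen arbitrarily, possibly depending on the realization of the random data. *)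

theory Defs
  imports
    "HOL-Probability.Probability"
    "Jordan_Normal_Form.Char_Poly"
begin

unbundle no inner_syntax
unbundle no vec_syntax

hide_const (open) Finite_Cartesian_Product.vec Finite_Cartesian_Product.mat
hide_type (open) Finite_Cartesian_Product.vec

text \<open>Vectors and matrices are those of \<^theory>\<open>Jordan_Normal_Form.Matrix\<close>, so that the
  dimension is an ordinary natural number. Indices are 0-based: the vertex set is
  \<^term>\<open>{..<n}\<close>.\<close>

definition sym_mat :: "nat \<Rightarrow> real mat \<Rightarrow> bool" where
  "sym_mat n A \<longleftrightarrow> A \<in> carrier_mat n n \<and> transpose_mat A = A"

definition ones_vec :: "nat \<Rightarrow> real vec" where
  "ones_vec n = vec n (\<lambda>_. 1)"

definition diagm :: "real vec \<Rightarrow> real mat" where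
  "diagm v = mat_diag (dim_vec v) (\<lambda>i. v $ i)"

definition ddiag :: "real mat \<Rightarrow> real mat" where
  "ddiag A = mat_diag (dim_row A) (\<lambda>i. A $$ (i, i))"

definition mat_trace :: "real mat \<Rightarrow> real" where
  "mat_trace A = (\<Sum>i<dim_row A. A $$ (i, i))"

definition frob_inner :: "real mat \<Rightarrow> real mat \<Rightarrow> real" where
  "frob_inner A B = mat_trace (transpose_mat A * B)"

definition outer :: "real vec \<Rightarrow> real vec \<Rightarrow> real mat" where
  "outer v w = mat (dim_vec v) (dim_vec w) (\<lambda>(i, j). v $ i * w $ j)"

definition l2_norm :: "real vec \<Rightarrow> real" where
  "l2_norm v = sqrt (v \<bullet> v)"

definition op_norm :: "real mat \<Rightarrow> real" where
  "op_norm A = (SUP x \<in> {x \<in> carrier_vec (dim_col A). l2_norm x \<le> 1}. l2_norm (A *\<^sub>v x))"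

definition sign_vec :: "nat \<Rightarrow> real vec \<Rightarrow> bool" where
  "sign_vec n z \<longleftrightarrow> z \<in> carrier_vec n \<and> (\<forall>i<n. z $ i \<in> {1, -1})"

definition adjacency_mat :: "nat \<Rightarrow> real mat \<Rightarrow> bool" where
  "adjacency_mat n A \<longleftrightarrow> sym_mat n A \<and> (\<forall>i<n. \<forall>j<n. 0 \<le> A $$ (i, j)) \<and> (\<forall>i<n. A $$ (i, i) = 0)"

definition connected_adj :: "nat \<Rightarrow> real mat \<Rightarrow> bool" where
  "connected_adj n A \<longleftrightarrow>
     (\<forall>i<n. \<forall>j<n. (i, j) \<in> {(k, l). k < n \<and> l < n \<and> A $$ (k, l) \<noteq> 0}\<^sup>*)"

definition laplacian :: "real mat \<Rightarrow> real mat" where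
  "laplacian A = diagm (A *\<^sub>v ones_vec (dim_row A)) - A"

text \<open>The eigenvalues in increasing order, repeated according to algebraic multiplicity; only used
  for symmetric matrices, all of whose eigenvalues are real.\<close>

definition sorted_eigenvalues :: "real mat \<Rightarrow> real list" where
  "sorted_eigenvalues M = sorted_list_of_multiset (proots (char_poly M))"

text \<open>The second entry of \<^term>\<open>sorted_eigenvalues (laplacian A)\<close>, as lists are 0-based. It is
  unspecified for a graph with a single vertex, which has no second eigenvalue.\<close>

definition algebraic_connectivity :: "real mat \<Rightarrow> real" where
  "algebraic_connectivity A = sorted_eigenvalues (laplacian A) ! 1"

definition feasible :: "nat \<Rightarrow> nat \<Rightarrow> real mat set" where
  "feasible n r = {Y \<in> carrier_mat n r. ddiag (Y * transpose_mat Y) = 1\<^sub>m n}"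

definition objective :: "real mat \<Rightarrow> real mat \<Rightarrow> real" where
  "objective C Y = frob_inner C (Y * transpose_mat Y)"

definition tangent_space :: "real mat \<Rightarrow> real mat set" where
  "tangent_space Y =
     {V \<in> carrier_mat (dim_row Y) (dim_col Y).
        ddiag (Y * transpose_mat V) = 0\<^sub>m (dim_row Y) (dim_row Y)}"

text \<open>For feasible \<open>Y\<close> this is the orthogonal projection onto the tangent space at \<open>Y\<close>;
  see \<open>tangent_proj_in_tangent_space\<close> and \<open>tangent_proj_orthogonal\<close> below.\<close>

definition tangent_proj :: "real mat \<Rightarrow> real mat \<Rightarrow> real mat" where
  "tangent_proj Y Z = Z - ddiag (Z * transpose_mat Y) * Y"

definition single_entry_mat :: "nat \<Rightarrow> nat \<Rightarrow> nat \<times> nat \<Rightarrow> real mat" where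
  "single_entry_mat n r ab = mat n r (\<lambda>ij. if ij = ab then 1 else 0)"

definition euclid_grad :: "(real mat \<Rightarrow> real) \<Rightarrow> real mat \<Rightarrow> real mat" where
  "euclid_grad f Y = mat (dim_row Y) (dim_col Y)
     (\<lambda>ij. deriv (\<lambda>t. f (Y + t \<cdot>\<^sub>m single_entry_mat (dim_row Y) (dim_col Y) ij)) 0)"

definition dir_deriv :: "(real mat \<Rightarrow> real mat) \<Rightarrow> real mat \<Rightarrow> real mat \<Rightarrow> real mat" where
  "dir_deriv F Y V = mat (dim_row Y) (dim_col Y) (\<lambda>ij. deriv (\<lambda>t. F (Y + t \<cdot>\<^sub>m V) $$ ij) 0)"

text \<open>For a Riemannian submanifold of a Euclidean space, the Riemannian gradient is the projection
  of the Euclidean gradient to the tangent space, and the Riemannian Hessian at \<open>Y\<close> along \<open>V\<close> is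
  the projection of the directional derivative of (any smooth extension of) the gradient field.
  Here the gradient field is extended by its own formula.\<close>

definition riem_grad :: "(real mat \<Rightarrow> real) \<Rightarrow> real mat \<Rightarrow> real mat" where
  "riem_grad f Y = tangent_proj Y (euclid_grad f Y)"

definition riem_hess :: "(real mat \<Rightarrow> real) \<Rightarrow> real mat \<Rightarrow> real mat \<Rightarrow> real mat" where
  "riem_hess f Y V = tangent_proj Y (dir_deriv (riem_grad f) Y V)"

definition second_order_critical :: "nat \<Rightarrow> nat \<Rightarrow> (real mat \<Rightarrow> real) \<Rightarrow> real mat \<Rightarrow> bool" where
  "second_order_critical n r f Y \<longleftrightarrow>
     Y \<in> feasible n r \<and>
     riem_grad f Y = 0\<^sub>m n r \<and>
     (\<forall>V \<in> tangent_space Y. frob_inner V (riem_hess f Y V) \<le> 0)"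

definition property_R :: "real mat \<Rightarrow> nat \<Rightarrow> real vec \<Rightarrow> bool" where
  "property_R C r z \<longleftrightarrow>
     (\<forall>Y. second_order_critical (dim_vec z) r (objective C) Y \<longrightarrow>
        (\<exists>u \<in> carrier_vec r. l2_norm u = 1 \<and> Y = outer z u))"

definition monotone_perturbation :: "real vec \<Rightarrow> real mat \<Rightarrow> bool" where
  "monotone_perturbation z D \<longleftrightarrow>
     sym_mat (dim_vec z) D \<and> (\<forall>i<dim_vec z. \<forall>j<dim_vec z. 0 \<le> D $$ (i, j) * z $ i * z $ j)"

definition vertex_pairs :: "nat \<Rightarrow> (nat \<times> nat) set" where
  "vertex_pairs n = {(i, j). i < j \<and> j < n}"

definition mat_of_upper :: "nat \<Rightarrow> (nat \<times> nat \<Rightarrow> real) \<Rightarrow> real mat" where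
  "mat_of_upper n f =
     mat n n (\<lambda>(i, j). if i < j then f (i, j) else if j < i then f (j, i) else 0)"

definition erdos_renyi_pmf :: "nat \<Rightarrow> real \<Rightarrow> (nat \<times> nat) set pmf" where
  "erdos_renyi_pmf n p =
     map_pmf (\<lambda>X. {e \<in> vertex_pairs n. X e})
       (Pi_pmf (vertex_pairs n) False (\<lambda>_. bernoulli_pmf p))"

text \<open>The Boolean variable \<open>T (i, j)\<close> tells whether the measurement on the edge is correct.\<close>

definition sync_pmf :: "nat \<Rightarrow> real \<Rightarrow> real \<Rightarrow> real vec \<Rightarrow> real mat pmf" where
  "sync_pmf n p \<delta> z =
     bind_pmf (erdos_renyi_pmf n p) (\<lambda>E.
       map_pmf (\<lambda>T. mat_of_upper n (\<lambda>(i, j).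
           if (i, j) \<in> E then (if T (i, j) then z $ i * z $ j else - (z $ i * z $ j)) else 0))
         (Pi_pmf E True (\<lambda>_. bernoulli_pmf ((1 + \<delta>) / 2))))"

definition sbm_pmf :: "nat \<Rightarrow> real \<Rightarrow> real \<Rightarrow> real vec \<Rightarrow> real mat pmf" where
  "sbm_pmf n p q z =
     map_pmf (\<lambda>X. mat_of_upper n (\<lambda>e. of_bool (X e)))
       (Pi_pmf (vertex_pairs n) False
         (\<lambda>(i, j). bernoulli_pmf (if z $ i = z $ j then p else q)))"

definition mean_mat :: "nat \<Rightarrow> real mat pmf \<Rightarrow> real mat" where
  "mean_mat n M = mat n n (\<lambda>ij. measure_pmf.expectation M (\<lambda>A. A $$ ij))"

lemma frob_inner_eq:
  assumes "A \<in> carrier_mat m k" "B \<in> carrier_mat m k"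
  shows "frob_inner A B = (\<Sum>i<m. \<Sum>j<k. A $$ (i, j) * B $$ (i, j))"
proof -
  have "frob_inner A B = (\<Sum>j<k. \<Sum>i<m. A $$ (i, j) * B $$ (i, j))"
    using assms by (auto simp: frob_inner_def mat_trace_def scalar_prod_def atLeast0LessThan)
  also have "\<dots> = (\<Sum>i<m. \<Sum>j<k. A $$ (i, j) * B $$ (i, j))"
    by (rule sum.swap)
  finally show ?thesis .
qed

lemma mult_transpose_index:
  assumes "Y \<in> carrier_mat n r" "V \<in> carrier_mat m r" "i < n" "k < m"
  shows "(Y * transpose_mat V) $$ (i, k) = (\<Sum>j<r. Y $$ (i, j) * V $$ (k, j))"
  using assms by (simp add: scalar_prod_def atLeast0LessThan)

lemma ddiag_mult_transpose:
  assumes "Y \<in> carrier_mat n r" "V \<in> carrier_mat n r"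
  shows "ddiag (Y * transpose_mat V) = mat_diag n (\<lambda>i. \<Sum>j<r. Y $$ (i, j) * V $$ (i, j))"
proof (rule eq_matI)
  fix i j
  assume "i < dim_row (mat_diag n (\<lambda>i. \<Sum>j<r. Y $$ (i, j) * V $$ (i, j)))"
    "j < dim_col (mat_diag n (\<lambda>i. \<Sum>j<r. Y $$ (i, j) * V $$ (i, j)))"
  then have "i < n" "j < n"
    by (simp_all add: mat_diag_def)
  moreover have "dim_row (Y * transpose_mat V) = n"
    using assms by simp
  ultimately show "ddiag (Y * transpose_mat V) $$ (i, j) =
      mat_diag n (\<lambda>i. \<Sum>j<r. Y $$ (i, j) * V $$ (i, j)) $$ (i, j)"
    using mult_transpose_index[OF assms] by (simp add: ddiag_def mat_diag_def del: index_mult_mat(1))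
qed (use assms in \<open>simp_all add: ddiag_def mat_diag_def\<close>)

lemma mat_diag_eq_iff: "mat_diag n f = mat_diag n g \<longleftrightarrow> (\<forall>i<n. f i = g i)"
proof
  assume eq: "mat_diag n f = mat_diag n g"
  show "\<forall>i<n. f i = g i"
  proof (intro allI impI)
    fix i assume "i < n"
    then show "f i = g i"
      using arg_cong[OF eq, of "\<lambda>A. A $$ (i, i)"] by (simp add: mat_diag_def)
  qed
next
  assume "\<forall>i<n. f i = g i"
  then show "mat_diag n f = mat_diag n g"
    by (intro eq_matI) (simp_all add: mat_diag_def)
qed

lemma zero_mat_diag: "0\<^sub>m n n = mat_diag n (\<lambda>_. 0)"
  by (intro eq_matI) (simp_all add: mat_diag_def)

lemma tangent_space_iff:
  assumes "Y \<in> carrier_mat n r"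
  shows "V \<in> tangent_space Y \<longleftrightarrow>
    V \<in> carrier_mat n r \<and> (\<forall>i<n. (\<Sum>j<r. Y $$ (i, j) * V $$ (i, j)) = 0)"
proof -
  have "dim_row Y = n" "dim_col Y = r"
    using assms by simp_all
  then show ?thesis
    unfolding tangent_space_def mem_Collect_eq zero_mat_diag
    by (metis (no_types, lifting) ddiag_mult_transpose[OF assms] mat_diag_eq_iff)
qed

lemma feasible_iff:
  "Y \<in> feasible n r \<longleftrightarrow>
    Y \<in> carrier_mat n r \<and> (\<forall>i<n. (\<Sum>j<r. Y $$ (i, j) * Y $$ (i, j)) = 1)"
proof (cases "Y \<in> carrier_mat n r")
  case True
  have "ddiag (Y * transpose_mat Y) = 1\<^sub>m n \<longleftrightarrow>
      mat_diag n (\<lambda>i. \<Sum>j<r. Y $$ (i, j) * Y $$ (i, j)) = mat_diag n (\<lambda>_. 1)"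
    by (simp only: ddiag_mult_transpose[OF True True] mat_diag_one)
  then show ?thesis
    using True by (simp only: feasible_def mem_Collect_eq mat_diag_eq_iff)
qed (simp add: feasible_def)

lemma tangent_proj_carrier [simp]:
  assumes "Y \<in> carrier_mat n r" "Z \<in> carrier_mat n r"
  shows "tangent_proj Y Z \<in> carrier_mat n r"
  using assms by (auto simp: tangent_proj_def ddiag_def mat_diag_def)

lemma tangent_proj_index:
  assumes "Y \<in> carrier_mat n r" "Z \<in> carrier_mat n r" "i < n" "j < r"
  shows "tangent_proj Y Z $$ (i, j) =
    Z $$ (i, j) - (\<Sum>l<r. Z $$ (i, l) * Y $$ (i, l)) * Y $$ (i, j)"
proof -
  have "ddiag (Z * transpose_mat Y) * Y =
      mat n r (\<lambda>(i, j). (\<Sum>l<r. Z $$ (i, l) * Y $$ (i, l)) * Y $$ (i, j))"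
    unfolding ddiag_mult_transpose[OF assms(2,1)] by (rule mat_diag_mult_left[OF assms(1)])
  then show ?thesis
    using assms unfolding tangent_proj_def by simp
qed

lemma tangent_proj_orthogonal_sum:
  assumes Y: "Y \<in> carrier_mat n r" and Z: "Z \<in> carrier_mat n r" and V: "V \<in> tangent_space Y"
  shows "frob_inner V (tangent_proj Y Z) = (\<Sum>i<n. \<Sum>j<r. V $$ (i, j) * Z $$ (i, j))"
proof -
  have VC: "V \<in> carrier_mat n r"
    and V0: "\<And>i. i < n \<Longrightarrow> (\<Sum>j<r. Y $$ (i, j) * V $$ (i, j)) = 0"
    using V Y by (auto simp: tangent_space_iff)
  have "(\<Sum>j<r. V $$ (i, j) * tangent_proj Y Z $$ (i, j)) = (\<Sum>j<r. V $$ (i, j) * Z $$ (i, j))"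
    if i: "i < n" for i
  proof -
    let ?c = "\<Sum>l<r. Z $$ (i, l) * Y $$ (i, l)"
    have "(\<Sum>j<r. V $$ (i, j) * tangent_proj Y Z $$ (i, j)) =
        (\<Sum>j<r. V $$ (i, j) * Z $$ (i, j) - ?c * (Y $$ (i, j) * V $$ (i, j)))"
      using i by (intro sum.cong) (auto simp: tangent_proj_index[OF Y Z] algebra_simps)
    also have "\<dots> = (\<Sum>j<r. V $$ (i, j) * Z $$ (i, j)) - ?c * (\<Sum>j<r. Y $$ (i, j) * V $$ (i, j))"
      by (simp only: sum_subtractf sum_distrib_left)
    finally show ?thesis
      using V0[OF i] by simp
  qed
  then show ?thesis
    using frob_inner_eq[OF VC tangent_proj_carrier[OF Y Z]] by (simp cong: sum.cong_simp)
qed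

lemma tangent_proj_in_tangent_space:
  assumes Y: "Y \<in> feasible n r" and Z: "Z \<in> carrier_mat n r"
  shows "tangent_proj Y Z \<in> tangent_space Y"
proof -
  have YC: "Y \<in> carrier_mat n r" and Y1: "\<And>i. i < n \<Longrightarrow> (\<Sum>j<r. Y $$ (i, j) * Y $$ (i, j)) = 1"
    using Y by (auto simp: feasible_iff)
  have "(\<Sum>j<r. Y $$ (i, j) * tangent_proj Y Z $$ (i, j)) = 0" if i: "i < n" for i
  proof -
    let ?c = "\<Sum>l<r. Z $$ (i, l) * Y $$ (i, l)"
    have "(\<Sum>j<r. Y $$ (i, j) * tangent_proj Y Z $$ (i, j)) =
        (\<Sum>j<r. Z $$ (i, j) * Y $$ (i, j) - ?c * (Y $$ (i, j) * Y $$ (i, j)))"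
      using i by (intro sum.cong) (auto simp: tangent_proj_index[OF YC Z] algebra_simps)
    also have "\<dots> = ?c - ?c * (\<Sum>j<r. Y $$ (i, j) * Y $$ (i, j))"
      by (simp only: sum_subtractf sum_distrib_left)
    finally show ?thesis
      using Y1[OF i] by simp
  qed
  then show ?thesis
    using YC Z by (simp add: tangent_space_iff)
qed

lemma tangent_proj_orthogonal:
  assumes "Y \<in> feasible n r" "Z \<in> carrier_mat n r" "V \<in> tangent_space Y"
  shows "frob_inner V (Z - tangent_proj Y Z) = 0"
proof -
  have Y: "Y \<in> carrier_mat n r"
    using assms by (simp add: feasible_iff)
  have V: "V \<in> carrier_mat n r"
    using assms(3) Y by (simp add: tangent_space_iff)
  have P: "tangent_proj Y Z \<in> carrier_mat n r"
    using Y assms(2) by simp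
  have ZP: "Z - tangent_proj Y Z \<in> carrier_mat n r"
    using P by (simp add: minus_carrier_mat)
  have "frob_inner V (Z - tangent_proj Y Z) =
      (\<Sum>i<n. \<Sum>j<r. V $$ (i, j) * Z $$ (i, j) - V $$ (i, j) * tangent_proj Y Z $$ (i, j))"
    unfolding frob_inner_eq[OF V ZP] using assms(2) P
    by (intro sum.cong refl) (simp add: right_diff_distrib)
  also have "\<dots> = (\<Sum>i<n. \<Sum>j<r. V $$ (i, j) * Z $$ (i, j)) - frob_inner V (tangent_proj Y Z)"
    by (simp only: frob_inner_eq[OF V P] sum_subtractf)
  finally have "frob_inner V (Z - tangent_proj Y Z) =
      (\<Sum>i<n. \<Sum>j<r. V $$ (i, j) * Z $$ (i, j)) - frob_inner V (tangent_proj Y Z)" .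
  then show ?thesis
    using tangent_proj_orthogonal_sum[OF Y assms(2,3)] by simp
qed

lemma objective_eq:
  assumes C: "C \<in> carrier_mat n n" and Y: "Y \<in> carrier_mat n r"
  shows "objective C Y =
    (\<Sum>i<n. \<Sum>k<n. C $$ (i, k) * (\<Sum>j<r. Y $$ (i, j) * Y $$ (k, j)))"
proof -
  have YY: "Y * transpose_mat Y \<in> carrier_mat n n"
    using Y by auto
  show ?thesis
    unfolding objective_def frob_inner_eq[OF C YY]
    using Y by (intro sum.cong) (auto simp: scalar_prod_def atLeast0LessThan)
qed

lemma mult_index:
  assumes "C \<in> carrier_mat n m" "Y \<in> carrier_mat m r" "i < n" "j < r"
  shows "(C * Y) $$ (i, j) = (\<Sum>k<m. C $$ (i, k) * Y $$ (k, j))"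
  using assms by (auto simp: scalar_prod_def atLeast0LessThan)

lemma objective_deriv:
  assumes C: "sym_mat n C" and Y: "Y \<in> carrier_mat n r" and V: "V \<in> carrier_mat n r"
  shows "((\<lambda>t. objective C (Y + t \<cdot>\<^sub>m V)) has_real_derivative
    2 * (\<Sum>i<n. \<Sum>j<r. V $$ (i, j) * (C * Y) $$ (i, j))) (at 0)"
proof -
  have CC: "C \<in> carrier_mat n n" and sym: "\<And>i k. i < n \<Longrightarrow> k < n \<Longrightarrow> C $$ (i, k) = C $$ (k, i)"
    using C by (auto simp: sym_mat_def) (metis carrier_matD index_transpose_mat(1))
  have "objective C (Y + t \<cdot>\<^sub>m V) = (\<Sum>i<n. \<Sum>k<n. C $$ (i, k) *
      (\<Sum>j<r. (Y $$ (i, j) + t * V $$ (i, j)) * (Y $$ (k, j) + t * V $$ (k, j))))" for t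
    using Y V by (subst objective_eq[OF CC, of _ r]) (auto intro!: sum.cong)
  then have eq: "(\<lambda>t. objective C (Y + t \<cdot>\<^sub>m V)) = (\<lambda>t. \<Sum>i<n. \<Sum>k<n. C $$ (i, k) *
      (\<Sum>j<r. (Y $$ (i, j) + t * V $$ (i, j)) * (Y $$ (k, j) + t * V $$ (k, j))))"
    by blast
  let ?s = "\<Sum>i<n. \<Sum>k<n. \<Sum>j<r. C $$ (i, k) * (V $$ (i, j) * Y $$ (k, j))"
  let ?s' = "\<Sum>i<n. \<Sum>k<n. \<Sum>j<r. C $$ (i, k) * (Y $$ (i, j) * V $$ (k, j))"
  have d: "((\<lambda>t. objective C (Y + t \<cdot>\<^sub>m V)) has_real_derivative
      (\<Sum>i<n. \<Sum>k<n. C $$ (i, k) *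
        (\<Sum>j<r. V $$ (i, j) * Y $$ (k, j) + Y $$ (i, j) * V $$ (k, j)))) (at 0)"
    unfolding eq by (auto intro!: derivative_eq_intros sum.cong simp: algebra_simps)
  have e1: "(\<Sum>i<n. \<Sum>k<n. C $$ (i, k) *
        (\<Sum>j<r. V $$ (i, j) * Y $$ (k, j) + Y $$ (i, j) * V $$ (k, j))) = ?s + ?s'"
    by (simp add: sum_distrib_left sum.distrib distrib_left)
  have "?s' = (\<Sum>k<n. \<Sum>i<n. \<Sum>j<r. C $$ (i, k) * (Y $$ (i, j) * V $$ (k, j)))"
    by (rule sum.swap)
  also have "\<dots> = ?s"
    by (intro sum.cong refl) (auto simp: sym mult.commute)
  finally have e2: "?s' = ?s" .
  have e3: "?s = (\<Sum>i<n. \<Sum>j<r. V $$ (i, j) * (C * Y) $$ (i, j))"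
  proof (rule sum.cong[OF refl])
    fix i assume "i \<in> {..<n}"
    have "(\<Sum>k<n. \<Sum>j<r. C $$ (i, k) * (V $$ (i, j) * Y $$ (k, j))) =
        (\<Sum>j<r. \<Sum>k<n. C $$ (i, k) * (V $$ (i, j) * Y $$ (k, j)))"
      by (rule sum.swap)
    also have "\<dots> = (\<Sum>j<r. V $$ (i, j) * (C * Y) $$ (i, j))"
      using \<open>i \<in> {..<n}\<close>
      by (intro sum.cong refl) (simp add: mult_index[OF CC Y] sum_distrib_left algebra_simps del: index_mult_mat)
    finally show "(\<Sum>k<n. \<Sum>j<r. C $$ (i, k) * (V $$ (i, j) * Y $$ (k, j))) =
        (\<Sum>j<r. V $$ (i, j) * (C * Y) $$ (i, j))" .
  qed
  show ?thesis
    using d unfolding e1 e2 e3 mult_2 .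
qed

lemma euclid_grad_objective:
  assumes C: "sym_mat n C" and Y: "Y \<in> carrier_mat n r"
  shows "euclid_grad (objective C) Y = 2 \<cdot>\<^sub>m (C * Y)"
proof (rule eq_matI)
  have CC: "C \<in> carrier_mat n n"
    using C by (simp add: sym_mat_def)
  fix i j assume "i < dim_row (2 \<cdot>\<^sub>m (C * Y))" "j < dim_col (2 \<cdot>\<^sub>m (C * Y))"
  then have ij: "i < n" "j < r"
    using CC Y by auto
  let ?E = "single_entry_mat n r (i, j)"
  have E: "?E \<in> carrier_mat n r"
    by (simp add: single_entry_mat_def)
  have "(\<Sum>a<n. \<Sum>b<r. ?E $$ (a, b) * (C * Y) $$ (a, b)) =
      (\<Sum>a<n. \<Sum>b<r. if a = i then if b = j then (C * Y) $$ (i, j) else 0 else 0)"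
    by (intro sum.cong refl) (auto simp: single_entry_mat_def)
  also have "\<dots> = (\<Sum>a<n. if a = i then (C * Y) $$ (i, j) else 0)"
    using ij by (intro sum.cong refl) auto
  also have "\<dots> = (C * Y) $$ (i, j)"
    using ij by simp
  finally have "deriv (\<lambda>t. objective C (Y + t \<cdot>\<^sub>m ?E)) 0 = 2 * (C * Y) $$ (i, j)"
    using DERIV_imp_deriv[OF objective_deriv[OF C Y E]] by simp
  then show "euclid_grad (objective C) Y $$ (i, j) = (2 \<cdot>\<^sub>m (C * Y)) $$ (i, j)"
    using ij Y CC by (simp add: euclid_grad_def)
qed (use assms in \<open>auto simp: euclid_grad_def sym_mat_def\<close>)

definition S_mat :: "real mat \<Rightarrow> real mat \<Rightarrow> real mat" where
  "S_mat C Y = ddiag (C * (Y * transpose_mat Y)) - C"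

context
  fixes n r :: nat and C :: "real mat"
  assumes C: "sym_mat n C"
begin

lemma C_carrier: "C \<in> carrier_mat n n"
  using C by (simp add: sym_mat_def)

lemma riem_grad_carrier:
  assumes Y: "Y \<in> carrier_mat n r"
  shows "riem_grad (objective C) Y \<in> carrier_mat n r"
  using Y C_carrier by (simp add: riem_grad_def euclid_grad_objective[OF C Y])

lemma riem_grad_index:
  assumes Y: "Y \<in> carrier_mat n r" and ij: "i < n" "j < r"
  shows "riem_grad (objective C) Y $$ (i, j) =
    2 * ((C * Y) $$ (i, j) - (\<Sum>l<r. (C * Y) $$ (i, l) * Y $$ (i, l)) * Y $$ (i, j))"
proof -
  have G: "2 \<cdot>\<^sub>m (C * Y) \<in> carrier_mat n r" and CY: "C * Y \<in> carrier_mat n r"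
    using C_carrier Y by auto
  have "(\<Sum>l<r. (2 \<cdot>\<^sub>m (C * Y)) $$ (i, l) * Y $$ (i, l)) = 2 * (\<Sum>l<r. (C * Y) $$ (i, l) * Y $$ (i, l))"
    unfolding sum_distrib_left using ij(1) C_carrier Y
    by (intro sum.cong refl) (simp add: index_smult_mat del: index_mult_mat(1))
  moreover have "(2 \<cdot>\<^sub>m (C * Y)) $$ (i, j) = 2 * (C * Y) $$ (i, j)"
    using ij CY by (intro index_smult_mat) auto
  ultimately show ?thesis
    unfolding riem_grad_def euclid_grad_objective[OF C Y] tangent_proj_index[OF Y G ij]
    by (simp add: algebra_simps del: index_mult_mat(1))
qed

lemma S_mat_carrier: "Y \<in> carrier_mat n r \<Longrightarrow> S_mat C Y \<in> carrier_mat n n"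
  using C_carrier by (simp add: S_mat_def minus_carrier_mat)

lemma S_mat_index:
  assumes Y: "Y \<in> carrier_mat n r" and ik: "i < n" "k < n"
  shows "S_mat C Y $$ (i, k) =
    (if i = k then \<Sum>l<r. (C * Y) $$ (i, l) * Y $$ (i, l) else 0) - C $$ (i, k)"
proof -
  have "C * (Y * transpose_mat Y) = (C * Y) * transpose_mat Y"
    using C_carrier Y by (simp add: assoc_mult_mat[of _ n n _ r _ n])
  moreover have CY: "C * Y \<in> carrier_mat n r"
    using C_carrier Y by auto
  moreover have "((C * Y) * transpose_mat Y) $$ (k, k) = (\<Sum>l<r. (C * Y) $$ (k, l) * Y $$ (k, l))"
    unfolding mult_index[OF CY transpose_carrier_mat[THEN iffD2, OF Y] ik(2) ik(2)]
    using Y ik by (intro sum.cong refl) auto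
  ultimately show ?thesis
    using C_carrier Y ik unfolding S_mat_def ddiag_def mat_diag_def
    by (auto simp del: index_mult_mat(1))
qed

lemma S_mat_mult_index:
  assumes Y: "Y \<in> carrier_mat n r" and V: "V \<in> carrier_mat n r" and ij: "i < n" "j < r"
  shows "(S_mat C Y * V) $$ (i, j) =
    (\<Sum>l<r. (C * Y) $$ (i, l) * Y $$ (i, l)) * V $$ (i, j) - (C * V) $$ (i, j)"
proof -
  let ?d = "\<Sum>l<r. (C * Y) $$ (i, l) * Y $$ (i, l)"
  have "(S_mat C Y * V) $$ (i, j) = (\<Sum>k<n. S_mat C Y $$ (i, k) * V $$ (k, j))"
    using S_mat_carrier[OF Y] V ij by (rule mult_index)
  also have "\<dots> = (\<Sum>k<n. (if k = i then ?d * V $$ (i, j) else 0) - C $$ (i, k) * V $$ (k, j))"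
    using ij by (intro sum.cong refl) (auto simp: S_mat_index[OF Y] left_diff_distrib simp del: index_mult_mat(1))
  also have "\<dots> = ?d * V $$ (i, j) - (\<Sum>k<n. C $$ (i, k) * V $$ (k, j))"
    using ij by (simp add: sum_subtractf del: index_mult_mat(1))
  finally show ?thesis
    using mult_index[OF C_carrier V ij] by simp
qed

lemma riem_grad_eq_0_iff:
  assumes Y: "Y \<in> carrier_mat n r"
  shows "riem_grad (objective C) Y = 0\<^sub>m n r \<longleftrightarrow> S_mat C Y * Y = 0\<^sub>m n r"
proof -
  have S: "S_mat C Y * Y \<in> carrier_mat n r"
    using S_mat_carrier[OF Y] Y by auto
  have "riem_grad (objective C) Y $$ (i, j) = -2 * (S_mat C Y * Y) $$ (i, j)"
    if "i < n" "j < r" for i j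
    using that by (simp add: riem_grad_index[OF Y] S_mat_mult_index[OF Y Y] del: index_mult_mat(1))
  then show ?thesis
    using riem_grad_carrier[OF Y] S by (auto simp: mat_eq_iff simp del: index_mult_mat(1))
qed

lemma dir_deriv_riem_grad:
  assumes Y: "Y \<in> carrier_mat n r" and V: "V \<in> carrier_mat n r" and ij: "i < n" "j < r"
  shows "dir_deriv (riem_grad (objective C)) Y V $$ (i, j) =
    - 2 * (S_mat C Y * V) $$ (i, j)
    - 2 * (\<Sum>l<r. (C * V) $$ (i, l) * Y $$ (i, l) + (C * Y) $$ (i, l) * V $$ (i, l)) * Y $$ (i, j)"
proof -
  have lin: "(C * (Y + t \<cdot>\<^sub>m V)) $$ (i, l) = (C * Y) $$ (i, l) + t * (C * V) $$ (i, l)"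
    if "l < r" for t l
  proof -
    have YV: "Y + t \<cdot>\<^sub>m V \<in> carrier_mat n r"
      using Y V by auto
    show ?thesis
      unfolding mult_index[OF C_carrier YV ij(1) that] mult_index[OF C_carrier Y ij(1) that]
        mult_index[OF C_carrier V ij(1) that] sum_distrib_left sum.distrib[symmetric]
      using Y V that by (intro sum.cong refl) (auto simp: algebra_simps)
  qed
  define W where "W = (\<lambda>l. (C * Y) $$ (i, l))"
  define X where "X = (\<lambda>l. (C * V) $$ (i, l))"
  have "riem_grad (objective C) (Y + t \<cdot>\<^sub>m V) $$ (i, j) =
      2 * ((W j + t * X j) - (\<Sum>l<r. (W l + t * X l) * (Y $$ (i, l) + t * V $$ (i, l))) *
        (Y $$ (i, j) + t * V $$ (i, j)))" for t
  proof -
    have YV: "Y + t \<cdot>\<^sub>m V \<in> carrier_mat n r"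
      using Y V by auto
    have ent: "(Y + t \<cdot>\<^sub>m V) $$ (i, l) = Y $$ (i, l) + t * V $$ (i, l)" if "l < r" for l
      using Y V ij that by auto
    show ?thesis
      unfolding riem_grad_index[OF YV ij] W_def X_def ent[OF ij(2)] lin[OF ij(2)]
      using ent lin by (simp cong: sum.cong_simp del: index_mult_mat(1))
  qed
  then have eq: "(\<lambda>t. riem_grad (objective C) (Y + t \<cdot>\<^sub>m V) $$ (i, j)) = (\<lambda>t.
      2 * ((W j + t * X j) - (\<Sum>l<r. (W l + t * X l) * (Y $$ (i, l) + t * V $$ (i, l))) *
        (Y $$ (i, j) + t * V $$ (i, j))))"
    by blast
  have "((\<lambda>t. riem_grad (objective C) (Y + t \<cdot>\<^sub>m V) $$ (i, j)) has_real_derivative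
      2 * (X j - ((\<Sum>l<r. X l * Y $$ (i, l) + W l * V $$ (i, l)) * Y $$ (i, j)
        + (\<Sum>l<r. W l * Y $$ (i, l)) * V $$ (i, j)))) (at 0)"
    unfolding eq by (auto intro!: derivative_eq_intros simp: algebra_simps sum.distrib)
  from DERIV_imp_deriv[OF this] show ?thesis
    using ij Y by (simp add: dir_deriv_def S_mat_mult_index[OF Y V ij] W_def X_def algebra_simps
        del: index_mult_mat(1))
qed

lemma riem_hess_quadratic:
  assumes Y: "Y \<in> carrier_mat n r" and V: "V \<in> tangent_space Y"
  shows "frob_inner V (riem_hess (objective C) Y V) =
    - 2 * frob_inner (S_mat C Y) (V * transpose_mat V)"
proof -
  have VC: "V \<in> carrier_mat n r"
    and V0: "\<And>i. i < n \<Longrightarrow> (\<Sum>j<r. Y $$ (i, j) * V $$ (i, j)) = 0"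
    using V Y by (auto simp: tangent_space_iff)
  let ?Z = "dir_deriv (riem_grad (objective C)) Y V"
  have Z: "?Z \<in> carrier_mat n r"
    using Y by (simp add: dir_deriv_def)
  have S: "S_mat C Y \<in> carrier_mat n n" and VV: "V * transpose_mat V \<in> carrier_mat n n"
    using S_mat_carrier[OF Y] VC by auto
  have row: "(\<Sum>j<r. V $$ (i, j) * ?Z $$ (i, j)) =
      - 2 * (\<Sum>k<n. S_mat C Y $$ (i, k) * (V * transpose_mat V) $$ (i, k))" if i: "i < n" for i
  proof -
    let ?c = "\<Sum>l<r. (C * V) $$ (i, l) * Y $$ (i, l) + (C * Y) $$ (i, l) * V $$ (i, l)"
    have "(\<Sum>j<r. V $$ (i, j) * ?Z $$ (i, j)) =
        (\<Sum>j<r. - 2 * (V $$ (i, j) * (S_mat C Y * V) $$ (i, j))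
          - 2 * ?c * (Y $$ (i, j) * V $$ (i, j)))"
      using i by (intro sum.cong refl)
        (simp add: dir_deriv_riem_grad[OF Y VC] algebra_simps del: index_mult_mat(1))
    also have "\<dots> = - 2 * (\<Sum>j<r. V $$ (i, j) * (S_mat C Y * V) $$ (i, j))
          - 2 * ?c * (\<Sum>j<r. Y $$ (i, j) * V $$ (i, j))"
      by (simp only: sum_subtractf sum_distrib_left)
    also have "\<dots> = - 2 * (\<Sum>j<r. V $$ (i, j) * (S_mat C Y * V) $$ (i, j))"
      by (simp only: V0[OF i] mult_zero_right diff_0_right)
    also have "(\<Sum>j<r. V $$ (i, j) * (S_mat C Y * V) $$ (i, j)) =
        (\<Sum>j<r. \<Sum>k<n. S_mat C Y $$ (i, k) * (V $$ (i, j) * V $$ (k, j)))"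
      using i by (intro sum.cong refl)
        (simp add: mult_index[OF S VC] sum_distrib_left algebra_simps del: index_mult_mat(1))
    also have "\<dots> = (\<Sum>k<n. \<Sum>j<r. S_mat C Y $$ (i, k) * (V $$ (i, j) * V $$ (k, j)))"
      by (rule sum.swap)
    also have "\<dots> = (\<Sum>k<n. S_mat C Y $$ (i, k) * (V * transpose_mat V) $$ (i, k))"
      using i VC by (intro sum.cong refl)
        (auto simp: scalar_prod_def atLeast0LessThan sum_distrib_left)
    finally show ?thesis .
  qed
  have "frob_inner V (riem_hess (objective C) Y V) = (\<Sum>i<n. \<Sum>j<r. V $$ (i, j) * ?Z $$ (i, j))"
    unfolding riem_hess_def by (rule tangent_proj_orthogonal_sum[OF Y Z V])
  also have "\<dots> = (\<Sum>i<n. - 2 * (\<Sum>k<n. S_mat C Y $$ (i, k) * (V * transpose_mat V) $$ (i, k)))"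
    using row by (intro sum.cong refl) auto
  also have "\<dots> = - 2 * frob_inner (S_mat C Y) (V * transpose_mat V)"
    by (simp only: frob_inner_eq[OF S VV] sum_distrib_left)
  finally show ?thesis .
qed

theorem second_order_critical_iff:
  "second_order_critical n r (objective C) Y \<longleftrightarrow>
     Y \<in> carrier_mat n r \<and> ddiag (Y * transpose_mat Y) = 1\<^sub>m n \<and>
     S_mat C Y * Y = 0\<^sub>m n r \<and>
     (\<forall>V \<in> carrier_mat n r. ddiag (Y * transpose_mat V) = 0\<^sub>m n n \<longrightarrow>
        0 \<le> frob_inner (S_mat C Y) (V * transpose_mat V))"
proof (cases "Y \<in> carrier_mat n r")
  case True
  have "tangent_space Y = {V \<in> carrier_mat n r. ddiag (Y * transpose_mat V) = 0\<^sub>m n n}"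
    using True by (simp add: tangent_space_def)
  then show ?thesis
    unfolding second_order_critical_def riem_grad_eq_0_iff[OF True] feasible_def
    using riem_hess_quadratic[OF True] by auto
qed (simp add: second_order_critical_def feasible_def)

end

lemma finite_vertex_pairs [simp]: "finite (vertex_pairs n)"
  by (rule finite_subset[of _ "{..<n} \<times> {..<n}"]) (auto simp: vertex_pairs_def)

lemma sbm_mean:
  assumes z: "sign_vec n z" and p: "p \<in> {0..1}" and q: "q \<in> {0..1}"
  shows "mean_mat n (sbm_pmf n p q z) =
    ((p - q) / 2) \<cdot>\<^sub>m outer z z + ((p + q) / 2) \<cdot>\<^sub>m outer (ones_vec n) (ones_vec n) - p \<cdot>\<^sub>m 1\<^sub>m n"
proof (rule eq_matI)
  let ?P = "\<lambda>(i, j). bernoulli_pmf (if z $ i = z $ j then p else q)"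
  have zc: "dim_vec z = n" and zi: "\<And>i. i < n \<Longrightarrow> z $ i = 1 \<or> z $ i = -1"
    using z by (auto simp: sign_vec_def)
  have up: "measure_pmf.expectation (Pi_pmf (vertex_pairs n) False ?P) (\<lambda>X. of_bool (X (i, j))) =
      (if z $ i = z $ j then p else q)" if "i < j" "j < n" for i j
  proof -
    have "measure_pmf.expectation (Pi_pmf (vertex_pairs n) False ?P) (\<lambda>X. of_bool (X (i, j))) =
        measure_pmf.expectation (map_pmf (\<lambda>X. X (i, j)) (Pi_pmf (vertex_pairs n) False ?P))
          (of_bool :: bool \<Rightarrow> real)"
      by simp
    also have "map_pmf (\<lambda>X. X (i, j)) (Pi_pmf (vertex_pairs n) False ?P) = ?P (i, j)"
      using that Pi_pmf_component[OF finite_vertex_pairs, of "(i, j)" n False ?P]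
      by (simp add: vertex_pairs_def)
    finally show ?thesis
      using p q by (auto simp: integral_bernoulli_pmf)
  qed
  fix i j
  assume "i < dim_row (((p - q) / 2) \<cdot>\<^sub>m outer z z + ((p + q) / 2) \<cdot>\<^sub>m outer (ones_vec n) (ones_vec n) - p \<cdot>\<^sub>m 1\<^sub>m n)"
    "j < dim_col (((p - q) / 2) \<cdot>\<^sub>m outer z z + ((p + q) / 2) \<cdot>\<^sub>m outer (ones_vec n) (ones_vec n) - p \<cdot>\<^sub>m 1\<^sub>m n)"
  then have ij: "i < n" "j < n"
    by auto
  have "mean_mat n (sbm_pmf n p q z) $$ (i, j) =
      (if i = j then 0 else if z $ i = z $ j then p else q)"
    using ij up[of i j] up[of j i]
    by (cases i j rule: linorder_cases) (auto simp: mean_mat_def sbm_pmf_def mat_of_upper_def)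
  then show "mean_mat n (sbm_pmf n p q z) $$ (i, j) =
    (((p - q) / 2) \<cdot>\<^sub>m outer z z + ((p + q) / 2) \<cdot>\<^sub>m outer (ones_vec n) (ones_vec n) - p \<cdot>\<^sub>m 1\<^sub>m n) $$ (i, j)"
    using ij zi[OF ij(1)] zi[OF ij(2)]
    by (auto simp: outer_def ones_vec_def zc field_simps)
qed (use z in \<open>simp_all add: mean_mat_def outer_def ones_vec_def sign_vec_def\<close>)

end

theory Submission
  imports Defs
begin

text \<open>Multiply row \<open>i\<close> of a point \<open>Y\<close> by \<open>z i\<close>. The rows become unit vectors \<open>y i\<close>, and property \<open>R\<close> says that
at every second-order critical point they all coincide. Let \<open>x i j\<close> be the inner product of \<open>y i\<close> and
\<open>y j\<close>, and let \<open>M i j = z i * z j * C i j\<close>. Take a coordinate direction \<open>e a\<close>, project it to the tangent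
spaces of the spheres at the rows of \<open>Y\<close>, multiply by \<open>z i\<close>, insert it into the second-order condition and
add over all \<open>a < r\<close>. What remains is one scalar inequality,
\<open>(\<Sum>i<n. \<Sum>j<n. M i j * ((1 - x i j) * (r - 2 - x i j))) \<le> 0\<close>
(\<open>second_order_inequality\<close>), and it alone forces the rows to coincide. A monotone perturbation contributes
nonnegative terms, so it cannot hurt. Without noise every term is nonnegative, every edge of \<open>M\<close> has
\<open>x i j = 1\<close>, and connectivity finishes the argument; this works for every \<open>r \<ge> 3\<close>.

With noise, \<open>M\<close> dominates \<open>a + D\<close> with \<open>a\<close> a weighted graph of spectral gap \<open>lam\<close>
(\<open>landscape_edges_aligned\<close>). The graph part uses \<open>(1 - x) * (r - 2 - x) = (r - 3) * (1 - x) + (1 - x)^2\<close>,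
and \<open>\<Sum> a i j * (1 - x i j)\<close> is a Dirichlet form, at least \<open>lam\<close> times the variance of the
configuration. The noise part uses \<open>(1 - x) * (r - 2 - x) = (r - 1) * (1 - x) - (1 - x^2)\<close>. Both \<open>1 - x\<close>
and \<open>1 - x^2\<close> are half squared distances, of the vectors \<open>y i\<close> and of the matrices
\<open>y i * transpose (y i)\<close>, so each noise sum splits into row sums of \<open>D\<close> weighted by squared distances to a
centre of our choice, and a quadratic form in \<open>D\<close>. If the mean is \<open>c = s * u\<close> with \<open>u\<close> a unit vector, the
centres \<open>c\<close> and \<open>u * transpose u\<close> make the combined weight of every row sum nonnegative. Hence only a lower
bound \<open>- \<rho>\<close> on the row sums and a bound \<open>B\<close> on the norm of \<open>D\<close> enter, and
\<open>(r - 1) * \<rho> + (r + 3) * B \<le> (r - 3) * lam\<close> suffices. The hypothesis for a general graph implies this, since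
\<open>r + 3 \<le> (r - 1) * (r + 11) / (r - 3)\<close>. For synchronization and clustering the graph is complete with the constant weight
\<open>p * \<delta>\<close> or \<open>(p - q) / 2\<close>, whose spectral gap is \<open>n\<close> times that weight.

The random parts need two facts with high probability. All row sums of the noise are large: Chernoff's bound,
with \<open>2 * s \<le> exp s - exp (- s)\<close> for the linear term and then the optimal \<open>s\<close>, gives the square-root
expressions of the hypotheses (\<open>sync_row_tail\<close>, \<open>sbm_row_tail\<close>). The norm of the noise is of order
\<open>sqrt (n * p + ln n)\<close> (\<open>random_kernel_norm\<close>); the hypotheses make the signal of order at least
\<open>sqrt (n * p * ln n)\<close>, so any constant is good enough here but an additional factor \<open>sqrt (ln n)\<close> is not.
The norm bound is a trace estimate. The expected trace of a power is a sum over closed walks, in which only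
walks that traverse each of their edges at least twice survive. These walks are never enumerated. They are
grouped by the pattern of coincidences between their vertices, and pattern by pattern their number is compared
(\<open>doubly_covered_comparison\<close>) with the number of such walks in a complete graph on \<open>2 * k\<close> vertices, where
\<open>n * p \<le> k\<close>. That number is at most the trace moment of a dense random matrix whose entries have all moments
of order at least two bounded below by one, and for a dense matrix a union bound over lattice points is
enough (\<open>card_doubly_covered_le\<close>).\<close>

section \<open>The second-order inequality\<close>

text \<open>The inner products of the tangent projections of the coordinate vectors at two points, added over the
coordinates: the trace of a product of two orthogonal projections when \<open>f\<close> and \<open>g\<close> are unit vectors.\<close>

lemma sum_delta_projections:
  fixes f g :: "nat \<Rightarrow> real"
  shows "(\<Sum>a<r. \<Sum>l<r. ((if l = a then 1 else 0) - f a * f l) * ((if l = a then 1 else 0) - g a * g l)) =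
    real r - (\<Sum>l<r. (f l)\<^sup>2) - (\<Sum>l<r. (g l)\<^sup>2) + (\<Sum>l<r. f l * g l)\<^sup>2"
proof -
  have "((if l = a then 1 else 0) - f a * f l) * ((if l = a then 1 else 0) - g a * g l) =
      (if l = a then 1 else 0) - (if l = a then (f a)\<^sup>2 else 0) - (if l = a then (g a)\<^sup>2 else 0)
      + (f a * g a) * (f l * g l)" for a l
    by (simp add: algebra_simps power2_eq_square)
  then show ?thesis
    by (simp add: sum.distrib sum_subtractf sum_product[symmetric] power2_eq_square[of "sum _ _"])
qed

text \<open>The tangent directions \<open>V a\<close> used here move all aligned rows towards the same vector \<open>e a\<close>. Adding over
\<open>a\<close> removes the dependence on the choice of direction, so that only the Gram matrix survives.\<close>

lemma second_order_inequality:
  fixes C Y :: "real mat"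
  assumes C: "sym_mat n C" and z: "sign_vec n z"
    and soc: "second_order_critical n r (objective C) Y"
  defines "x \<equiv> \<lambda>i j. \<Sum>l<r. (z $ i * Y $$ (i, l)) * (z $ j * Y $$ (j, l))"
  shows "(\<Sum>i<n. \<Sum>j<n. (z $ i * z $ j * C $$ (i, j)) * ((1 - x i j) * (real r - 2 - x i j))) \<le> 0"
proof -
  have Y: "Y \<in> carrier_mat n r" and feas: "Y \<in> feasible n r"
    and pos: "\<And>V. V \<in> carrier_mat n r \<Longrightarrow> ddiag (Y * transpose_mat V) = 0\<^sub>m n n \<Longrightarrow>
        0 \<le> frob_inner (S_mat C Y) (V * transpose_mat V)"
    using soc unfolding second_order_critical_iff[OF C] by (auto simp: feasible_def)
  have unit: "(\<Sum>l<r. (Y $$ (i, l))\<^sup>2) = 1" if "i < n" for i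
    using feas that unfolding feasible_iff power2_eq_square by blast
  have zz: "z $ i * z $ i = 1" if "i < n" for i
    using z that unfolding sign_vec_def by auto
  define X where "X = (\<lambda>i j. \<Sum>l<r. Y $$ (i, l) * Y $$ (j, l))"
  define V where "V = (\<lambda>a. mat n r (\<lambda>(i, l). z $ i * ((if l = a then 1 else 0) - Y $$ (i, a) * Y $$ (i, l))))"
  define G where "G = (\<lambda>i k. \<Sum>a<r. \<Sum>l<r. V a $$ (i, l) * V a $$ (k, l))"
  have Vc: "V a \<in> carrier_mat n r" for a
    unfolding V_def by simp
  have tangent: "ddiag (Y * transpose_mat (V a)) = 0\<^sub>m n n" if "a < r" for a
    unfolding ddiag_mult_transpose[OF Y Vc] zero_mat_diag mat_diag_eq_iff
  proof (intro allI impI)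
    fix i assume i: "i < n"
    have "(\<Sum>l<r. Y $$ (i, l) * V a $$ (i, l)) =
        (\<Sum>l<r. z $ i * ((if l = a then Y $$ (i, a) else 0) - Y $$ (i, a) * (Y $$ (i, l))\<^sup>2))"
      using i unfolding V_def by (intro sum.cong refl) (auto simp: algebra_simps power2_eq_square)
    also have "\<dots> = 0"
      using that by (simp add: sum_distrib_left[symmetric] sum_subtractf unit[OF i])
    finally show "(\<Sum>l<r. Y $$ (i, l) * V a $$ (i, l)) = 0" .
  qed
  have Sc: "S_mat C Y \<in> carrier_mat n n"
    by (rule S_mat_carrier[OF C Y])
  have CY: "(\<Sum>l<r. (C * Y) $$ (i, l) * Y $$ (i, l)) = (\<Sum>k<n. C $$ (i, k) * X i k)" if "i < n" for i
  proof -
    have "(\<Sum>l<r. (C * Y) $$ (i, l) * Y $$ (i, l)) =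
        (\<Sum>l<r. \<Sum>k<n. C $$ (i, k) * (Y $$ (i, l) * Y $$ (k, l)))"
      using that by (intro sum.cong refl)
        (simp add: mult_index[OF C_carrier[OF C] Y] sum_distrib_left mult_ac del: index_mult_mat(1))
    also have "\<dots> = (\<Sum>k<n. C $$ (i, k) * X i k)"
      unfolding X_def sum_distrib_left by (rule sum.swap)
    finally show ?thesis .
  qed
  have S: "S_mat C Y $$ (i, k) = (if i = k then (\<Sum>k<n. C $$ (i, k) * X i k) else 0) - C $$ (i, k)"
    if "i < n" "k < n" for i k
    unfolding S_mat_index[OF C Y that] CY[OF that(1)] by simp
  have G: "G i k = z $ i * z $ k * (real r - 2 + (X i k)\<^sup>2)" if "i < n" "k < n" for i k
  proof -
    have "G i k = (\<Sum>a<r. \<Sum>l<r. z $ i * z $ k * (((if l = a then 1 else 0) - Y $$ (i, a) * Y $$ (i, l))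
        * ((if l = a then 1 else 0) - Y $$ (k, a) * Y $$ (k, l))))"
      using that unfolding G_def V_def by (intro sum.cong refl) (simp add: mult_ac)
    also have "\<dots> = z $ i * z $ k * (real r - 2 + (X i k)\<^sup>2)"
      unfolding sum_distrib_left[symmetric] sum_delta_projections unit[OF that(1)] unit[OF that(2)] X_def
      by simp
    finally show ?thesis .
  qed
  have Xii: "X i i = 1" if "i < n" for i
    using unit[OF that] by (simp add: X_def power2_eq_square)
  have "0 \<le> (\<Sum>a<r. frob_inner (S_mat C Y) (V a * transpose_mat (V a)))"
    by (intro sum_nonneg pos Vc tangent) simp
  also have "\<dots> = (\<Sum>a<r. \<Sum>i<n. \<Sum>k<n. S_mat C Y $$ (i, k) * (\<Sum>l<r. V a $$ (i, l) * V a $$ (k, l)))"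
  proof (intro sum.cong refl)
    fix a
    have VV: "V a * transpose_mat (V a) \<in> carrier_mat n n"
      using Vc[of a] by auto
    show "frob_inner (S_mat C Y) (V a * transpose_mat (V a)) =
        (\<Sum>i<n. \<Sum>k<n. S_mat C Y $$ (i, k) * (\<Sum>l<r. V a $$ (i, l) * V a $$ (k, l)))"
      unfolding frob_inner_eq[OF Sc VV]
      by (intro sum.cong refl) (simp add: mult_transpose_index[OF Vc Vc] del: index_mult_mat(1))
  qed
  also have "\<dots> = (\<Sum>i<n. \<Sum>k<n. S_mat C Y $$ (i, k) * G i k)"
    unfolding G_def sum_distrib_left sum.swap[of _ "{..<n}" "{..<r}"] by (rule refl)
  also have "\<dots> = (\<Sum>i<n. (\<Sum>k<n. C $$ (i, k) * X i k) * (real r - 1) - (\<Sum>k<n. C $$ (i, k) * G i k))"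
  proof (intro sum.cong refl)
    fix i assume i: "i \<in> {..<n}"
    have "(\<Sum>k<n. S_mat C Y $$ (i, k) * G i k) =
      (\<Sum>k<n. (if i = k then (\<Sum>k<n. C $$ (i, k) * X i k) * G i i else 0) - C $$ (i, k) * G i k)"
      using i by (intro sum.cong refl) (auto simp: S left_diff_distrib)
    also have "\<dots> = (\<Sum>k<n. C $$ (i, k) * X i k) * G i i - (\<Sum>k<n. C $$ (i, k) * G i k)"
      using i by (simp add: sum_subtractf)
    also have "G i i = real r - 1"
      using i by (simp add: G Xii zz)
    finally show "(\<Sum>k<n. S_mat C Y $$ (i, k) * G i k) =
      (\<Sum>k<n. C $$ (i, k) * X i k) * (real r - 1) - (\<Sum>k<n. C $$ (i, k) * G i k)" .
  qed
  also have "\<dots> = (\<Sum>i<n. \<Sum>k<n. - ((z $ i * z $ k * C $$ (i, k)) * ((1 - x i k) * (real r - 2 - x i k))))"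
    unfolding sum_distrib_right sum_subtractf[symmetric]
  proof (intro sum.cong refl)
    fix i k assume ik: "i \<in> {..<n}" "k \<in> {..<n}"
    define s where "s = z $ i * z $ k"
    have "s * s = (z $ i * z $ i) * (z $ k * z $ k)"
      unfolding s_def by (simp only: mult_ac)
    then have s2: "s * s = 1"
      using zz[of i] zz[of k] ik by simp
    have x: "x i k = s * X i k"
      unfolding x_def X_def s_def by (simp add: sum_distrib_left mult_ac)
    have X: "X i k = s * x i k"
      unfolding x mult.assoc[symmetric] s2 by simp
    have X2: "(X i k)\<^sup>2 = (x i k)\<^sup>2"
      unfolding X power_mult_distrib power2_eq_square[of s] s2 by simp
    show "C $$ (i, k) * X i k * (real r - 1) - C $$ (i, k) * G i k =
        - ((z $ i * z $ k * C $$ (i, k)) * ((1 - x i k) * (real r - 2 - x i k)))"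
    proof -
      have "G i k = s * (real r - 2 + (x i k)\<^sup>2)"
        using G[of i k] ik unfolding X2 s_def by simp
      then show ?thesis
        unfolding s_def[symmetric] by (simp only: X) (simp add: algebra_simps power2_eq_square)
    qed
  qed
  finally show ?thesis
    by (simp add: sum_negf)
qed

text \<open>The interface between optimization and analysis: the scalar inequality is all that the rest of the argument
knows about \<open>Y\<close>.\<close>

lemma property_R_introduction:
  assumes C: "sym_mat n C" and z: "sign_vec n z" and n: "0 < n"
    and aligned: "\<And>y x. (\<And>i. i < n \<Longrightarrow> (\<Sum>l<r. (y i l)\<^sup>2) = 1) \<Longrightarrow>
      (\<And>i j. x i j = (\<Sum>l<r. y i l * y j l)) \<Longrightarrow>
      (\<Sum>i<n. \<Sum>j<n. (z $ i * z $ j * C $$ (i, j)) * ((1 - x i j) * (real r - 2 - x i j))) \<le> 0 \<Longrightarrow>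
      (\<And>i j l. i < n \<Longrightarrow> j < n \<Longrightarrow> l < r \<Longrightarrow> y i l = y j l)"
  shows "property_R C r z"
  unfolding property_R_def
proof (intro allI impI)
  fix Y assume "second_order_critical (dim_vec z) r (objective C) Y"
  moreover have dz: "dim_vec z = n"
    using z by (auto simp: sign_vec_def)
  ultimately have soc: "second_order_critical n r (objective C) Y" by simp
  then have feas: "Y \<in> feasible n r"
    by (simp add: second_order_critical_def)
  then have Y: "Y \<in> carrier_mat n r"
    by (simp add: feasible_def)
  have unit: "(\<Sum>l<r. (Y $$ (i, l))\<^sup>2) = 1" if "i < n" for i
    using feas that unfolding feasible_iff power2_eq_square by blast
  have zz: "z $ i * z $ i = 1" if "i < n" for i
    using z that unfolding sign_vec_def by auto
  define y where "y = (\<lambda>i l. z $ i * Y $$ (i, l))"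
  have y2: "(\<Sum>l<r. (y i l)\<^sup>2) = 1" if "i < n" for i
    using unit[OF that] zz[OF that] unfolding y_def power_mult_distrib sum_distrib_left[symmetric]
    by (simp add: power2_eq_square)
  have eq: "y i l = y j l" if "i < n" "j < n" "l < r" for i j l
  proof (rule aligned[where y=y and x="\<lambda>i j. \<Sum>l<r. y i l * y j l"])
    show "(\<Sum>i<n. \<Sum>j<n. z $ i * z $ j * C $$ (i, j) *
        ((1 - (\<Sum>l<r. y i l * y j l)) * (real r - 2 - (\<Sum>l<r. y i l * y j l)))) \<le> 0"
      unfolding y_def by (rule second_order_inequality[OF C z soc])
  qed (use y2 that in auto)
  define u where "u = vec r (y 0)"
  have "l2_norm u = 1"
    using y2[OF n] by (simp add: l2_norm_def u_def scalar_prod_def atLeast0LessThan power2_eq_square)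
  moreover have "Y = outer z u"
  proof (rule eq_matI)
    fix i l assume "i < dim_row (outer z u)" "l < dim_col (outer z u)"
    then have il: "i < n" "l < r" by (auto simp: outer_def dz u_def)
    have "Y $$ (i, l) = z $ i * y i l"
      unfolding y_def using zz[OF il(1)] by (simp add: mult.assoc[symmetric])
    also have "\<dots> = z $ i * y 0 l" using eq[OF il(1) n il(2)] by simp
    finally show "Y $$ (i, l) = outer z u $$ (i, l)"
      using il by (simp add: outer_def dz u_def)
  qed (use Y in \<open>auto simp: outer_def dz u_def\<close>)
  ultimately show "\<exists>u\<in>carrier_vec r. l2_norm u = 1 \<and> Y = outer z u"
    by (intro bexI[of _ u]) (auto simp: u_def)
qed

lemma unit_vectors_eq:
  fixes a b :: "nat \<Rightarrow> real"
  assumes "(\<Sum>l<r. (a l)\<^sup>2) = 1" "(\<Sum>l<r. (b l)\<^sup>2) = 1" "(\<Sum>l<r. a l * b l) = 1" "l < r"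
  shows "a l = b l"
proof -
  have "(\<Sum>l<r. (a l - b l)\<^sup>2) = (\<Sum>l<r. (a l)\<^sup>2) + (\<Sum>l<r. (b l)\<^sup>2) - 2 * (\<Sum>l<r. a l * b l)"
    by (simp add: power2_diff sum.distrib sum_subtractf sum_distrib_left algebra_simps)
  then have "(\<Sum>l<r. (a l - b l)\<^sup>2) = 0"
    using assms by simp
  then show ?thesis
    using assms(4) by (subst (asm) sum_nonneg_eq_0_iff) auto
qed

section \<open>Configurations of unit vectors under a spectral gap\<close>

lemma sum_diff_squares_kernel:
  fixes D :: "nat \<Rightarrow> nat \<Rightarrow> real"
  assumes sym: "\<And>i j. i < n \<Longrightarrow> j < n \<Longrightarrow> D i j = D j i"
  shows "(\<Sum>i<n. \<Sum>j<n. D i j * (f i - f j)\<^sup>2) / 2 =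
    (\<Sum>i<n. (\<Sum>j<n. D i j) * (f i)\<^sup>2) - (\<Sum>i<n. \<Sum>j<n. D i j * f i * f j)"
proof -
  have "(\<Sum>i<n. \<Sum>j<n. D i j * (f j)\<^sup>2) = (\<Sum>j<n. \<Sum>i<n. D i j * (f j)\<^sup>2)"
    by (rule sum.swap)
  also have "\<dots> = (\<Sum>i<n. (\<Sum>j<n. D i j) * (f i)\<^sup>2)"
    using sym by (auto intro!: sum.cong simp: sum_distrib_right)
  finally have s: "(\<Sum>i<n. \<Sum>j<n. D i j * (f j)\<^sup>2) = (\<Sum>i<n. (\<Sum>j<n. D i j) * (f i)\<^sup>2)" .
  have "(\<Sum>i<n. \<Sum>j<n. D i j * (f i - f j)\<^sup>2) =
      (\<Sum>i<n. \<Sum>j<n. D i j * (f i)\<^sup>2) + (\<Sum>i<n. \<Sum>j<n. D i j * (f j)\<^sup>2)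
      - 2 * (\<Sum>i<n. \<Sum>j<n. D i j * f i * f j)"
    by (simp add: sum.distrib[symmetric] sum_subtractf[symmetric] sum_distrib_left
        power2_diff algebra_simps)
  moreover have "(\<Sum>i<n. \<Sum>j<n. D i j * (f i)\<^sup>2) = (\<Sum>i<n. (\<Sum>j<n. D i j) * (f i)\<^sup>2)"
    by (simp add: sum_distrib_right)
  ultimately show ?thesis
    by (simp add: s)
qed

text \<open>A kernel sum against half the squared distances of feature vectors is a Laplacian form, so it does not
change when all features are shifted by the same \<open>c\<close>. This freedom to choose the centre is the point of the
lemma.\<close>

lemma feature_kernel_sum:
  fixes D :: "nat \<Rightarrow> nat \<Rightarrow> real" and \<phi> :: "nat \<Rightarrow> 'l \<Rightarrow> real"
  assumes sym: "\<And>i j. i < n \<Longrightarrow> j < n \<Longrightarrow> D i j = D j i"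
    and k: "\<And>i j. i < n \<Longrightarrow> j < n \<Longrightarrow> k i j = (\<Sum>l\<in>L. (\<phi> i l - \<phi> j l)\<^sup>2) / 2"
  shows "(\<Sum>i<n. \<Sum>j<n. D i j * k i j) =
    (\<Sum>i<n. (\<Sum>j<n. D i j) * (\<Sum>l\<in>L. (\<phi> i l - c l)\<^sup>2))
    - (\<Sum>l\<in>L. \<Sum>i<n. \<Sum>j<n. D i j * (\<phi> i l - c l) * (\<phi> j l - c l))"
proof -
  have "(\<Sum>i<n. \<Sum>j<n. D i j * k i j) =
      (\<Sum>i<n. \<Sum>l\<in>L. \<Sum>j<n. D i j * ((\<phi> i l - c l) - (\<phi> j l - c l))\<^sup>2 / 2)"
    by (subst sum.swap[of _ _ L], intro sum.cong refl)
      (simp add: k sum_distrib_left sum_divide_distrib)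
  also have "\<dots> = (\<Sum>l\<in>L. (\<Sum>i<n. \<Sum>j<n. D i j * ((\<phi> i l - c l) - (\<phi> j l - c l))\<^sup>2) / 2)"
    by (subst sum.swap) (simp add: sum_divide_distrib)
  also have "\<dots> = (\<Sum>l\<in>L. (\<Sum>i<n. (\<Sum>j<n. D i j) * (\<phi> i l - c l)\<^sup>2) -
      (\<Sum>i<n. \<Sum>j<n. D i j * (\<phi> i l - c l) * (\<phi> j l - c l)))"
    by (intro sum.cong refl sum_diff_squares_kernel sym)
  also have "\<dots> = (\<Sum>l\<in>L. (\<Sum>i<n. (\<Sum>j<n. D i j) * (\<phi> i l - c l)\<^sup>2)) -
      (\<Sum>l\<in>L. \<Sum>i<n. \<Sum>j<n. D i j * (\<phi> i l - c l) * (\<phi> j l - c l))"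
    by (rule sum_subtractf)
  also have "(\<Sum>l\<in>L. (\<Sum>i<n. (\<Sum>j<n. D i j) * (\<phi> i l - c l)\<^sup>2)) =
      (\<Sum>i<n. (\<Sum>j<n. D i j) * (\<Sum>l\<in>L. (\<phi> i l - c l)\<^sup>2))"
    by (subst sum.swap) (simp add: sum_distrib_left)
  finally show ?thesis .
qed

lemma unit_rows_half_dist:
  fixes y :: "nat \<Rightarrow> nat \<Rightarrow> real"
  assumes "(\<Sum>l<r. (y i l)\<^sup>2) = 1" "(\<Sum>l<r. (y j l)\<^sup>2) = 1"
  shows "(\<Sum>l<r. (y i l - y j l)\<^sup>2) / 2 = 1 - (\<Sum>l<r. y i l * y j l)"
proof -
  have "(\<Sum>l<r. (y i l - y j l)\<^sup>2) = (\<Sum>l<r. (y i l)\<^sup>2) + (\<Sum>l<r. (y j l)\<^sup>2)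
      - 2 * (\<Sum>l<r. y i l * y j l)"
    by (simp add: power2_diff sum.distrib sum_subtractf sum_distrib_left algebra_simps)
  then show ?thesis
    using assms by simp
qed

lemma sum_product_square:
  fixes a b :: "nat \<Rightarrow> real"
  shows "(\<Sum>p\<in>{..<r}\<times>{..<r}. (a (fst p) * a (snd p)) * (b (fst p) * b (snd p))) =
    (\<Sum>l<r. a l * b l)\<^sup>2"
  by (simp add: power2_eq_square sum_product sum.cartesian_product case_prod_beta algebra_simps)

text \<open>The features of the kernel \<open>x^2\<close> are the rank-one matrices with entries \<open>a l * a m\<close>; their inner products
are squares of inner products.\<close>

lemma rank_one_dist:
  fixes a b :: "nat \<Rightarrow> real"
  assumes "(\<Sum>l<r. (a l)\<^sup>2) = 1" "(\<Sum>l<r. (b l)\<^sup>2) = 1"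
  shows "(\<Sum>p\<in>{..<r}\<times>{..<r}. (a (fst p) * a (snd p) - b (fst p) * b (snd p))\<^sup>2) =
    2 * (1 - (\<Sum>l<r. a l * b l)\<^sup>2)"
proof -
  have "(\<Sum>p\<in>{..<r}\<times>{..<r}. (a (fst p) * a (snd p) - b (fst p) * b (snd p))\<^sup>2) =
     (\<Sum>p\<in>{..<r}\<times>{..<r}. (a (fst p) * a (snd p)) * (a (fst p) * a (snd p))) +
     (\<Sum>p\<in>{..<r}\<times>{..<r}. (b (fst p) * b (snd p)) * (b (fst p) * b (snd p))) -
     2 * (\<Sum>p\<in>{..<r}\<times>{..<r}. (a (fst p) * a (snd p)) * (b (fst p) * b (snd p)))"
    by (simp add: power2_diff sum.distrib sum_subtractf sum_distrib_left algebra_simps power2_eq_square)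
  then show ?thesis
    unfolding sum_product_square using assms by (simp add: power2_eq_square)
qed

lemma scaled_unit_vector:
  fixes c :: "nat \<Rightarrow> real"
  assumes "r > 0"
  shows "\<exists>s u. (\<Sum>l<r. (u l)\<^sup>2) = 1 \<and> (\<forall>l<r. c l = s * u l)"
proof (cases "(\<Sum>l<r. (c l)\<^sup>2) = 0")
  case True
  then have "\<And>l. l < r \<Longrightarrow> c l = 0"
    by (subst (asm) sum_nonneg_eq_0_iff) auto
  moreover have "(\<Sum>l<r. (if l = 0 then 1 else 0 :: real)\<^sup>2) = 1"
    using assms by (simp add: if_distrib[of "\<lambda>x. x\<^sup>2"] cong: if_cong)
  ultimately show ?thesis
    by (intro exI[of _ 0] exI[of _ "\<lambda>l. if l = 0 then 1 else 0"]) simp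
next
  case False
  define s where "s = sqrt (\<Sum>l<r. (c l)\<^sup>2)"
  have s2: "s\<^sup>2 = (\<Sum>l<r. (c l)\<^sup>2)"
    unfolding s_def by (simp add: sum_nonneg)
  have s0: "s \<noteq> 0"
    using False s2 by auto
  have "(\<Sum>l<r. (c l / s)\<^sup>2) = 1"
    using s0 by (simp add: power_divide sum_divide_distrib[symmetric] s2[symmetric])
  then show ?thesis
    using s0 by (intro exI[of _ s] exI[of _ "\<lambda>l. c l / s"]) simp
qed

text \<open>The heart of the argument. The hypotheses on \<open>D\<close> are one-sided for the row sums and two-sided for the
quadratic form, because the centres below turn the row sums into a nonnegative combination. The noise is paid
for by \<open>(r - 3) * (\<Sum> a i j * (1 - x i j))\<close> alone, so that the other graph term
\<open>\<Sum> a i j * (1 - x i j)^2\<close> is forced to vanish.\<close>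

lemma landscape_edges_aligned:
  fixes A D M :: "nat \<Rightarrow> nat \<Rightarrow> real" and y :: "nat \<Rightarrow> nat \<Rightarrow> real" and \<rho> B lam :: real
  assumes n: "0 < n" and r: "4 \<le> r"
    and unit: "\<And>i. i < n \<Longrightarrow> (\<Sum>l<r. (y i l)\<^sup>2) = 1"
    and x: "\<And>i j. x i j = (\<Sum>l<r. y i l * y j l)"
    and A0: "\<And>i j. i < n \<Longrightarrow> j < n \<Longrightarrow> 0 \<le> A i j"
    and Dsym: "\<And>i j. i < n \<Longrightarrow> j < n \<Longrightarrow> D i j = D j i"
    and M: "\<And>i j. i < n \<Longrightarrow> j < n \<Longrightarrow> i \<noteq> j \<Longrightarrow> A i j + D i j \<le> M i j"
    and gap: "\<And>f. lam * (\<Sum>i<n. (f i - (\<Sum>k<n. f k) / n)\<^sup>2) \<le> (\<Sum>i<n. \<Sum>j<n. A i j * (f i - f j)\<^sup>2) / 2"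
    and form: "\<And>f. \<bar>\<Sum>i<n. \<Sum>j<n. D i j * f i * f j\<bar> \<le> B * (\<Sum>i<n. (f i)\<^sup>2)"
    and rows: "\<And>i. i < n \<Longrightarrow> - \<rho> \<le> (\<Sum>j<n. D i j)"
    and bound: "(real r - 1) * \<rho> + (real r + 3) * B \<le> (real r - 3) * lam"
    and second_order: "(\<Sum>i<n. \<Sum>j<n. M i j * ((1 - x i j) * (real r - 2 - x i j))) \<le> 0"
    and ij: "i < n" "j < n" "A i j \<noteq> 0"
  shows "x i j = 1"
proof -
  define c where "c = (\<lambda>l. (\<Sum>k<n. y k l) / n)"
  \<comment> \<open>If the mean vanishes, \<open>s = 0\<close> and any unit vector \<open>u\<close> will do.\<close>
  obtain s u where u: "(\<Sum>l<r. (u l)\<^sup>2) = 1" and cu: "\<And>l. l < r \<Longrightarrow> c l = s * u l"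
    using scaled_unit_vector[of r c] r by (metis less_le_trans zero_less_numeral)
  define V where "V = (\<lambda>i. \<Sum>l<r. (y i l - c l)\<^sup>2)"
  define L where "L = {..<r} \<times> {..<r}"
  define W where "W = (\<lambda>i. \<Sum>p\<in>L. (y i (fst p) * y i (snd p) - u (fst p) * u (snd p))\<^sup>2)"
  define dev where "dev = (\<Sum>i<n. V i)"
  have half: "1 - x i j = (\<Sum>l<r. (y i l - y j l)\<^sup>2) / 2" if "i < n" "j < n" for i j
    using unit_rows_half_dist[of y i r j] unit that x by simp
  have half2: "1 - (x i j)\<^sup>2 = (\<Sum>p\<in>L. (y i (fst p) * y i (snd p) - y j (fst p) * y j (snd p))\<^sup>2) / 2"
    if "i < n" "j < n" for i j
    using rank_one_dist[of "y i" r "y j"] unit that x L_def by simp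
  have xle: "x i j \<le> 1" if "i < n" "j < n" for i j
  proof -
    have "0 \<le> (\<Sum>l<r. (y i l - y j l)\<^sup>2) / 2" by (simp add: sum_nonneg)
    then show ?thesis using half[OF that] by simp
  qed
  have xii: "x i i = 1" if "i < n" for i
    using unit[OF that] by (simp add: x power2_eq_square)
  have V0: "0 \<le> V i" for i
    unfolding V_def by (simp add: sum_nonneg)
  have WV: "W i \<le> 2 * V i" if "i < n" for i
  proof -
    define t where "t = (\<Sum>l<r. y i l * u l)"
    have "V i = (\<Sum>l<r. (y i l)\<^sup>2 + s\<^sup>2 * (u l)\<^sup>2 - 2 * s * (y i l * u l))"
      unfolding V_def by (intro sum.cong refl) (simp add: cu power2_diff power_mult_distrib algebra_simps)
    also have "\<dots> = 1 + s\<^sup>2 - 2 * s * t"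
      unfolding sum_subtractf sum.distrib sum_distrib_left[symmetric] unit[OF that] u t_def by simp
    finally have V: "V i = 1 + s\<^sup>2 - 2 * s * t" .
    have W: "W i = 2 * (1 - t\<^sup>2)"
      unfolding W_def L_def t_def by (rule rank_one_dist[OF unit[OF that] u])
    have "0 \<le> 2 * (s - t)\<^sup>2" by simp
    also have "\<dots> = 2 * V i - W i"
      unfolding V W by (simp add: power2_eq_square algebra_simps)
    finally show ?thesis by simp
  qed
  have W0: "0 \<le> W i" for i
    unfolding W_def by (simp add: sum_nonneg)
  have B\<rho>: "- \<rho> \<le> B" "0 \<le> B"
  proof -
    have f1: "\<bar>\<Sum>i<n. \<Sum>j<n. D i j\<bar> \<le> B * n"
      using form[of "\<lambda>_. 1"] by simp
    have "real n * (- \<rho>) \<le> (\<Sum>i<n. \<Sum>j<n. D i j)"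
      using sum_mono[of "{..<n}" "\<lambda>_. - \<rho>" "\<lambda>i. \<Sum>j<n. D i j"] rows by simp
    with f1 have "real n * (- \<rho>) \<le> real n * B" by (simp add: mult.commute)
    then show "- \<rho> \<le> B" using n by (metis mult_le_cancel_left_pos of_nat_0_less_iff)
    have "0 \<le> B * n" using f1 by linarith
    then show "0 \<le> B" using n by (simp add: zero_le_mult_iff)
  qed
  have dev0: "0 \<le> dev" unfolding dev_def by (simp add: sum_nonneg V0)
  have devW: "(\<Sum>i<n. W i) \<le> 2 * dev"
    unfolding dev_def sum_distrib_left by (intro sum_mono) (simp add: WV)
  have E1: "(\<Sum>i<n. \<Sum>j<n. D i j * (1 - x i j)) = (\<Sum>i<n. (\<Sum>j<n. D i j) * V i)
      - (\<Sum>l<r. \<Sum>i<n. \<Sum>j<n. D i j * (y i l - c l) * (y j l - c l))"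
    unfolding V_def
    by (rule feature_kernel_sum[OF Dsym half])
  have E2: "(\<Sum>i<n. \<Sum>j<n. D i j * (1 - (x i j)\<^sup>2)) = (\<Sum>i<n. (\<Sum>j<n. D i j) * W i)
      - (\<Sum>p\<in>L. \<Sum>i<n. \<Sum>j<n. D i j * (y i (fst p) * y i (snd p) - u (fst p) * u (snd p))
          * (y j (fst p) * y j (snd p) - u (fst p) * u (snd p)))"
    unfolding W_def
    by (rule feature_kernel_sum[OF Dsym half2])
  have F1: "(\<Sum>l<r. \<Sum>i<n. \<Sum>j<n. D i j * (y i l - c l) * (y j l - c l)) \<le> B * dev"
  proof -
    have "(\<Sum>l<r. \<Sum>i<n. \<Sum>j<n. D i j * (y i l - c l) * (y j l - c l)) \<le>
        (\<Sum>l<r. B * (\<Sum>i<n. (y i l - c l)\<^sup>2))"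
      by (intro sum_mono order.trans[OF abs_ge_self form])
    also have "\<dots> = B * dev"
      unfolding dev_def V_def by (subst sum.swap) (simp add: sum_distrib_left)
    finally show ?thesis .
  qed
  have F2: "(\<Sum>p\<in>L. \<Sum>i<n. \<Sum>j<n. D i j * (y i (fst p) * y i (snd p) - u (fst p) * u (snd p))
          * (y j (fst p) * y j (snd p) - u (fst p) * u (snd p))) \<ge> - (B * (2 * dev))"
  proof -
    have "- (B * (2 * dev)) \<le> - (B * (\<Sum>i<n. W i))"
      using mult_left_mono[OF devW B\<rho>(2)] by simp
    also have "\<dots> = (\<Sum>p\<in>L. - (B * (\<Sum>i<n. (y i (fst p) * y i (snd p) - u (fst p) * u (snd p))\<^sup>2)))"
      unfolding W_def sum_negf sum_distrib_left[symmetric] by (subst sum.swap) (rule refl)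
    also have "\<dots> \<le> (\<Sum>p\<in>L. \<Sum>i<n. \<Sum>j<n. D i j * (y i (fst p) * y i (snd p) - u (fst p) * u (snd p))
          * (y j (fst p) * y j (snd p) - u (fst p) * u (snd p)))"
    proof (rule sum_mono)
      fix p
      show "- (B * (\<Sum>i<n. (y i (fst p) * y i (snd p) - u (fst p) * u (snd p))\<^sup>2)) \<le>
          (\<Sum>i<n. \<Sum>j<n. D i j * (y i (fst p) * y i (snd p) - u (fst p) * u (snd p))
          * (y j (fst p) * y j (snd p) - u (fst p) * u (snd p)))"
        using form[of "\<lambda>i. y i (fst p) * y i (snd p) - u (fst p) * u (snd p)"] by linarith
    qed
    finally show ?thesis .
  qed
  \<comment> \<open>The combined weight of row sum \<open>i\<close>; nonnegative since \<open>W i \<le> 2 * V i\<close> and \<open>r \<ge> 3\<close>.\<close>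
  define a where "a = (\<lambda>i. (real r - 1) * V i - W i)"
  have a0: "0 \<le> a i" if "i < n" for i
  proof -
    have "2 * V i \<le> (real r - 1) * V i" using r V0[of i] by (intro mult_right_mono) auto
    then show ?thesis unfolding a_def using WV[OF that] by linarith
  qed
  have "- \<rho> * (\<Sum>i<n. a i) \<le> (\<Sum>i<n. (\<Sum>j<n. D i j) * a i)"
    unfolding sum_distrib_left by (intro sum_mono mult_right_mono rows a0) auto
  also have "\<dots> = (real r - 1) * (\<Sum>i<n. (\<Sum>j<n. D i j) * V i) - (\<Sum>i<n. (\<Sum>j<n. D i j) * W i)"
    unfolding a_def by (simp add: sum_subtractf sum_distrib_left right_diff_distrib mult.left_commute)
  finally have R1: "- \<rho> * (\<Sum>i<n. a i) \<le>
    (real r - 1) * (\<Sum>i<n. (\<Sum>j<n. D i j) * V i) - (\<Sum>i<n. (\<Sum>j<n. D i j) * W i)" .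
  have sa: "(\<Sum>i<n. a i) = (real r - 1) * dev - (\<Sum>i<n. W i)"
    unfolding a_def dev_def by (simp add: sum_subtractf sum_distrib_left)
  have sW0: "0 \<le> (\<Sum>i<n. W i)" by (simp add: sum_nonneg W0)
  \<comment> \<open>\<open>\<rho>\<close> may be negative, but not below \<open>- B\<close>, so replacing the sum of the weights by its maximum costs little.\<close>
  have R2: "- \<rho> * (real r - 1) * dev - 2 * B * dev \<le> - \<rho> * (\<Sum>i<n. a i)"
  proof -
    have "- \<rho> * (\<Sum>i<n. W i) \<le> B * (\<Sum>i<n. W i)"
      using B\<rho>(1) sW0 by (rule mult_right_mono)
    also have "\<dots> \<le> B * (2 * dev)" using devW B\<rho>(2) by (rule mult_left_mono)
    finally show ?thesis unfolding sa by (simp add: algebra_simps)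
  qed
  have Dpart: "(\<Sum>i<n. \<Sum>j<n. D i j * ((1 - x i j) * (real r - 2 - x i j))) \<ge>
      - ((real r - 1) * \<rho> + (real r + 3) * B) * dev"
  proof -
    have "(\<Sum>i<n. \<Sum>j<n. D i j * ((1 - x i j) * (real r - 2 - x i j))) =
      (real r - 1) * (\<Sum>i<n. \<Sum>j<n. D i j * (1 - x i j)) - (\<Sum>i<n. \<Sum>j<n. D i j * (1 - (x i j)\<^sup>2))"
    proof -
      have "D i j * ((1 - x i j) * (real r - 2 - x i j)) =
          (real r - 1) * (D i j * (1 - x i j)) - D i j * (1 - (x i j)\<^sup>2)" for i j
        by (simp add: algebra_simps power2_eq_square)
      then show ?thesis
        by (simp only: sum_subtractf sum_distrib_left)
    qed
    moreover have "(real r - 1) * (\<Sum>l<r. \<Sum>i<n. \<Sum>j<n. D i j * (y i l - c l) * (y j l - c l))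
        \<le> (real r - 1) * (B * dev)"
      using F1 r by (intro mult_left_mono) auto
    ultimately have "(\<Sum>i<n. \<Sum>j<n. D i j * ((1 - x i j) * (real r - 2 - x i j))) \<ge>
        (real r - 1) * (\<Sum>i<n. (\<Sum>j<n. D i j) * V i) - (real r - 1) * (B * dev)
        - (\<Sum>i<n. (\<Sum>j<n. D i j) * W i) - B * (2 * dev)"
      unfolding E1 E2 right_diff_distrib[of "real r - 1"] using F2 by linarith
    with R1 R2 have "(\<Sum>i<n. \<Sum>j<n. D i j * ((1 - x i j) * (real r - 2 - x i j))) \<ge>
        - \<rho> * (real r - 1) * dev - 2 * B * dev - (real r - 1) * (B * dev) - B * (2 * dev)"
      by linarith
    also have "- \<rho> * (real r - 1) * dev - 2 * B * dev - (real r - 1) * (B * dev) - B * (2 * dev) =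
        - ((real r - 1) * \<rho> + (real r + 3) * B) * dev"
      by (simp add: algebra_simps)
    finally show ?thesis .
  qed
  have Apart: "lam * dev \<le> (\<Sum>i<n. \<Sum>j<n. A i j * (1 - x i j))"
  proof -
    have "lam * dev = (\<Sum>l<r. lam * (\<Sum>i<n. (y i l - (\<Sum>k<n. y k l) / n)\<^sup>2))"
      unfolding dev_def V_def c_def by (subst sum.swap) (simp add: sum_distrib_left)
    also have "\<dots> \<le> (\<Sum>l<r. (\<Sum>i<n. \<Sum>j<n. A i j * (y i l - y j l)\<^sup>2) / 2)"
      by (intro sum_mono gap)
    also have "\<dots> = (\<Sum>i<n. \<Sum>j<n. \<Sum>l<r. A i j * (y i l - y j l)\<^sup>2 / 2)"
      unfolding sum_divide_distrib sum.swap[of _ "{..<n}" "{..<r}"] by (rule refl)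
    also have "\<dots> = (\<Sum>i<n. \<Sum>j<n. A i j * (1 - x i j))"
    proof (intro sum.cong refl)
      fix i j assume "i \<in> {..<n}" "j \<in> {..<n}"
      then have "1 - x i j = (\<Sum>l<r. (y i l - y j l)\<^sup>2) / 2"
        using half by simp
      then show "(\<Sum>l<r. A i j * (y i l - y j l)\<^sup>2 / 2) = A i j * (1 - x i j)"
        by (simp add: sum_distrib_left sum_divide_distrib)
    qed
    finally show ?thesis .
  qed
  have pos: "0 \<le> (1 - x i j) * (real r - 2 - x i j)" if "i < n" "j < n" for i j
    using xle[OF that] r by simp
  have "(\<Sum>i<n. \<Sum>j<n. (A i j + D i j) * ((1 - x i j) * (real r - 2 - x i j))) \<le>
      (\<Sum>i<n. \<Sum>j<n. M i j * ((1 - x i j) * (real r - 2 - x i j)))"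
  proof (intro sum_mono)
    fix i j assume "i \<in> {..<n}" "j \<in> {..<n}"
    then show "(A i j + D i j) * ((1 - x i j) * (real r - 2 - x i j)) \<le>
        M i j * ((1 - x i j) * (real r - 2 - x i j))"
      using M[of i j] pos[of i j] xii[of i] by (cases "i = j") (auto intro: mult_right_mono)
  qed
  also have "\<dots> \<le> 0" by (rule second_order)
  also have "(\<Sum>i<n. \<Sum>j<n. (A i j + D i j) * ((1 - x i j) * (real r - 2 - x i j))) =
      (real r - 3) * (\<Sum>i<n. \<Sum>j<n. A i j * (1 - x i j)) + (\<Sum>i<n. \<Sum>j<n. A i j * (1 - x i j)\<^sup>2)
      + (\<Sum>i<n. \<Sum>j<n. D i j * ((1 - x i j) * (real r - 2 - x i j)))"
  proof -
    have "(A i j + D i j) * ((1 - x i j) * (real r - 2 - x i j)) =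
        (real r - 3) * (A i j * (1 - x i j)) + A i j * (1 - x i j)\<^sup>2
        + D i j * ((1 - x i j) * (real r - 2 - x i j))" for i j
      by (simp add: algebra_simps power2_eq_square)
    then show ?thesis
      by (simp only: sum.distrib sum_distrib_left)
  qed
  finally have total: "(real r - 3) * (\<Sum>i<n. \<Sum>j<n. A i j * (1 - x i j)) + (\<Sum>i<n. \<Sum>j<n. A i j * (1 - x i j)\<^sup>2)
      + (\<Sum>i<n. \<Sum>j<n. D i j * ((1 - x i j) * (real r - 2 - x i j))) \<le> 0" .
  have "(real r - 3) * (lam * dev) \<le> (real r - 3) * (\<Sum>i<n. \<Sum>j<n. A i j * (1 - x i j))"
    using Apart r by (intro mult_left_mono) auto
  moreover have "((real r - 1) * \<rho> + (real r + 3) * B) * dev \<le> (real r - 3) * lam * dev"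
    using bound B\<rho>(2) by (intro mult_right_mono dev0) (auto simp: algebra_simps)
  ultimately have "(\<Sum>i<n. \<Sum>j<n. A i j * (1 - x i j)\<^sup>2) \<le> 0"
    using total Dpart unfolding mult.assoc minus_mult_left[symmetric] by linarith
  moreover have nonneg: "0 \<le> A i j * (1 - x i j)\<^sup>2" if "i < n" "j < n" for i j
    using A0[OF that] by simp
  moreover have "0 \<le> (\<Sum>i<n. \<Sum>j<n. A i j * (1 - x i j)\<^sup>2)"
    by (intro sum_nonneg nonneg) auto
  ultimately have "(\<Sum>i<n. \<Sum>j<n. A i j * (1 - x i j)\<^sup>2) = 0"
    by linarith
  then have "(\<Sum>j<n. A i j * (1 - x i j)\<^sup>2) = 0"
    using ij by (subst (asm) sum_nonneg_eq_0_iff) (auto intro!: sum_nonneg nonneg simp del: zero_le_mult_iff mult_nonneg_nonneg)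
  then have "A i j * (1 - x i j)\<^sup>2 = 0"
    using ij by (subst (asm) sum_nonneg_eq_0_iff) (auto intro!: nonneg)
  then show ?thesis
    using ij by simp
qed

section \<open>Algebraic connectivity as a spectral gap\<close>

text \<open>Half the sum over ordered pairs, which for a symmetric weight is the quadratic form of the graph Laplacian.\<close>

definition dirichlet_form :: "nat \<Rightarrow> (nat \<Rightarrow> nat \<Rightarrow> real) \<Rightarrow> (nat \<Rightarrow> real) \<Rightarrow> real" where
  "dirichlet_form n a f = (\<Sum>i<n. \<Sum>j<n. a i j * (f i - f j)\<^sup>2) / 2"

lemma dirichlet_form_nonneg:
  assumes "\<And>i j. i < n \<Longrightarrow> j < n \<Longrightarrow> 0 \<le> a i j"
  shows "0 \<le> dirichlet_form n a f"
  unfolding dirichlet_form_def using assms by (intro divide_nonneg_pos sum_nonneg) auto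

lemma dirichlet_form_scale: "dirichlet_form n a (\<lambda>i. c * f i) = c\<^sup>2 * dirichlet_form n a f"
proof -
  have "a i j * (c * f i - c * f j)\<^sup>2 = c\<^sup>2 * (a i j * (f i - f j)\<^sup>2)" for i j
    by (simp add: power2_eq_square algebra_simps)
  then show ?thesis
    by (simp only: dirichlet_form_def sum_distrib_left times_divide_eq_right)
qed

lemma dirichlet_form_perturb:
  assumes sym: "\<And>i j. i < n \<Longrightarrow> j < n \<Longrightarrow> a i j = a j i"
  shows "dirichlet_form n a (\<lambda>i. v i + t * h i) = dirichlet_form n a v
    + 2 * t * (\<Sum>i<n. h i * (\<Sum>j<n. a i j * (v i - v j))) + t\<^sup>2 * dirichlet_form n a h"
proof -
  have "(\<Sum>i<n. \<Sum>j<n. a i j * (v i - v j) * h j) = (\<Sum>j<n. \<Sum>i<n. a i j * (v i - v j) * h j)"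
    by (rule sum.swap)
  also have "\<dots> = (\<Sum>i<n. \<Sum>j<n. - (a i j * (v i - v j) * h i))"
    by (intro sum.cong refl) (simp add: sym algebra_simps)
  finally have sw: "(\<Sum>i<n. \<Sum>j<n. a i j * (v i - v j) * h j) = - (\<Sum>i<n. \<Sum>j<n. a i j * (v i - v j) * h i)"
    by (simp add: sum_negf)
  have "a i j * ((v i + t * h i) - (v j + t * h j))\<^sup>2 = a i j * (v i - v j)\<^sup>2
      + 2 * t * (a i j * (v i - v j) * h i) - 2 * t * (a i j * (v i - v j) * h j)
      + t\<^sup>2 * (a i j * (h i - h j)\<^sup>2)" for i j
    by (simp add: power2_eq_square algebra_simps)
  then have "(\<Sum>i<n. \<Sum>j<n. a i j * ((v i + t * h i) - (v j + t * h j))\<^sup>2) =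
      (\<Sum>i<n. \<Sum>j<n. a i j * (v i - v j)\<^sup>2)
      + 2 * t * (\<Sum>i<n. \<Sum>j<n. a i j * (v i - v j) * h i)
      - 2 * t * (\<Sum>i<n. \<Sum>j<n. a i j * (v i - v j) * h j)
      + t\<^sup>2 * (\<Sum>i<n. \<Sum>j<n. a i j * (h i - h j)\<^sup>2)"
    by (simp only: sum.distrib sum_subtractf sum_distrib_left)
  moreover have "(\<Sum>i<n. \<Sum>j<n. a i j * (v i - v j) * h i) = (\<Sum>i<n. h i * (\<Sum>j<n. a i j * (v i - v j)))"
    by (simp add: sum_distrib_left mult_ac)
  ultimately show ?thesis
    unfolding dirichlet_form_def sw by (simp add: field_simps)
qed

text \<open>The second eigenvalue is reached through its variational description: a continuous function attains its
minimum over the compact set of unit vectors orthogonal to the constants. Functions vanishing outside \<open>{..<n}\<close>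
stand for vectors, so compactness comes from Tychonoff's theorem.\<close>

lemma dirichlet_form_minimizer:
  assumes n: "2 \<le> n"
  shows "\<exists>v. (\<Sum>i<n. v i) = 0 \<and> (\<Sum>i<n. (v i)\<^sup>2) = 1 \<and>
    (\<forall>f. (\<Sum>i<n. f i) = 0 \<longrightarrow> dirichlet_form n a v * (\<Sum>i<n. (f i)\<^sup>2) \<le> dirichlet_form n a f)"
proof -
  define K where "K = PiE UNIV (\<lambda>i. if i < n then {-1..1} else {0 :: real})"
  define S where "S = K \<inter> ({f. (\<Sum>i<n. f i) = 0} \<inter> {f. (\<Sum>i<n. (f i)\<^sup>2) = 1})"
  have "compactin (product_topology (\<lambda>_. euclidean) UNIV) K"
    unfolding K_def compactin_PiE by simp
  then have "compact K"
    by (simp add: euclidean_product_topology)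
  moreover have "closed ({f::nat \<Rightarrow> real. (\<Sum>i<n. f i) = 0} \<inter> {f. (\<Sum>i<n. (f i)\<^sup>2) = 1})"
    by (intro closed_Int closed_Collect_eq continuous_intros) auto
  ultimately have "compact S"
    unfolding S_def by (rule compact_Int_closed)
  moreover have "S \<noteq> {}"
  proof -
    define e where "e = (\<lambda>i::nat. if i = 0 then 1 / sqrt 2 else if i = 1 then - 1 / sqrt 2 else 0 :: real)"
    have s: "sum g {..<n} = g 0 + g 1" if "\<And>i. 1 < i \<Longrightarrow> g i = 0" for g :: "nat \<Rightarrow> real"
    proof -
      have "sum g {..<n} = sum g {0, 1}"
        using n that by (intro sum.mono_neutral_right) auto
      then show ?thesis by simp
    qed
    have "- 1 \<le> 1 / sqrt (2 :: real)"
      by (rule order.trans[of _ 0]) auto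
    then have "e \<in> S"
      unfolding S_def K_def using n by (auto simp: s e_def power_divide)
    then show ?thesis by blast
  qed
  moreover have "continuous_on S (dirichlet_form n a)"
    unfolding dirichlet_form_def
    by (intro continuous_intros continuous_on_subset[OF continuous_on_product_coordinates]) auto
  ultimately have "\<exists>v\<in>S. \<forall>w\<in>S. dirichlet_form n a v \<le> dirichlet_form n a w"
    by (rule continuous_attains_inf)
  then obtain v where v: "v \<in> S" "\<And>w. w \<in> S \<Longrightarrow> dirichlet_form n a v \<le> dirichlet_form n a w"
    by blast
  have "dirichlet_form n a v * (\<Sum>i<n. (f i)\<^sup>2) \<le> dirichlet_form n a f" if f: "(\<Sum>i<n. f i) = 0" for f
  proof (cases "(\<Sum>i<n. (f i)\<^sup>2) = 0")
    case True
    then have "\<forall>i<n. f i = 0"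
      by (subst (asm) sum_nonneg_eq_0_iff) auto
    then have "dirichlet_form n a f = 0"
      by (simp add: dirichlet_form_def)
    then show ?thesis using True by simp
  next
    case False
    define c where "c = sqrt (\<Sum>i<n. (f i)\<^sup>2)"
    have c2: "c\<^sup>2 = (\<Sum>i<n. (f i)\<^sup>2)"
      unfolding c_def by (simp add: sum_nonneg)
    have c0: "c \<noteq> 0" using False c2 by auto
    define w where "w = (\<lambda>i. if i < n then (1 / c) * f i else 0)"
    have w1: "(\<Sum>i<n. (w i)\<^sup>2) = 1"
      using c0 by (simp add: w_def power_divide sum_divide_distrib[symmetric] c2[symmetric])
    have "w i \<in> (if i < n then {-1..1} else {0})" for i
    proof (cases "i < n")
      case True
      have "(w i)\<^sup>2 \<le> (\<Sum>i<n. (w i)\<^sup>2)"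
        using True by (intro member_le_sum) auto
      then have "\<bar>w i\<bar> \<le> 1"
        unfolding w1 by (simp add: abs_square_le_1)
      then show ?thesis using True by auto
    qed (simp add: w_def)
    then have "w \<in> K"
      unfolding K_def PiE_UNIV_domain by blast
    moreover have "(\<Sum>i<n. w i) = 0"
      using f by (simp add: w_def sum_divide_distrib[symmetric])
    ultimately have "w \<in> S"
      using w1 by (simp add: S_def)
    then have "dirichlet_form n a v \<le> dirichlet_form n a w" by (rule v(2))
    also have "\<dots> = dirichlet_form n a (\<lambda>i. (1 / c) * f i)"
      by (simp add: dirichlet_form_def w_def)
    also have "\<dots> = dirichlet_form n a f / c\<^sup>2"
      unfolding dirichlet_form_scale by (simp add: power_divide)
    finally show ?thesis
      unfolding c2[symmetric] using c0 by (simp add: field_simps)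
  qed
  then show ?thesis
    using v(1) by (auto simp: S_def)
qed

lemma linear_quadratic_nonneg_imp_zero:
  fixes p q :: real
  assumes "\<And>t. 0 \<le> 2 * t * p + t\<^sup>2 * q"
  shows "p = 0"
proof (rule ccontr)
  assume p: "p \<noteq> 0"
  define t where "t = - p / (\<bar>q\<bar> + 1)"
  have "0 \<le> 2 * t * p + t\<^sup>2 * q" by (rule assms)
  also have "t\<^sup>2 * q \<le> t\<^sup>2 * (\<bar>q\<bar> + 1)" by (intro mult_left_mono) auto
  also have "2 * t * p + t\<^sup>2 * (\<bar>q\<bar> + 1) = - p\<^sup>2 / (\<bar>q\<bar> + 1)"
    unfolding t_def by (simp add: power2_eq_square divide_simps)
  also have "\<dots> < 0" using p by (simp add: divide_neg_pos)
  finally show False by simp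
qed

text \<open>First-order optimality: the residual \<open>h\<close> of the eigenvalue equation is itself orthogonal to the constants,
so it is an admissible variation and must be orthogonal to itself.\<close>

lemma dirichlet_form_minimizer_eigenvector:
  assumes sym: "\<And>i j. i < n \<Longrightarrow> j < n \<Longrightarrow> a i j = a j i"
    and v0: "(\<Sum>i<n. v i) = 0" and v1: "(\<Sum>i<n. (v i)\<^sup>2) = 1"
    and min: "\<And>f. (\<Sum>i<n. f i) = 0 \<Longrightarrow> dirichlet_form n a v * (\<Sum>i<n. (f i)\<^sup>2) \<le> dirichlet_form n a f"
    and i: "i < n"
  shows "(\<Sum>j<n. a i j * (v i - v j)) = dirichlet_form n a v * v i"
proof -
  define \<mu> where "\<mu> = dirichlet_form n a v"
  define h where "h = (\<lambda>i. (\<Sum>j<n. a i j * (v i - v j)) - \<mu> * v i)"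
  have "(\<Sum>i<n. \<Sum>j<n. a i j * v j) = (\<Sum>j<n. \<Sum>i<n. a i j * v j)"
    by (rule sum.swap)
  also have "\<dots> = (\<Sum>i<n. \<Sum>j<n. a i j * v i)"
    by (intro sum.cong refl) (simp add: sym)
  finally have h0: "(\<Sum>i<n. h i) = 0"
    unfolding h_def by (simp add: sum_subtractf right_diff_distrib sum_distrib_left[symmetric] v0)
  have "(h i)\<^sup>2 = h i * (\<Sum>j<n. a i j * (v i - v j)) - \<mu> * (h i * v i)" for i
    unfolding power2_eq_square by (subst (2) h_def) (simp add: right_diff_distrib)
  then have "(\<Sum>i<n. (h i)\<^sup>2) = (\<Sum>i<n. h i * (\<Sum>j<n. a i j * (v i - v j))) - \<mu> * (\<Sum>i<n. h i * v i)"
    by (simp only: sum_subtractf sum_distrib_left)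
  moreover have "(\<Sum>i<n. h i * (\<Sum>j<n. a i j * (v i - v j))) - \<mu> * (\<Sum>i<n. h i * v i) = 0"
  proof (rule linear_quadratic_nonneg_imp_zero)
    fix t :: real
    have s: "(\<Sum>i<n. (v i + t * h i)\<^sup>2) = 1 + 2 * t * (\<Sum>i<n. h i * v i) + t\<^sup>2 * (\<Sum>i<n. (h i)\<^sup>2)"
      unfolding v1[symmetric]
      by (simp add: power2_sum power_mult_distrib sum.distrib sum_distrib_left mult_ac)
    have z: "(\<Sum>i<n. v i + t * h i) = 0"
      by (simp add: sum.distrib sum_distrib_left[symmetric] v0 h0)
    have e: "dirichlet_form n a (\<lambda>i. v i + t * h i) = \<mu>
        + 2 * t * (\<Sum>i<n. h i * (\<Sum>j<n. a i j * (v i - v j))) + t\<^sup>2 * dirichlet_form n a h"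
      unfolding \<mu>_def by (rule dirichlet_form_perturb) (rule sym)
    from min[OF z] have "\<mu> * (1 + 2 * t * (\<Sum>i<n. h i * v i) + t\<^sup>2 * (\<Sum>i<n. (h i)\<^sup>2)) \<le>
        \<mu> + 2 * t * (\<Sum>i<n. h i * (\<Sum>j<n. a i j * (v i - v j))) + t\<^sup>2 * dirichlet_form n a h"
      unfolding s e \<mu>_def[symmetric] by simp
    then show "0 \<le> 2 * t * ((\<Sum>i<n. h i * (\<Sum>j<n. a i j * (v i - v j))) - \<mu> * (\<Sum>i<n. h i * v i))
        + t\<^sup>2 * (dirichlet_form n a h - \<mu> * (\<Sum>i<n. (h i)\<^sup>2))"
      by (simp add: algebra_simps)
  qed
  ultimately have "(\<Sum>i<n. (h i)\<^sup>2) = 0" by simp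
  then have "h i = 0"
    using i by (subst (asm) sum_nonneg_eq_0_iff) auto
  then show ?thesis
    by (simp add: h_def \<mu>_def)
qed

lemma laplacian_eigenvalueI:
  assumes A: "A \<in> carrier_mat n n" and nz: "k < n" "v k \<noteq> 0"
    and eig: "\<And>i. i < n \<Longrightarrow> (\<Sum>j<n. A $$ (i, j) * (v i - v j)) = \<mu> * v i"
  shows "poly (char_poly (laplacian A)) \<mu> = 0"
proof -
  have L: "laplacian A \<in> carrier_mat n n"
    using A unfolding laplacian_def diagm_def mat_diag_def by auto
  have "eigenvector (laplacian A) (vec n v) \<mu>"
    unfolding eigenvector_def
  proof (intro conjI)
    show "vec n v \<in> carrier_vec (dim_row (laplacian A))" using L by simp
    show "vec n v \<noteq> 0\<^sub>v (dim_row (laplacian A))"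
      using L nz by (metis carrier_matD(1) index_vec index_zero_vec(1))
    show "laplacian A *\<^sub>v vec n v = \<mu> \<cdot>\<^sub>v vec n v"
    proof (rule eq_vecI)
      fix i assume "i < dim_vec (\<mu> \<cdot>\<^sub>v vec n v)"
      then have i: "i < n" by simp
      have row: "laplacian A $$ (i, j) = (if i = j then (\<Sum>k<n. A $$ (i, k)) else 0) - A $$ (i, j)" if "j < n" for j
        using A i that
        by (auto simp: laplacian_def diagm_def mat_diag_def ones_vec_def scalar_prod_def atLeast0LessThan)
      have "(laplacian A *\<^sub>v vec n v) $ i = (\<Sum>j<n. laplacian A $$ (i, j) * v j)"
        using L i by (simp add: scalar_prod_def atLeast0LessThan)
      also have "\<dots> = (\<Sum>j<n. (if i = j then (\<Sum>k<n. A $$ (i, k)) * v i else 0) - A $$ (i, j) * v j)"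
        by (intro sum.cong refl) (auto simp: row left_diff_distrib)
      also have "\<dots> = (\<Sum>j<n. A $$ (i, j) * (v i - v j))"
        using i by (simp add: sum_subtractf sum_distrib_right right_diff_distrib)
      finally show "(laplacian A *\<^sub>v vec n v) $ i = (\<mu> \<cdot>\<^sub>v vec n v) $ i"
        using i eig by simp
    qed (use L in simp)
  qed
  then show ?thesis
    using eigenvalue_root_char_poly[OF L] by (auto simp: eigenvalue_def)
qed

text \<open>Only that \<open>a\<close> and \<open>b\<close> occur in the list is known, not their positions; \<open>b\<close> cannot come first because \<open>a\<close> is
smaller.\<close>

lemma sorted_second_le:
  fixes xs :: "real list"
  assumes "sorted xs" "a \<in> set xs" "b \<in> set xs" "a < b"
  shows "xs ! 1 \<le> b"
proof -
  obtain k l where k: "k < length xs" "xs ! k = b" and l: "l < length xs" "xs ! l = a"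
    using assms(2,3) by (meson in_set_conv_nth)
  have "k \<noteq> 0"
  proof
    assume "k = 0"
    then have "b \<le> a" using sorted_nth_mono[OF assms(1), of 0 l] k l by simp
    then show False using assms(4) by simp
  qed
  then show ?thesis
    using sorted_nth_mono[OF assms(1), of 1 k] k by simp
qed

lemma rtrancl_constant:
  assumes "(i, j) \<in> R\<^sup>*" and "\<And>i j. (i, j) \<in> R \<Longrightarrow> g i = g j"
  shows "g i = g j"
  using assms(1) by (induction rule: rtrancl_induct) (auto dest: assms(2))

text \<open>Connectivity makes the constrained minimum \<open>\<mu>\<close> positive, hence different from the eigenvalue \<open>0\<close> of the
constants. Two distinct eigenvalues \<open>0 < \<mu>\<close> already bound the second entry of the sorted list by \<open>\<mu>\<close>, without
any knowledge of multiplicities. For a single vertex both sides vanish.\<close>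

lemma algebraic_connectivity_gap:
  assumes A: "adjacency_mat n A" and conn: "connected_adj n A"
  shows "algebraic_connectivity A * (\<Sum>i<n. (f i - (\<Sum>k<n. f k) / n)\<^sup>2) \<le>
    dirichlet_form n (\<lambda>i j. A $$ (i, j)) f"
proof (cases "2 \<le> n")
  case False
  then consider "n = 0" | "n = 1" by linarith
  then show ?thesis
    by cases (simp_all add: dirichlet_form_def)
next
  case True
  let ?a = "\<lambda>i j. A $$ (i, j)"
  have Ac: "A \<in> carrier_mat n n" and sym: "\<And>i j. i < n \<Longrightarrow> j < n \<Longrightarrow> ?a i j = ?a j i"
    and nonneg: "\<And>i j. i < n \<Longrightarrow> j < n \<Longrightarrow> 0 \<le> ?a i j"
    using A by (auto simp: adjacency_mat_def sym_mat_def) (metis carrier_matD index_transpose_mat(1))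
  obtain v where v0: "(\<Sum>i<n. v i) = 0" and v1: "(\<Sum>i<n. (v i)\<^sup>2) = 1"
    and min: "\<And>f. (\<Sum>i<n. f i) = 0 \<Longrightarrow> dirichlet_form n ?a v * (\<Sum>i<n. (f i)\<^sup>2) \<le> dirichlet_form n ?a f"
    using dirichlet_form_minimizer[OF True, of ?a] by blast
  define \<mu> where "\<mu> = dirichlet_form n ?a v"
  have "0 \<le> \<mu>"
    unfolding \<mu>_def by (rule dirichlet_form_nonneg[OF nonneg])
  moreover have "\<mu> \<noteq> 0"
  proof
    assume "\<mu> = 0"
    then have 0: "(\<Sum>i<n. \<Sum>j<n. ?a i j * (v i - v j)\<^sup>2) = 0"
      by (simp add: \<mu>_def dirichlet_form_def)
    have edge: "v i = v j" if "i < n" "j < n" "?a i j \<noteq> 0" for i j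
    proof -
      have nn: "0 \<le> ?a i j * (v i - v j)\<^sup>2" if "i < n" "j < n" for i j
        using nonneg[OF that] by simp
      have "(\<Sum>j<n. ?a i j * (v i - v j)\<^sup>2) = 0"
        using 0 \<open>i < n\<close> by (subst (asm) sum_nonneg_eq_0_iff) (auto intro!: sum_nonneg nonneg mult_nonneg_nonneg)
      then have "?a i j * (v i - v j)\<^sup>2 = 0"
        using \<open>i < n\<close> \<open>j < n\<close> by (subst (asm) sum_nonneg_eq_0_iff) (auto intro!: nonneg mult_nonneg_nonneg)
      then show ?thesis using that by simp
    qed
    have const: "v i = v 0" if "i < n" for i
    proof (rule rtrancl_constant[where g = v])
      show "(i, 0) \<in> {(k, l). k < n \<and> l < n \<and> A $$ (k, l) \<noteq> 0}\<^sup>*"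
        using conn that True by (simp add: connected_adj_def)
    qed (auto simp only: mem_Collect_eq case_prod_conv intro: edge)
    have "(\<Sum>i<n. v i) = (\<Sum>i<n. v 0)"
      by (intro sum.cong refl) (rule const, simp)
    then have "v 0 = 0"
      using v0 True by simp
    then have "(\<Sum>i<n. (v i)\<^sup>2) = (\<Sum>i<n. 0)"
      by (intro sum.cong refl) (metis const lessThan_iff power_zero_numeral)
    then show False using v1 by simp
  qed
  ultimately have \<mu>: "0 < \<mu>" by simp
  have "\<exists>k<n. v k \<noteq> 0"
  proof (rule ccontr)
    assume "\<not> (\<exists>k<n. v k \<noteq> 0)"
    then have "(\<Sum>i<n. (v i)\<^sup>2) = 0" by simp
    then show False using v1 by simp
  qed
  then obtain k where "k < n" "v k \<noteq> 0" by blast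
  then have r\<mu>: "poly (char_poly (laplacian A)) \<mu> = 0"
    unfolding \<mu>_def
    by (intro laplacian_eigenvalueI[OF Ac, of k v] dirichlet_form_minimizer_eigenvector[OF sym v0 v1 min])
  have r0: "poly (char_poly (laplacian A)) 0 = 0"
    using True by (intro laplacian_eigenvalueI[OF Ac, of 0 "\<lambda>_. 1"]) auto
  have L: "laplacian A \<in> carrier_mat n n"
    using Ac unfolding laplacian_def diagm_def mat_diag_def by auto
  have cp: "char_poly (laplacian A) \<noteq> 0"
    using degree_monic_char_poly[OF L] by auto
  have "algebraic_connectivity A \<le> \<mu>"
    unfolding algebraic_connectivity_def sorted_eigenvalues_def
    by (rule sorted_second_le[of _ 0]) (use \<mu> r0 r\<mu> cp in auto)
  then have "algebraic_connectivity A * (\<Sum>i<n. (f i - (\<Sum>k<n. f k) / n)\<^sup>2) \<le>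
      \<mu> * (\<Sum>i<n. (f i - (\<Sum>k<n. f k) / n)\<^sup>2)"
    by (intro mult_right_mono sum_nonneg) auto
  also have "\<dots> \<le> dirichlet_form n ?a (\<lambda>i. f i - (\<Sum>k<n. f k) / n)"
    unfolding \<mu>_def using True by (intro min) (simp add: sum_subtractf)
  also have "\<dots> = dirichlet_form n ?a f"
    by (simp add: dirichlet_form_def)
  finally show ?thesis .
qed

section \<open>Deterministic criteria for the landscape\<close>

text \<open>The supremum defining \<open>op_norm\<close> is over a bounded set, by the Frobenius norm; without that it would be
unspecified.\<close>

lemma abs_quadratic_form_le_op_norm:
  assumes D: "D \<in> carrier_mat n n"
  shows "\<bar>\<Sum>i<n. \<Sum>j<n. D $$ (i, j) * f i * f j\<bar> \<le> op_norm D * (\<Sum>i<n. (f i)\<^sup>2)"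
    and "0 \<le> op_norm D"
proof -
  have norm2: "(l2_norm (vec n g))\<^sup>2 = (\<Sum>i<n. (g i)\<^sup>2)" for g
    by (simp add: l2_norm_def scalar_prod_def atLeast0LessThan power2_eq_square sum_nonneg)
  have ent: "D *\<^sub>v vec n g = vec n (\<lambda>i. \<Sum>j<n. D $$ (i, j) * g j)" for g
    using D by (intro eq_vecI) (auto simp: scalar_prod_def atLeast0LessThan)
  have nonneg: "0 \<le> l2_norm v" for v
    unfolding l2_norm_def by (auto simp: scalar_prod_def intro!: sum_nonneg)
  define F where "F = (\<Sum>i<n. \<Sum>j<n. (D $$ (i, j))\<^sup>2)"
  have F0: "0 \<le> F" unfolding F_def by (simp add: sum_nonneg)
  let ?S = "{x \<in> carrier_vec (dim_col D). l2_norm x \<le> 1}"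
  have bdd: "bdd_above ((\<lambda>x. l2_norm (D *\<^sub>v x)) ` ?S)"
  proof (rule bdd_aboveI2)
    fix x assume x: "x \<in> ?S"
    define g where "g = (\<lambda>i. x $ i)"
    have xg: "x = vec n g"
      using x D by (auto simp: g_def)
    have "(l2_norm (D *\<^sub>v x))\<^sup>2 = (\<Sum>i<n. (\<Sum>j<n. D $$ (i, j) * g j)\<^sup>2)"
      unfolding xg ent norm2 ..
    also have "\<dots> \<le> (\<Sum>i<n. (\<Sum>j<n. (D $$ (i, j))\<^sup>2) * (\<Sum>j<n. (g j)\<^sup>2))"
      by (intro sum_mono Cauchy_Schwarz_ineq_sum)
    also have "\<dots> = F * (l2_norm x)\<^sup>2"
      unfolding F_def xg norm2 by (simp add: sum_distrib_right)
    also have "\<dots> \<le> F * 1"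
      using x nonneg[of x] F0 by (intro mult_left_mono power_le_one) auto
    finally show "l2_norm (D *\<^sub>v x) \<le> sqrt F"
      by (simp add: real_le_rsqrt)
  qed
  have "l2_norm (D *\<^sub>v vec n (\<lambda>_. 0)) \<le> op_norm D"
    unfolding op_norm_def using D
    by (intro cSUP_upper bdd) (auto simp: l2_norm_def scalar_prod_def)
  then show "0 \<le> op_norm D"
    using nonneg[of "D *\<^sub>v vec n (\<lambda>_. 0)"] by linarith
  show "\<bar>\<Sum>i<n. \<Sum>j<n. D $$ (i, j) * f i * f j\<bar> \<le> op_norm D * (\<Sum>i<n. (f i)\<^sup>2)"
  proof (cases "(\<Sum>i<n. (f i)\<^sup>2) = 0")
    case True
    then have "\<forall>i<n. f i = 0"
      by (subst (asm) sum_nonneg_eq_0_iff) auto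
    then show ?thesis by simp
  next
    case False
    define c where "c = sqrt (\<Sum>i<n. (f i)\<^sup>2)"
    have c2: "c\<^sup>2 = (\<Sum>i<n. (f i)\<^sup>2)"
      unfolding c_def by (simp add: sum_nonneg)
    have c0: "0 < c"
      using False unfolding c_def by (simp add: sum_nonneg order_less_le)
    define g where "g = (\<lambda>i. f i / c)"
    have g1: "(\<Sum>i<n. (g i)\<^sup>2) = 1"
      using c0 by (simp add: g_def power_divide sum_divide_distrib[symmetric] c2[symmetric])
    have "vec n g \<in> ?S"
      using D g1 norm2[of g] nonneg[of "vec n g"] by (simp add: power2_eq_1_iff)
    then have le: "l2_norm (D *\<^sub>v vec n g) \<le> op_norm D"
      unfolding op_norm_def by (intro cSUP_upper bdd)
    have "(\<Sum>i<n. \<Sum>j<n. D $$ (i, j) * g i * g j)\<^sup>2 = (\<Sum>i<n. g i * (\<Sum>j<n. D $$ (i, j) * g j))\<^sup>2"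
      by (simp add: sum_distrib_left mult_ac)
    also have "\<dots> \<le> (\<Sum>i<n. (g i)\<^sup>2) * (\<Sum>i<n. (\<Sum>j<n. D $$ (i, j) * g j)\<^sup>2)"
      by (rule Cauchy_Schwarz_ineq_sum)
    also have "\<dots> = (l2_norm (D *\<^sub>v vec n g))\<^sup>2"
      unfolding g1 ent norm2 by simp
    finally have sq: "(\<Sum>i<n. \<Sum>j<n. D $$ (i, j) * g i * g j)\<^sup>2 \<le> (l2_norm (D *\<^sub>v vec n g))\<^sup>2" .
    have "\<bar>\<Sum>i<n. \<Sum>j<n. D $$ (i, j) * g i * g j\<bar> \<le> l2_norm (D *\<^sub>v vec n g)"
      by (rule power2_le_imp_le[OF _ nonneg]) (simp only: power2_abs sq)
    also note le
    finally have "\<bar>\<Sum>i<n. \<Sum>j<n. D $$ (i, j) * g i * g j\<bar> \<le> op_norm D" .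
    moreover have "(\<Sum>i<n. \<Sum>j<n. D $$ (i, j) * f i * f j) = c\<^sup>2 * (\<Sum>i<n. \<Sum>j<n. D $$ (i, j) * g i * g j)"
      unfolding sum_distrib_left using c0 by (intro sum.cong refl) (simp add: g_def power2_eq_square)
    ultimately show ?thesis
      unfolding c2[symmetric] by (simp only: abs_mult abs_power2 mult.commute[of "op_norm D"] mult_left_mono zero_le_power2)
  qed
qed

lemma sym_mat_index: "sym_mat n A \<Longrightarrow> i < n \<Longrightarrow> j < n \<Longrightarrow> A $$ (i, j) = A $$ (j, i)"
  by (auto simp: sym_mat_def) (metis carrier_matD index_transpose_mat(1))

lemma property_R_of_aligned_edges:
  assumes C: "sym_mat n C" and z: "sign_vec n z" and n: "0 < n"
    and conn: "\<And>i j. i < n \<Longrightarrow> j < n \<Longrightarrow> (i, j) \<in> {(k, l). k < n \<and> l < n \<and> a k l \<noteq> 0}\<^sup>*"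
    and edges: "\<And>(y :: nat \<Rightarrow> nat \<Rightarrow> real) x i j. (\<And>i. i < n \<Longrightarrow> (\<Sum>l<r. (y i l)\<^sup>2) = 1) \<Longrightarrow>
      (\<And>i j. x i j = (\<Sum>l<r. y i l * y j l)) \<Longrightarrow>
      (\<Sum>i<n. \<Sum>j<n. (z $ i * z $ j * C $$ (i, j)) * ((1 - x i j) * (real r - 2 - x i j))) \<le> 0 \<Longrightarrow>
      i < n \<Longrightarrow> j < n \<Longrightarrow> a i j \<noteq> (0 :: real) \<Longrightarrow> x i j = 1"
  shows "property_R C r z"
proof (rule property_R_introduction[OF C z n])
  fix y :: "nat \<Rightarrow> nat \<Rightarrow> real" and x :: "nat \<Rightarrow> nat \<Rightarrow> real" and i j l
  assume unit: "\<And>i. i < n \<Longrightarrow> (\<Sum>l<r. (y i l)\<^sup>2) = 1" and x: "\<And>i j. x i j = (\<Sum>l<r. y i l * y j l)"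
    and le: "(\<Sum>i<n. \<Sum>j<n. (z $ i * z $ j * C $$ (i, j)) * ((1 - x i j) * (real r - 2 - x i j))) \<le> 0"
    and ij: "i < n" "j < n" and l: "l < r"
  have "y k l = y m l" if "(k, m) \<in> {(k, l). k < n \<and> l < n \<and> a k l \<noteq> 0}" for k m
  proof -
    have km: "k < n" "m < n" "a k m \<noteq> 0"
      using that by auto
    have "x k m = 1"
      by (rule edges[OF unit x le km])
    then show ?thesis
      using unit_vectors_eq[OF unit[OF km(1)] unit[OF km(2)] _ l] x by simp
  qed
  then show "y i l = y j l"
    by (rule rtrancl_constant[OF conn[OF ij], of "\<lambda>i. y i l"])
qed

lemma property_R_of_spectral_gap:
  fixes a D :: "nat \<Rightarrow> nat \<Rightarrow> real" and \<rho> B lam :: real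
  assumes C: "sym_mat n C" and z: "sign_vec n z" and n: "0 < n" and r: "4 \<le> r"
    and conn: "\<And>i j. i < n \<Longrightarrow> j < n \<Longrightarrow> (i, j) \<in> {(k, l). k < n \<and> l < n \<and> a k l \<noteq> 0}\<^sup>*"
    and a0: "\<And>i j. i < n \<Longrightarrow> j < n \<Longrightarrow> 0 \<le> a i j"
    and Dsym: "\<And>i j. i < n \<Longrightarrow> j < n \<Longrightarrow> D i j = D j i"
    and M: "\<And>i j. i < n \<Longrightarrow> j < n \<Longrightarrow> i \<noteq> j \<Longrightarrow> a i j + D i j \<le> z $ i * z $ j * C $$ (i, j)"
    and gap: "\<And>f. lam * (\<Sum>i<n. (f i - (\<Sum>k<n. f k) / n)\<^sup>2) \<le> dirichlet_form n a f"
    and form: "\<And>f. \<bar>\<Sum>i<n. \<Sum>j<n. D i j * f i * f j\<bar> \<le> B * (\<Sum>i<n. (f i)\<^sup>2)"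
    and rows: "\<And>i. i < n \<Longrightarrow> - \<rho> \<le> (\<Sum>j<n. D i j)"
    and bound: "(real r - 1) * \<rho> + (real r + 3) * B \<le> (real r - 3) * lam"
  shows "property_R C r z"
proof (rule property_R_of_aligned_edges[OF C z n, of a])
  fix y :: "nat \<Rightarrow> nat \<Rightarrow> real" and x :: "nat \<Rightarrow> nat \<Rightarrow> real" and i j
  assume unit: "\<And>i. i < n \<Longrightarrow> (\<Sum>l<r. (y i l)\<^sup>2) = 1" and x: "\<And>i j. x i j = (\<Sum>l<r. y i l * y j l)"
    and le: "(\<Sum>i<n. \<Sum>j<n. (z $ i * z $ j * C $$ (i, j)) * ((1 - x i j) * (real r - 2 - x i j))) \<le> 0"
    and ij: "i < n" "j < n" "a i j \<noteq> 0"
  show "x i j = 1"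
    by (rule landscape_edges_aligned[OF n r unit x a0 Dsym M gap[unfolded dirichlet_form_def] form rows bound le ij])
qed (fact conn)

text \<open>For \<open>r = 3\<close> the second factor is \<open>1 - x\<close>, so the product is a square and still vanishes only at \<open>x = 1\<close>.\<close>

lemma property_R_noiseless:
  fixes a :: "nat \<Rightarrow> nat \<Rightarrow> real"
  assumes C: "sym_mat n C" and z: "sign_vec n z" and n: "0 < n" and r: "3 \<le> r"
    and conn: "\<And>i j. i < n \<Longrightarrow> j < n \<Longrightarrow> (i, j) \<in> {(k, l). k < n \<and> l < n \<and> a k l \<noteq> 0}\<^sup>*"
    and a0: "\<And>i j. i < n \<Longrightarrow> j < n \<Longrightarrow> 0 \<le> a i j"
    and M: "\<And>i j. i < n \<Longrightarrow> j < n \<Longrightarrow> a i j \<le> z $ i * z $ j * C $$ (i, j)"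
  shows "property_R C r z"
proof (rule property_R_of_aligned_edges[OF C z n, of a])
  fix y :: "nat \<Rightarrow> nat \<Rightarrow> real" and x :: "nat \<Rightarrow> nat \<Rightarrow> real" and i j
  assume unit: "\<And>i. i < n \<Longrightarrow> (\<Sum>l<r. (y i l)\<^sup>2) = 1" and x: "\<And>i j. x i j = (\<Sum>l<r. y i l * y j l)"
    and le: "(\<Sum>i<n. \<Sum>j<n. (z $ i * z $ j * C $$ (i, j)) * ((1 - x i j) * (real r - 2 - x i j))) \<le> 0"
    and ij: "i < n" "j < n" "a i j \<noteq> 0"
  define t where "t = (\<lambda>i j. (z $ i * z $ j * C $$ (i, j)) * ((1 - x i j) * (real r - 2 - x i j)))"
  have xle: "x i j \<le> 1" if "i < n" "j < n" for i j
  proof -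
    have "0 \<le> (\<Sum>l<r. (y i l - y j l)\<^sup>2) / 2" by (simp add: sum_nonneg)
    then show ?thesis using unit_rows_half_dist[OF unit[OF that(1)] unit[OF that(2)]] x by simp
  qed
  have pos: "0 \<le> (1 - x i j) * (real r - 2 - x i j)" if "i < n" "j < n" for i j
    using xle[OF that] r by simp
  have t0: "0 \<le> t i j" if "i < n" "j < n" for i j
    unfolding t_def by (rule mult_nonneg_nonneg[OF order.trans[OF a0[OF that] M[OF that]] pos[OF that]])
  have "0 \<le> (\<Sum>i<n. \<Sum>j<n. t i j)"
    by (intro sum_nonneg t0) auto
  with le have "(\<Sum>i<n. \<Sum>j<n. t i j) = 0"
    by (simp add: t_def)
  then have "(\<Sum>j<n. t i j) = 0"
    using ij by (subst (asm) sum_nonneg_eq_0_iff) (auto intro!: sum_nonneg t0)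
  then have "t i j = 0"
    using ij by (subst (asm) sum_nonneg_eq_0_iff) (auto intro!: t0)
  moreover have "0 < z $ i * z $ j * C $$ (i, j)"
    using a0[OF ij(1,2)] M[OF ij(1,2)] ij(3) by linarith
  ultimately have "x i j = 1 \<or> x i j = real r - 2"
    unfolding t_def by auto
  then show "x i j = 1"
    using xle[OF ij(1,2)] r by auto
qed (fact conn)

lemma dirichlet_form_complete:
  assumes "0 < n"
  shows "dirichlet_form n (\<lambda>_ _. \<mu>) f = real n * \<mu> * (\<Sum>i<n. (f i - (\<Sum>k<n. f k) / n)\<^sup>2)"
proof -
  define g where "g = (\<lambda>i. f i - (\<Sum>k<n. f k) / n)"
  have g0: "(\<Sum>i<n. g i) = 0"
    using assms by (simp add: g_def sum_subtractf)
  have "dirichlet_form n (\<lambda>_ _. \<mu>) f = (\<Sum>i<n. \<Sum>j<n. \<mu> * (g i - g j)\<^sup>2) / 2"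
    by (simp add: dirichlet_form_def g_def)
  also have "\<dots> = (\<Sum>i<n. (\<Sum>j<n. \<mu>) * (g i)\<^sup>2) - (\<Sum>i<n. \<Sum>j<n. \<mu> * g i * g j)"
    by (rule sum_diff_squares_kernel) simp
  also have "(\<Sum>i<n. \<Sum>j<n. \<mu> * g i * g j) = 0"
    by (simp add: sum_distrib_left[symmetric] g0)
  finally show ?thesis
    by (simp add: g_def sum_distrib_left)
qed

text \<open>The complete graph with constant weight \<open>\<mu>\<close>, whose Dirichlet form is exactly \<open>n * \<mu>\<close> times the variance.
Since \<open>x i i = 1\<close>, the diagonal of the cost matrix drops out of the scalar inequality, and \<open>D\<close> may be taken to
vanish there.\<close>

lemma property_R_mean_plus_noise:
  fixes \<mu> \<rho> B :: real
  assumes C: "sym_mat n C" and z: "sign_vec n z" and n: "0 < n" and r: "4 \<le> r"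
    and P: "monotone_perturbation z \<Delta>p" and \<mu>: "0 < \<mu>"
    and D: "\<And>i j. i < n \<Longrightarrow> j < n \<Longrightarrow> D i j = (if i = j then 0 else z $ i * z $ j * C $$ (i, j) - \<mu>)"
    and form: "\<And>f. \<bar>\<Sum>i<n. \<Sum>j<n. D i j * f i * f j\<bar> \<le> B * (\<Sum>i<n. (f i)\<^sup>2)"
    and rows: "\<And>i. i < n \<Longrightarrow> - \<rho> \<le> (\<Sum>j<n. D i j)"
    and bound: "(real r - 1) * \<rho> + (real r + 3) * B \<le> (real r - 3) * (real n * \<mu>)"
  shows "property_R (C + \<Delta>p) r z"
proof (rule property_R_of_spectral_gap[of n _ z r "\<lambda>_ _. \<mu>" D "real n * \<mu>" B \<rho>])
  have dz: "dim_vec z = n"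
    using z by (auto simp: sign_vec_def)
  have P': "sym_mat n \<Delta>p" "\<And>i j. i < n \<Longrightarrow> j < n \<Longrightarrow> 0 \<le> \<Delta>p $$ (i, j) * z $ i * z $ j"
    using P dz by (auto simp: monotone_perturbation_def)
  have Cc: "C \<in> carrier_mat n n" "\<Delta>p \<in> carrier_mat n n"
    using C P' by (auto simp: sym_mat_def)
  then show "sym_mat n (C + \<Delta>p)"
    using C P'(1) by (auto simp: sym_mat_def transpose_add)
  show "\<mu> + D i j \<le> z $ i * z $ j * (C + \<Delta>p) $$ (i, j)" if "i < n" "j < n" "i \<noteq> j" for i j
    using that Cc D[OF that(1,2)] P'(2)[OF that(1,2)] by (simp add: algebra_simps)
  show "D i j = D j i" if "i < n" "j < n" for i j
    using that D[OF that] D[OF that(2,1)] sym_mat_index[OF C that] by simp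
  show "real n * \<mu> * (\<Sum>i<n. (f i - (\<Sum>k<n. f k) / n)\<^sup>2) \<le> dirichlet_form n (\<lambda>_ _. \<mu>) f" for f
    using dirichlet_form_complete[OF n] by simp
  show "(i, j) \<in> {(k, l). k < n \<and> l < n \<and> \<mu> \<noteq> 0}\<^sup>*" if "i < n" "j < n" for i j
    using that \<mu> by (intro r_into_rtrancl) auto
qed (rule z n r form rows bound less_imp_le[OF \<mu>] | assumption)+

lemma rank_constant:
  assumes "4 \<le> r"
  shows "real r + 3 \<le> (real r - 1) * ((real r + 11) / (real r - 3))"
  using assms by (simp add: field_simps)

lemma property_R_graph:
  assumes n: "0 < n" and z: "sign_vec n z" and A: "adjacency_mat n A" and conn: "connected_adj n A"
    and D: "sym_mat n \<Delta>" "\<And>i. i < n \<Longrightarrow> \<Delta> $$ (i, i) = 0"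
    and \<rho>: "\<rho> = Max ((\<lambda>i. - z $ i * (\<Sum>j\<in>{..<n} - {i}. \<Delta> $$ (i, j) * z $ j)) ` {..<n})"
    and cond: "(4 \<le> r \<and>
         \<rho> + (real r + 11) / (real r - 3) * op_norm \<Delta>
           \<le> (real r - 3) / (real r - 1) * algebraic_connectivity A) \<or>
        (r = 3 \<and> \<Delta> = 0\<^sub>m n n)"
    and P: "monotone_perturbation z \<Delta>p"
  shows "property_R (diagm z * A * diagm z + \<Delta> + \<Delta>p) r z"
proof -
  have dz: "dim_vec z = n"
    using z by (auto simp: sign_vec_def)
  have zz: "z $ i * z $ i = 1" if "i < n" for i
    using z that unfolding sign_vec_def by auto
  have P': "sym_mat n \<Delta>p" "\<And>i j. i < n \<Longrightarrow> j < n \<Longrightarrow> 0 \<le> \<Delta>p $$ (i, j) * z $ i * z $ j"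
    using P dz by (auto simp: monotone_perturbation_def)
  have As: "sym_mat n A" "\<And>i j. i < n \<Longrightarrow> j < n \<Longrightarrow> 0 \<le> A $$ (i, j)"
    using A by (auto simp: adjacency_mat_def)
  have carr: "A \<in> carrier_mat n n" "\<Delta> \<in> carrier_mat n n" "\<Delta>p \<in> carrier_mat n n"
    using As(1) D(1) P'(1) by (auto simp: sym_mat_def)
  define Z where "Z = diagm z * A * diagm z"
  have Zc: "Z \<in> carrier_mat n n"
    using carr dz by (auto simp: Z_def diagm_def mat_diag_def)
  have Zi: "Z $$ (i, j) = z $ i * A $$ (i, j) * z $ j" if "i < n" "j < n" for i j
  proof -
    have 1: "diagm z * A = mat n n (\<lambda>(i, j). z $ i * A $$ (i, j))"
      unfolding diagm_def dz by (rule mat_diag_mult_left[OF carr(1)])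
    have "Z = mat n n (\<lambda>(i, j). (mat n n (\<lambda>(i, j). z $ i * A $$ (i, j))) $$ (i, j) * z $ j)"
      unfolding Z_def 1 unfolding diagm_def dz by (rule mat_diag_mult_right) simp
    then show ?thesis using that by simp
  qed
  have Zs: "sym_mat n Z"
    unfolding sym_mat_def
  proof (intro conjI eq_matI)
    fix i j assume "i < dim_row Z" "j < dim_col Z"
    then have "i < n" "j < n" using Zc by auto
    then show "transpose_mat Z $$ (i, j) = Z $$ (i, j)"
      using Zc sym_mat_index[OF As(1), of i j] by (simp add: Zi)
  qed (use Zc in auto)
  have sym: "sym_mat n (Z + \<Delta> + \<Delta>p)"
    using Zs D(1) P'(1) by (auto simp: sym_mat_def transpose_add)
  define d where "d = (\<lambda>i j. z $ i * z $ j * \<Delta> $$ (i, j))"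
  have M: "A $$ (i, j) + d i j \<le> z $ i * z $ j * (Z + \<Delta> + \<Delta>p) $$ (i, j)" if "i < n" "j < n" for i j
  proof -
    have "z $ i * z $ j * (Z + \<Delta> + \<Delta>p) $$ (i, j) =
        (z $ i * z $ i) * (z $ j * z $ j) * A $$ (i, j) + d i j + \<Delta>p $$ (i, j) * z $ i * z $ j"
      using carr Zc that by (simp add: Zi d_def algebra_simps)
    then show ?thesis
      using P'(2)[OF that] zz that by simp
  qed
  have conn': "(i, j) \<in> {(k, l). k < n \<and> l < n \<and> A $$ (k, l) \<noteq> 0}\<^sup>*" if "i < n" "j < n" for i j
    using conn that by (simp add: connected_adj_def)
  from cond have "property_R (Z + \<Delta> + \<Delta>p) r z"
  proof (elim disjE conjE)
    assume r: "4 \<le> r" and le: "\<rho> + (real r + 11) / (real r - 3) * op_norm \<Delta>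
           \<le> (real r - 3) / (real r - 1) * algebraic_connectivity A"
    show ?thesis
    proof (rule property_R_of_spectral_gap[where a = "\<lambda>i j. A $$ (i, j)" and D = d and
          lam = "algebraic_connectivity A" and B = "op_norm \<Delta>" and \<rho> = \<rho>, OF sym z n r])
      show "\<bar>\<Sum>i<n. \<Sum>j<n. d i j * f i * f j\<bar> \<le> op_norm \<Delta> * (\<Sum>i<n. (f i)\<^sup>2)" for f
      proof -
        have "(\<Sum>i<n. (z $ i * f i)\<^sup>2) = (\<Sum>i<n. (f i)\<^sup>2)"
          by (intro sum.cong refl) (simp add: power_mult_distrib power2_eq_square[of "z $ _"] zz)
        then show ?thesis
          using abs_quadratic_form_le_op_norm(1)[OF carr(2), of "\<lambda>i. z $ i * f i"]
          by (simp add: d_def mult_ac)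
      qed
      show "- \<rho> \<le> (\<Sum>j<n. d i j)" if "i < n" for i
      proof -
        have "- z $ i * (\<Sum>j\<in>{..<n} - {i}. \<Delta> $$ (i, j) * z $ j) \<le> \<rho>"
          unfolding \<rho> using that by (intro Max_ge) auto
        moreover have "(\<Sum>j<n. d i j) = (\<Sum>j\<in>{..<n} - {i}. d i j)"
          using that D(2) by (intro sum.mono_neutral_right) (auto simp: d_def)
        ultimately show ?thesis
          by (simp add: d_def sum_distrib_left sum_negf mult_ac)
      qed
      show "(real r - 1) * \<rho> + (real r + 3) * op_norm \<Delta> \<le> (real r - 3) * algebraic_connectivity A"
      proof -
        have "(real r - 1) * (\<rho> + (real r + 11) / (real r - 3) * op_norm \<Delta>) \<le>
            (real r - 1) * ((real r - 3) / (real r - 1) * algebraic_connectivity A)"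
          using r le by (intro mult_left_mono) auto
        also have "\<dots> = (real r - 3) * algebraic_connectivity A"
          using r by simp
        finally show ?thesis
          using mult_right_mono[OF rank_constant[OF r] abs_quadratic_form_le_op_norm(2)[OF carr(2)]]
          unfolding distrib_left mult.assoc by linarith
      qed
      show "d i j = d j i" if "i < n" "j < n" for i j
        using sym_mat_index[OF D(1) that] by (simp add: d_def mult_ac)
    qed (rule conn' As(2) M algebraic_connectivity_gap[OF A conn] | assumption)+
  next
    assume r: "r = 3" and 0: "\<Delta> = 0\<^sub>m n n"
    show ?thesis
    proof (rule property_R_noiseless[where a = "\<lambda>i j. A $$ (i, j)", OF sym z n])
      show "A $$ (i, j) \<le> z $ i * z $ j * (Z + \<Delta> + \<Delta>p) $$ (i, j)" if "i < n" "j < n" for i j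
        using M[OF that] that 0 by (simp add: d_def)
      show "3 \<le> r" using r by simp
    qed (rule conn' As(2) | assumption)+
  qed
  then show ?thesis
    by (simp add: Z_def)
qed

text \<open>Conjugating by the labels turns the rank-one term \<open>z * transpose z\<close> of the mean into a complete graph of
weight \<open>(p - q) / 2\<close>, and subtracting the constant matrix removes the other term off the diagonal. Since the
labels are balanced, row \<open>i\<close> of the mean contributes \<open>n * (p - q) / 2 - p\<close> to the sum; the last \<open>p\<close> is
given away.\<close>

lemma property_R_block_model:
  fixes A :: "real mat" and p q B :: real
  assumes n: "0 < n" and z: "sign_vec n z" and balanced: "z \<bullet> ones_vec n = 0" and pq: "0 \<le> q" "q < p"
    and A: "sym_mat n A" and diag: "\<And>i. i < n \<Longrightarrow> A $$ (i, i) = 0" and r: "4 \<le> r"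
    and E: "\<And>i j. i < n \<Longrightarrow> j < n \<Longrightarrow> E i j = (if i = j then 0 else (p - q) / 2 * (z $ i * z $ j) + (p + q) / 2)"
    and B: "0 \<le> B"
    and form: "\<And>f. \<bar>\<Sum>i<n. \<Sum>j<n. (A $$ (i, j) - E i j) * f i * f j\<bar> \<le> B * (\<Sum>i<n. (f i)\<^sup>2)"
    and rows: "\<And>i. i < n \<Longrightarrow> (real r + 11) / (real r - 3) * B + real n * (p - q) / (real r - 1) \<le>
        z $ i * (\<Sum>j\<in>{..<n} - {i}. A $$ (i, j) * z $ j)"
    and P: "monotone_perturbation z \<Delta>p"
  shows "property_R (A - ((p + q) / 2) \<cdot>\<^sub>m outer (ones_vec n) (ones_vec n) + \<Delta>p) r z"
proof -
  have zz: "z $ i * z $ i = 1" if "i < n" for i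
    using z that unfolding sign_vec_def by auto
  have sum0: "(\<Sum>j<n. z $ j) = 0"
    using balanced by (simp add: scalar_prod_def ones_vec_def atLeast0LessThan)
  have Ac: "A \<in> carrier_mat n n"
    using A by (simp add: sym_mat_def)
  define C where "C = A - ((p + q) / 2) \<cdot>\<^sub>m outer (ones_vec n) (ones_vec n)"
  have Cc: "C \<in> carrier_mat n n"
    using Ac by (auto simp: C_def outer_def ones_vec_def)
  have Ci: "C $$ (i, j) = A $$ (i, j) - (p + q) / 2" if "i < n" "j < n" for i j
    using Ac that by (simp add: C_def outer_def ones_vec_def)
  have Cs: "sym_mat n C"
    unfolding sym_mat_def
  proof (intro conjI eq_matI)
    fix i j assume "i < dim_row C" "j < dim_col C"
    then have "i < n" "j < n" using Cc by auto
    then show "transpose_mat C $$ (i, j) = C $$ (i, j)"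
      using Cc sym_mat_index[OF A, of i j] by (simp add: Ci)
  qed (use Cc in auto)
  define D where "D = (\<lambda>i j. (A $$ (i, j) - E i j) * z $ i * z $ j)"
  define \<rho> where "\<rho> = real n * (p - q) / 2 - ((real r + 11) / (real r - 3) * B + real n * (p - q) / (real r - 1))"
  show ?thesis
    unfolding C_def[symmetric]
  proof (rule property_R_mean_plus_noise[OF Cs z n r P, where \<mu> = "(p - q) / 2" and D = D and B = B and \<rho> = \<rho>])
    show "0 < (p - q) / 2" using pq by simp
    show "D i j = (if i = j then 0 else z $ i * z $ j * C $$ (i, j) - (p - q) / 2)" if "i < n" "j < n" for i j
    proof (cases "i = j")
      case True
      then show ?thesis using that diag by (simp add: D_def E)
    next
      case False
      have "D i j = z $ i * z $ j * C $$ (i, j) - (p - q) / 2 * ((z $ i * z $ i) * (z $ j * z $ j))"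
        using False that by (simp add: D_def E Ci algebra_simps)
      then show ?thesis using False that by (simp add: zz)
    qed
    show "\<bar>\<Sum>i<n. \<Sum>j<n. D i j * f i * f j\<bar> \<le> B * (\<Sum>i<n. (f i)\<^sup>2)" for f
    proof -
      have "(\<Sum>i<n. (z $ i * f i)\<^sup>2) = (\<Sum>i<n. (f i)\<^sup>2)"
        by (intro sum.cong refl) (simp add: power_mult_distrib power2_eq_square[of "z $ _"] zz)
      then show ?thesis
        using form[of "\<lambda>i. z $ i * f i"] by (simp add: D_def mult_ac)
    qed
    show "- \<rho> \<le> (\<Sum>j<n. D i j)" if i: "i < n" for i
    proof -
      have "(\<Sum>j\<in>{..<n} - {i}. z $ j) = - (z $ i)"
        using sum0 i by (simp add: sum_diff1)
      then have zs: "z $ i * (\<Sum>j\<in>{..<n} - {i}. z $ j) = - 1"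
        using zz[OF i] by simp
      have "(\<Sum>j<n. D i j) = (\<Sum>j\<in>{..<n} - {i}. D i j)"
        using i diag by (intro sum.mono_neutral_right) (auto simp: D_def E)
      also have "\<dots> = (\<Sum>j\<in>{..<n} - {i}. z $ i * (A $$ (i, j) * z $ j) - (p - q) / 2 - (p + q) / 2 * (z $ i * z $ j))"
      proof (intro sum.cong refl)
        fix j assume j: "j \<in> {..<n} - {i}"
        have "D i j = z $ i * (A $$ (i, j) * z $ j) - (p - q) / 2 * ((z $ i * z $ i) * (z $ j * z $ j))
            - (p + q) / 2 * (z $ i * z $ j)"
          using j i by (simp add: D_def E algebra_simps)
        then show "D i j = z $ i * (A $$ (i, j) * z $ j) - (p - q) / 2 - (p + q) / 2 * (z $ i * z $ j)"
          using j i by (simp add: zz)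
      qed
      also have "\<dots> = z $ i * (\<Sum>j\<in>{..<n} - {i}. A $$ (i, j) * z $ j) - (real n - 1) * ((p - q) / 2)
          - (p + q) / 2 * (z $ i * (\<Sum>j\<in>{..<n} - {i}. z $ j))"
        using i by (simp add: sum_subtractf sum_distrib_left of_nat_diff)
      also have "\<dots> = z $ i * (\<Sum>j\<in>{..<n} - {i}. A $$ (i, j) * z $ j) - real n * (p - q) / 2 + p"
        unfolding zs by (simp add: field_simps)
      finally show ?thesis
        using rows[OF i] pq unfolding \<rho>_def by linarith
    qed
    show "(real r - 1) * \<rho> + (real r + 3) * B \<le> (real r - 3) * (real n * ((p - q) / 2))"
    proof -
      have "(real r - 1) * \<rho> = (real r - 1) * (real n * (p - q) / 2) - (real r - 1) * ((real r + 11) / (real r - 3)) * B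
          - real n * (p - q)"
        using r unfolding \<rho>_def right_diff_distrib distrib_left by simp
      moreover have "(real r - 1) * (real n * (p - q) / 2) - real n * (p - q) =
          (real r - 3) * (real n * ((p - q) / 2))"
        by (simp add: field_simps)
      ultimately show ?thesis
        using mult_right_mono[OF rank_constant[OF r] B] by linarith
    qed
  qed
qed

section \<open>Closed walks and the norm of a symmetric kernel\<close>

text \<open>Vectors are functions on the natural numbers of which only the values on \<open>{..<n}\<close> matter.\<close>

definition kernel_apply :: "nat \<Rightarrow> (nat \<Rightarrow> nat \<Rightarrow> real) \<Rightarrow> (nat \<Rightarrow> real) \<Rightarrow> nat \<Rightarrow> real" where
  "kernel_apply n W x = (\<lambda>i. \<Sum>j<n. W i j * x j)"

definition words :: "nat \<Rightarrow> nat \<Rightarrow> nat list set" where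
  "words n k = {xs. set xs \<subseteq> {..<n} \<and> length xs = k}"

fun walk_weight :: "(nat \<Rightarrow> nat \<Rightarrow> real) \<Rightarrow> nat list \<Rightarrow> real" where
  "walk_weight W (x # y # ys) = W x y * walk_weight W (y # ys)"
| "walk_weight W _ = 1"

text \<open>The trace of the \<open>k\<close>-th power of \<open>W\<close> for positive \<open>k\<close>, as a sum over the vertex sequences of closed walks.\<close>

definition closed_walk_sum :: "nat \<Rightarrow> (nat \<Rightarrow> nat \<Rightarrow> real) \<Rightarrow> nat \<Rightarrow> real" where
  "closed_walk_sum n W k = (\<Sum>xs\<in>words n k. walk_weight W (xs @ [hd xs]))"

lemma finite_words [simp]: "finite (words n k)"
  unfolding words_def by (intro finite_lists_length_eq) simp

lemma sum_words_Suc: "(\<Sum>xs\<in>words n (Suc k). F xs) = (\<Sum>x<n. \<Sum>xs\<in>words n k. F (x # xs))"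
proof -
  have "words n (Suc k) = (\<lambda>p. snd p # fst p) ` (words n k \<times> {..<n})"
    unfolding words_def lists_length_Suc_eq by (simp add: case_prod_beta)
  moreover have "inj_on (\<lambda>p. snd p # fst p) (words n k \<times> {..<n})"
    by (auto simp: inj_on_def)
  ultimately have "(\<Sum>xs\<in>words n (Suc k). F xs) = (\<Sum>p\<in>words n k \<times> {..<n}. F (snd p # fst p))"
    by (simp add: sum.reindex)
  also have "\<dots> = (\<Sum>xs\<in>words n k. \<Sum>x<n. F (x # xs))"
    by (simp add: sum.cartesian_product case_prod_beta)
  finally show ?thesis
    by (simp add: sum.swap[of _ "{..<n}"])
qed

lemma kernel_power_walks:
  assumes "j < n"
  shows "(kernel_apply n W ^^ Suc k) (\<lambda>i. if i = j then 1 else 0) i =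
    (\<Sum>xs\<in>words n k. walk_weight W (i # xs @ [j]))"
proof (induction k arbitrary: i)
  case 0
  have "words n 0 = {[]}" by (auto simp: words_def)
  moreover have "(\<Sum>l<n. W i l * (if l = j then 1 else 0)) = W i j"
    using assms by (simp add: if_distrib[of "\<lambda>x. _ * x"] cong: if_cong)
  ultimately show ?case
    by (simp add: kernel_apply_def)
next
  case (Suc k)
  have "(kernel_apply n W ^^ Suc (Suc k)) (\<lambda>i. if i = j then 1 else 0) i =
      (\<Sum>l<n. W i l * (kernel_apply n W ^^ Suc k) (\<lambda>i. if i = j then 1 else 0) l)"
    by (simp add: kernel_apply_def)
  also have "\<dots> = (\<Sum>l<n. \<Sum>xs\<in>words n k. walk_weight W (i # (l # xs) @ [j]))"
    unfolding Suc.IH by (simp add: sum_distrib_left)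
  also have "\<dots> = (\<Sum>xs\<in>words n (Suc k). walk_weight W (i # xs @ [j]))"
    by (simp only: sum_words_Suc)
  finally show ?case .
qed

lemma kernel_apply_selfadjoint:
  assumes sym: "\<And>i j. i < n \<Longrightarrow> j < n \<Longrightarrow> W i j = W j i"
  shows "(\<Sum>i<n. kernel_apply n W x i * y i) = (\<Sum>i<n. x i * kernel_apply n W y i)"
proof -
  have "(\<Sum>i<n. kernel_apply n W x i * y i) = (\<Sum>i<n. \<Sum>j<n. W i j * x j * y i)"
    by (simp add: kernel_apply_def sum_distrib_right)
  also have "\<dots> = (\<Sum>j<n. \<Sum>i<n. W i j * x j * y i)"
    by (rule sum.swap)
  also have "\<dots> = (\<Sum>j<n. \<Sum>i<n. x j * (W j i * y i))"
    by (intro sum.cong refl) (simp add: sym)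
  finally show ?thesis
    by (simp add: kernel_apply_def sum_distrib_left)
qed

lemma kernel_power_selfadjoint:
  assumes sym: "\<And>i j. i < n \<Longrightarrow> j < n \<Longrightarrow> W i j = W j i"
  shows "(\<Sum>i<n. (kernel_apply n W ^^ k) x i * y i) = (\<Sum>i<n. x i * (kernel_apply n W ^^ k) y i)"
proof (induction k arbitrary: x y)
  case (Suc k)
  have "(\<Sum>i<n. (kernel_apply n W ^^ Suc k) x i * y i) = (\<Sum>i<n. (kernel_apply n W ^^ k) x i * kernel_apply n W y i)"
    using kernel_apply_selfadjoint[OF sym] by simp
  also have "\<dots> = (\<Sum>i<n. x i * (kernel_apply n W ^^ k) (kernel_apply n W y) i)"
    by (rule Suc.IH)
  finally show ?case
    by (simp only: funpow_Suc_right comp_def)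
qed simp

lemma closed_walk_sum_eq_trace:
  assumes sym: "\<And>i j. i < n \<Longrightarrow> j < n \<Longrightarrow> W i j = W j i" and k: "0 < k"
  shows "closed_walk_sum n W (2 * k) =
    (\<Sum>j<n. \<Sum>i<n. ((kernel_apply n W ^^ k) (\<lambda>i. if i = j then 1 else 0) i)\<^sup>2)"
proof -
  obtain l where l: "2 * k = Suc l"
    using k by (metis mult_is_0 not0_implies_Suc not_gr0 zero_neq_numeral)
  have "closed_walk_sum n W (2 * k) = (\<Sum>j<n. \<Sum>xs\<in>words n l. walk_weight W (j # xs @ [j]))"
    unfolding closed_walk_sum_def l sum_words_Suc by simp
  also have "\<dots> = (\<Sum>j<n. (kernel_apply n W ^^ (2 * k)) (\<lambda>i. if i = j then 1 else 0) j)"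
    unfolding l by (intro sum.cong refl) (simp add: kernel_power_walks del: funpow.simps)
  also have "\<dots> = (\<Sum>j<n. \<Sum>i<n. ((kernel_apply n W ^^ k) (\<lambda>i. if i = j then 1 else 0) i)\<^sup>2)"
  proof (intro sum.cong refl)
    fix j assume j: "j \<in> {..<n}"
    define e where "e = (\<lambda>i. if i = j then 1 else 0 :: real)"
    have "(kernel_apply n W ^^ (2 * k)) e j = (\<Sum>i<n. (kernel_apply n W ^^ k) ((kernel_apply n W ^^ k) e) i * e i)"
      using j by (simp add: mult_2 funpow_add e_def if_distrib[of "\<lambda>x. _ * x"] cong: if_cong)
    also have "\<dots> = (\<Sum>i<n. (kernel_apply n W ^^ k) e i * (kernel_apply n W ^^ k) e i)"
      by (rule kernel_power_selfadjoint[OF sym])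
    finally show "(kernel_apply n W ^^ (2 * k)) e j = (\<Sum>i<n. ((kernel_apply n W ^^ k) e i)\<^sup>2)"
      by (simp add: power2_eq_square)
  qed
  finally show ?thesis .
qed

text \<open>A norm is at most the Frobenius norm, applied to a power of the kernel.\<close>

lemma kernel_power_expand:
  "(\<Sum>i<n. ((kernel_apply n W ^^ k) x i)\<^sup>2) \<le>
    (\<Sum>i<n. (x i)\<^sup>2) * (\<Sum>j<n. \<Sum>i<n. ((kernel_apply n W ^^ k) (\<lambda>i. if i = j then 1 else 0) i)\<^sup>2)"
proof (cases k)
  case 0
  have "(\<Sum>i<n. (x i)\<^sup>2) * 1 \<le> (\<Sum>i<n. (x i)\<^sup>2) * real n" if "0 < n"
    using that by (intro mult_left_mono sum_nonneg) auto
  then show ?thesis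
    using 0 by (cases "n = 0") (auto simp: if_distrib[of "\<lambda>x. x\<^sup>2"] cong: if_cong)
next
  case (Suc l)
  have lin: "(kernel_apply n W ^^ Suc l) x i =
      (\<Sum>j<n. x j * (kernel_apply n W ^^ Suc l) (\<lambda>i. if i = j then 1 else 0) i)" for l i
  proof (induction l arbitrary: i)
    case 0
    have "(\<Sum>l<n. W i l * (if l = j then 1 else 0)) = W i j" if "j < n" for j
      using that by (simp add: if_distrib[of "\<lambda>x. _ * x"] cong: if_cong)
    then show ?case
      by (simp add: kernel_apply_def mult.commute)
  next
    case (Suc l)
    have unfold: "(kernel_apply n W ^^ Suc (Suc l)) x i = (\<Sum>m<n. W i m * (kernel_apply n W ^^ Suc l) x m)" for x i
      by (simp add: kernel_apply_def)
    have "(kernel_apply n W ^^ Suc (Suc l)) x i = (\<Sum>m<n. W i m * (kernel_apply n W ^^ Suc l) x m)"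
      by (rule unfold)
    also have "\<dots> = (\<Sum>m<n. \<Sum>j<n. W i m * (x j * (kernel_apply n W ^^ Suc l) (\<lambda>i. if i = j then 1 else 0) m))"
      unfolding Suc.IH sum_distrib_left ..
    also have "\<dots> = (\<Sum>j<n. \<Sum>m<n. W i m * (x j * (kernel_apply n W ^^ Suc l) (\<lambda>i. if i = j then 1 else 0) m))"
      by (rule sum.swap)
    also have "\<dots> = (\<Sum>j<n. x j * (\<Sum>m<n. W i m * (kernel_apply n W ^^ Suc l) (\<lambda>i. if i = j then 1 else 0) m))"
      unfolding sum_distrib_left by (simp only: mult.left_commute)
    finally show ?case
      unfolding unfold[symmetric] .
  qed
  have "(\<Sum>i<n. ((kernel_apply n W ^^ k) x i)\<^sup>2) \<le>
      (\<Sum>i<n. (\<Sum>j<n. (x j)\<^sup>2) * (\<Sum>j<n. ((kernel_apply n W ^^ k) (\<lambda>i. if i = j then 1 else 0) i)\<^sup>2))"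
    unfolding Suc by (subst lin) (intro sum_mono Cauchy_Schwarz_ineq_sum)
  also have "\<dots> = (\<Sum>i<n. (x i)\<^sup>2) * (\<Sum>i<n. \<Sum>j<n. ((kernel_apply n W ^^ k) (\<lambda>i. if i = j then 1 else 0) i)\<^sup>2)"
    by (simp add: sum_distrib_left)
  finally show ?thesis
    by (subst sum.swap)
qed

text \<open>For a symmetric kernel the numbers \<open>b k\<close>, the squared norms of the iterates, are log-convex by
Cauchy--Schwarz. This replaces the spectral theorem.\<close>

lemma kernel_norm_power_le:
  assumes sym: "\<And>i j. i < n \<Longrightarrow> j < n \<Longrightarrow> W i j = W j i" and x: "(\<Sum>i<n. (x i)\<^sup>2) = 1"
  shows "(\<Sum>i<n. (kernel_apply n W x i)\<^sup>2) ^ k \<le> (\<Sum>i<n. ((kernel_apply n W ^^ k) x i)\<^sup>2)"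
proof -
  define b where "b = (\<lambda>k. \<Sum>i<n. ((kernel_apply n W ^^ k) x i)\<^sup>2)"
  have b0: "0 \<le> b k" for k
    unfolding b_def by (simp add: sum_nonneg)
  have conv: "(b (Suc k))\<^sup>2 \<le> b k * b (Suc (Suc k))" for k
  proof -
    have "b (Suc k) = (\<Sum>i<n. kernel_apply n W ((kernel_apply n W ^^ k) x) i * kernel_apply n W ((kernel_apply n W ^^ k) x) i)"
      unfolding b_def by (simp add: power2_eq_square)
    also have "\<dots> = (\<Sum>i<n. (kernel_apply n W ^^ k) x i * (kernel_apply n W ^^ Suc (Suc k)) x i)"
      using kernel_apply_selfadjoint[OF sym] by simp
    finally show ?thesis
      unfolding b_def using Cauchy_Schwarz_ineq_sum by metis
  qed
  have step: "b 1 * b k \<le> b (Suc k)" for k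
  proof (induction k)
    case 0
    then show ?case using x by (simp add: b_def)
  next
    case (Suc k)
    show ?case
    proof (cases "b k = 0")
      case True
      then have "b (Suc k) = 0" using conv[of k] by simp
      then show ?thesis using b0 by simp
    next
      case False
      then have "0 < b k" using b0[of k] by simp
      have "b k * (b 1 * b (Suc k)) = (b 1 * b k) * b (Suc k)" by simp
      also have "\<dots> \<le> b (Suc k) * b (Suc k)"
        using Suc b0 by (rule mult_right_mono)
      also have "\<dots> \<le> b k * b (Suc (Suc k))"
        using conv[of k] by (simp add: power2_eq_square)
      finally show ?thesis
        using \<open>0 < b k\<close> by (rule mult_left_le_imp_le)
    qed
  qed
  have "b 1 ^ k \<le> b k"
  proof (induction k)
    case 0
    then show ?case using x by (simp add: b_def)
  next
    case (Suc k)
    have "b 1 ^ Suc k \<le> b 1 * b k"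
      using Suc b0 by (simp add: mult_left_mono)
    then show ?case using step[of k] by linarith
  qed
  then show ?thesis by (simp add: b_def)
qed

text \<open>One half of the trace method: a trace of an even power bounds the norm from above.\<close>

lemma kernel_norm_le_closed_walk_sum:
  assumes sym: "\<And>i j. i < n \<Longrightarrow> j < n \<Longrightarrow> W i j = W j i" and k: "0 < k"
  shows "(\<Sum>i<n. (kernel_apply n W x i)\<^sup>2) ^ k \<le> closed_walk_sum n W (2 * k) * (\<Sum>i<n. (x i)\<^sup>2) ^ k"
proof (cases "(\<Sum>i<n. (x i)\<^sup>2) = 0")
  case True
  then have "\<forall>i<n. x i = 0"
    by (subst (asm) sum_nonneg_eq_0_iff) auto
  then have "(\<Sum>i<n. (kernel_apply n W x i)\<^sup>2) = 0"
    by (simp add: kernel_apply_def)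
  then show ?thesis using True k by (simp add: zero_power)
next
  case False
  define c where "c = sqrt (\<Sum>i<n. (x i)\<^sup>2)"
  have c2: "c\<^sup>2 = (\<Sum>i<n. (x i)\<^sup>2)"
    unfolding c_def by (simp add: sum_nonneg)
  have c0: "c \<noteq> 0"
    using False c2 by auto
  define y where "y = (\<lambda>i. x i / c)"
  have y1: "(\<Sum>i<n. (y i)\<^sup>2) = 1"
    using c0 by (simp add: y_def power_divide sum_divide_distrib[symmetric] c2[symmetric])
  have xy: "x = (\<lambda>i. c * y i)"
    using c0 by (simp add: y_def)
  have scaled: "(\<Sum>i<n. (kernel_apply n W x i)\<^sup>2) = c\<^sup>2 * (\<Sum>i<n. (kernel_apply n W y i)\<^sup>2)"
  proof -
    have "kernel_apply n W x i = c * kernel_apply n W y i" for i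
      unfolding xy by (simp add: kernel_apply_def sum_distrib_left mult_ac)
    then show ?thesis
      by (simp add: power_mult_distrib sum_distrib_left)
  qed
  have trace: "closed_walk_sum n W (2 * k) =
      (\<Sum>j<n. \<Sum>i<n. ((kernel_apply n W ^^ k) (\<lambda>i. if i = j then 1 else 0) i)\<^sup>2)"
    by (rule closed_walk_sum_eq_trace[OF _ k]) (rule sym)
  have "(\<Sum>i<n. (kernel_apply n W y i)\<^sup>2) ^ k \<le> closed_walk_sum n W (2 * k)"
    using kernel_norm_power_le[where n = n and W = W and k = k and x = y, OF sym y1] kernel_power_expand[where n = n and W = W and k = k and x = y]
    unfolding y1 trace by simp
  then have "(c\<^sup>2) ^ k * (\<Sum>i<n. (kernel_apply n W y i)\<^sup>2) ^ k \<le> (c\<^sup>2) ^ k * closed_walk_sum n W (2 * k)"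
    by (rule mult_left_mono) simp
  then show ?thesis
    unfolding c2[symmetric] scaled power_mult_distrib by (simp only: mult.commute)
qed

text \<open>The other half, used for the dense ensemble: a norm bound gives a trace bound, at the price of a factor \<open>n\<close>.\<close>

lemma closed_walk_sum_le_norm:
  assumes sym: "\<And>i j. i < n \<Longrightarrow> j < n \<Longrightarrow> W i j = W j i" and k: "0 < k"
    and norm: "\<And>x. (\<Sum>i<n. (kernel_apply n W x i)\<^sup>2) \<le> Q * (\<Sum>i<n. (x i)\<^sup>2)" and Q: "0 \<le> Q"
  shows "closed_walk_sum n W (2 * k) \<le> real n * Q ^ k"
proof -
  have pow: "(\<Sum>i<n. ((kernel_apply n W ^^ k) x i)\<^sup>2) \<le> Q ^ k * (\<Sum>i<n. (x i)\<^sup>2)" for k x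
  proof (induction k)
    case (Suc k)
    have "(\<Sum>i<n. ((kernel_apply n W ^^ Suc k) x i)\<^sup>2) \<le> Q * (\<Sum>i<n. ((kernel_apply n W ^^ k) x i)\<^sup>2)"
      using norm by simp
    also have "\<dots> \<le> Q * (Q ^ k * (\<Sum>i<n. (x i)\<^sup>2))"
      using Suc Q by (rule mult_left_mono)
    finally show ?case by (simp add: mult.assoc)
  qed simp
  have trace: "closed_walk_sum n W (2 * k) =
      (\<Sum>j<n. \<Sum>i<n. ((kernel_apply n W ^^ k) (\<lambda>i. if i = j then 1 else 0) i)\<^sup>2)"
    by (rule closed_walk_sum_eq_trace[OF _ k]) (rule sym)
  have "closed_walk_sum n W (2 * k) \<le> (\<Sum>j<n. Q ^ k * (\<Sum>i<n. (if i = j then 1 else 0 :: real)\<^sup>2))"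
    unfolding trace by (rule sum_mono) (rule pow)
  also have "\<dots> = real n * Q ^ k"
    by (simp add: if_distrib[of "\<lambda>x. x\<^sup>2"] cong: if_cong)
  finally show ?thesis .
qed

section \<open>Closed walks counted by coincidence pattern\<close>

text \<open>The representative of an undirected edge in \<open>vertex_pairs n\<close>.\<close>

definition sorted_pair :: "nat \<times> nat \<Rightarrow> nat \<times> nat" where
  "sorted_pair e = (min (fst e) (snd e), max (fst e) (snd e))"

definition edge_kernel :: "(nat \<times> nat \<Rightarrow> real) \<Rightarrow> nat \<Rightarrow> nat \<Rightarrow> real" where
  "edge_kernel f i j = (if i = j then 0 else f (sorted_pair (i, j)))"

definition steps :: "nat list \<Rightarrow> (nat \<times> nat) list" where
  "steps xs = zip xs (tl xs)"

abbreviation walk_edges :: "nat list \<Rightarrow> (nat \<times> nat) list" where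
  "walk_edges xs \<equiv> map sorted_pair (steps xs)"

definition loopfree :: "nat list \<Rightarrow> bool" where
  "loopfree xs \<longleftrightarrow> (\<forall>e\<in>set (steps xs). fst e \<noteq> snd e)"

abbreviation close_walk :: "nat list \<Rightarrow> nat list" where
  "close_walk xs \<equiv> xs @ [hd xs]"

text \<open>A mean-zero random kernel with independent entries gives a nonzero expected weight only to closed walks of
this kind.\<close>

definition doubly_covered :: "nat list \<Rightarrow> bool" where
  "doubly_covered xs \<longleftrightarrow> loopfree (close_walk xs) \<and>
     (\<forall>e\<in>set (walk_edges (close_walk xs)). 2 \<le> count_list (walk_edges (close_walk xs)) e)"

lemma steps_simps [simp]:
  "steps [] = []" "steps [x] = []" "steps (x # y # ys) = (x, y) # steps (y # ys)"
  by (simp_all add: steps_def)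

lemma steps_map: "steps (map g xs) = map (map_prod g g) (steps xs)"
  unfolding steps_def by (simp add: map_tl[symmetric] zip_map_map map_prod_def)

lemma set_steps: "e \<in> set (steps xs) \<Longrightarrow> fst e \<in> set xs \<and> snd e \<in> set xs"
  unfolding steps_def
  by (metis list.set_sel(2) prod.collapse set_zip_leftD set_zip_rightD tl_Nil)

lemma edge_kernel_sym: "edge_kernel f i j = edge_kernel f j i"
  by (simp add: edge_kernel_def sorted_pair_def min.commute max.commute)

lemma walk_weight_edge_kernel:
  "walk_weight (edge_kernel f) xs = (if loopfree xs then prod_list (map f (walk_edges xs)) else 0)"
proof (induction "edge_kernel f" xs rule: walk_weight.induct)
  case (1 x y ys)
  then show ?case
    by (auto simp: loopfree_def edge_kernel_def)
qed (auto simp: loopfree_def)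

text \<open>Regroups the steps of a walk by edge, so that independence of the edges can be used.\<close>

lemma prod_list_eq_prod_count:
  fixes f :: "'b \<Rightarrow> real"
  assumes "finite V" "set es \<subseteq> V"
  shows "prod_list (map f es) = (\<Prod>e\<in>V. f e ^ count_list es e)"
  using assms(2)
proof (induction es)
  case (Cons a es)
  have a: "a \<in> V" using Cons by simp
  have "(\<Prod>e\<in>V. f e ^ count_list (a # es) e) = (\<Prod>e\<in>V. (if e = a then f a else 1) * f e ^ count_list es e)"
    by (intro prod.cong) auto
  also have "\<dots> = f a * (\<Prod>e\<in>V. f e ^ count_list es e)"
    using a assms(1) by (simp add: prod.distrib)
  finally show ?case using Cons by simp
qed simp

lemma walk_edges_subset:
  assumes "set xs \<subseteq> {..<n}" "loopfree xs"
  shows "set (walk_edges xs) \<subseteq> vertex_pairs n"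
proof
  fix e assume "e \<in> set (walk_edges xs)"
  then obtain s where s: "s \<in> set (steps xs)" "e = sorted_pair s" by auto
  then have "fst s < n" "snd s < n" "fst s \<noteq> snd s"
    using set_steps[OF s(1)] assms by (auto simp: loopfree_def)
  then show "e \<in> vertex_pairs n"
    by (auto simp: s sorted_pair_def vertex_pairs_def)
qed

text \<open>A walk is connected: along it, each new vertex comes with a new edge.\<close>

lemma card_vertices_le_edges: "xs \<noteq> [] \<Longrightarrow> card (set xs) \<le> card (set (walk_edges xs)) + 1"
proof (induction xs rule: induct_list012)
  case (3 x y zs)
  have IH: "card (set (y # zs)) \<le> card (set (walk_edges (y # zs))) + 1"
    by (rule 3) simp
  have le: "card (set (walk_edges (y # zs))) \<le> card (set (walk_edges (x # y # zs)))"
    by (intro card_mono) auto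
  show ?case
  proof (cases "x \<in> set (y # zs)")
    case True
    then have "set (x # y # zs) = set (y # zs)" by auto
    then have "card (set (x # y # zs)) = card (set (y # zs))" by (rule arg_cong)
    then show ?thesis using IH le by linarith
  next
    case False
    have "sorted_pair (x, y) \<notin> set (walk_edges (y # zs))"
    proof
      assume "sorted_pair (x, y) \<in> set (walk_edges (y # zs))"
      then obtain s where s: "s \<in> set (steps (y # zs))" "sorted_pair (x, y) = sorted_pair s" by auto
      then have "x = fst s \<or> x = snd s"
        by (auto simp: sorted_pair_def min_def max_def split: if_splits)
      then show False using set_steps[OF s(1)] False by auto
    qed
    then have "card (set (walk_edges (x # y # zs))) = Suc (card (set (walk_edges (y # zs))))"
      by simp
    moreover have "card (set (x # y # zs)) = Suc (card (set (y # zs)))"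
      using False by simp
    ultimately show ?thesis using IH by linarith
  qed
qed auto

text \<open>Each edge uses up at least two of the \<open>2 * k\<close> steps.\<close>

lemma doubly_covered_card_le:
  assumes "doubly_covered xs" "length xs = 2 * k" "0 < k"
  shows "card (set (walk_edges (close_walk xs))) \<le> k" "card (set xs) \<le> card (set (walk_edges (close_walk xs))) + 1"
proof -
  let ?es = "walk_edges (close_walk xs)"
  have ne: "xs \<noteq> []" using assms by auto
  have "card (set ?es) * 2 = (\<Sum>e\<in>set ?es. 2)" by simp
  also have "\<dots> \<le> (\<Sum>e\<in>set ?es. count_list ?es e)"
    using assms(1) unfolding doubly_covered_def by (intro sum_mono) blast
  also have "\<dots> = length ?es"
    by (rule sum_count_set) auto
  also have "\<dots> = 2 * k"
    using assms(2) by (simp add: steps_def)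
  finally show "card (set ?es) \<le> k" by simp
  have "set (close_walk xs) = set xs" using ne by auto
  then show "card (set xs) \<le> card (set ?es) + 1"
    using card_vertices_le_edges[of "close_walk xs"] by simp
qed

text \<open>Relabelling vertices injectively also relabels edges injectively, so edge multiplicities are unchanged.\<close>

lemma doubly_covered_map:
  assumes inj: "inj_on g (set xs)" and ne: "xs \<noteq> []"
  shows "doubly_covered (map g xs) \<longleftrightarrow> doubly_covered xs"
proof -
  define h where "h = (\<lambda>e. sorted_pair (map_prod g g e))"
  have cl: "close_walk (map g xs) = map g (close_walk xs)"
    using ne by (simp add: hd_map)
  have inj': "inj_on g (set (close_walk xs))"
    using inj ne by (simp add: insert_absorb)
  let ?ys = "close_walk xs"
  have st: "fst e \<in> set ?ys" "snd e \<in> set ?ys" if "e \<in> set (steps ?ys)" for e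
    using set_steps[OF that] by auto
  have "h (sorted_pair e) = sorted_pair (map_prod g g e)" for e
    by (cases e) (auto simp: h_def sorted_pair_def min_def max_def)
  then have we: "walk_edges (map g ?ys) = map h (walk_edges ?ys)"
    by (simp only: steps_map map_map comp_def)
  have hinj: "inj_on h (set (walk_edges ?ys))"
  proof (rule inj_onI)
    fix a b assume ab: "a \<in> set (walk_edges ?ys)" "b \<in> set (walk_edges ?ys)" "h a = h b"
    have el: "fst e \<le> snd e \<and> fst e \<in> set ?ys \<and> snd e \<in> set ?ys" if e: "e \<in> set (walk_edges ?ys)" for e
    proof -
      obtain s where "s \<in> set (steps ?ys)" "e = sorted_pair s" using e by auto
      then show ?thesis using st[of s] by (simp add: sorted_pair_def min_def max_def)
    qed
    obtain a1 a2 b1 b2 where e: "a = (a1, a2)" "b = (b1, b2)" by (cases a, cases b)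
    have i: "g u = g v \<Longrightarrow> u = v" if "u \<in> set ?ys" "v \<in> set ?ys" for u v
      using inj' that by (simp only: inj_on_eq_iff)
    have m: "a1 \<le> a2" "b1 \<le> b2" "a1 \<in> set ?ys" "a2 \<in> set ?ys" "b1 \<in> set ?ys" "b2 \<in> set ?ys"
      using el[OF ab(1)] el[OF ab(2)] unfolding e by auto
    have "(g a1 = g b1 \<and> g a2 = g b2) \<or> (g a1 = g b2 \<and> g a2 = g b1)"
      using ab(3) unfolding h_def e by (auto simp: sorted_pair_def min_def max_def split: if_splits)
    then have "(a1 = b1 \<and> a2 = b2) \<or> (a1 = b2 \<and> a2 = b1)"
      using i m by blast
    then show "a = b" using m(1,2) unfolding e by auto
  qed
  have lf: "loopfree (map g ?ys) \<longleftrightarrow> loopfree ?ys"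
    unfolding loopfree_def steps_map
  proof -
    have "g (fst e) = g (snd e) \<longleftrightarrow> fst e = snd e" if "e \<in> set (steps ?ys)" for e
      using inj' st[OF that] by (simp only: inj_on_eq_iff)
    then show "(\<forall>e\<in>set (map (map_prod g g) (steps ?ys)). fst e \<noteq> snd e) \<longleftrightarrow> (\<forall>e\<in>set (steps ?ys). fst e \<noteq> snd e)"
      by auto
  qed
  have "(\<forall>e\<in>set (walk_edges (map g ?ys)). 2 \<le> count_list (walk_edges (map g ?ys)) e) \<longleftrightarrow>
      (\<forall>e\<in>set (walk_edges ?ys). 2 \<le> count_list (map h (walk_edges ?ys)) (h e))"
    unfolding we by simp
  also have "\<dots> \<longleftrightarrow> (\<forall>e\<in>set (walk_edges ?ys). 2 \<le> count_list (walk_edges ?ys) e)"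
    by (intro ball_cong refl) (simp only: count_list_inj_map[OF hinj])
  finally show ?thesis
    unfolding doubly_covered_def cl lf by simp
qed

text \<open>Each vertex is renamed to the position of its first visit. Two walks have the same canonical form if and only
if they have the same pattern of coincidences.\<close>

definition canonical :: "nat list \<Rightarrow> nat list" where
  "canonical xs = map (\<lambda>x. LEAST i. i < length xs \<and> xs ! i = x) xs"

lemma canonical_props:
  assumes "x \<in> set xs"
  shows "(LEAST i. i < length xs \<and> xs ! i = x) < length xs"
    "xs ! (LEAST i. i < length xs \<and> xs ! i = x) = x"
proof -
  have "\<exists>i. i < length xs \<and> xs ! i = x"
    using assms by (simp add: in_set_conv_nth)
  from LeastI_ex[OF this] show "(LEAST i. i < length xs \<and> xs ! i = x) < length xs"
    "xs ! (LEAST i. i < length xs \<and> xs ! i = x) = x" by auto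
qed

lemma length_canonical [simp]: "length (canonical xs) = length xs"
  by (simp add: canonical_def)

lemma set_canonical: "set (canonical xs) \<subseteq> {..<length xs}"
  unfolding canonical_def using canonical_props(1) by auto

lemma map_nth_canonical: "map ((!) xs) (canonical xs) = xs"
  unfolding canonical_def by (simp add: map_idI canonical_props(2) cong: map_cong)

lemma inj_nth_canonical: "inj_on ((!) xs) (set (canonical xs))"
  unfolding canonical_def by (auto simp: inj_on_def canonical_props(2))

lemma canonical_map:
  assumes "inj_on g (set xs)"
  shows "canonical (map g xs) = canonical xs"
proof -
  have "(LEAST i. i < length (map g xs) \<and> map g xs ! i = g x) = (LEAST i. i < length xs \<and> xs ! i = x)"
    if "x \<in> set xs" for x
  proof -
    have "(i < length (map g xs) \<and> map g xs ! i = g x) \<longleftrightarrow> (i < length xs \<and> xs ! i = x)" for i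
      using assms that by (auto simp: inj_on_eq_iff)
    then show ?thesis by simp
  qed
  then show ?thesis
    by (simp add: canonical_def)
qed

lemma canonical_idem: "canonical (canonical xs) = canonical xs"
  using canonical_map[OF inj_nth_canonical[of xs]] by (simp add: map_nth_canonical)

definition patterns :: "nat \<Rightarrow> nat list set" where
  "patterns k = {c \<in> words k k. canonical c = c}"

text \<open>Any quantity that is invariant under injective relabelling can be summed pattern by pattern, and only the
number of walks of each pattern depends on the number \<open>n\<close> of vertices.\<close>

lemma sum_words_by_pattern:
  fixes F :: "nat list \<Rightarrow> real"
  assumes inv: "\<And>g xs. inj_on g (set xs) \<Longrightarrow> length xs = k \<Longrightarrow> F (map g xs) = F xs"
  shows "(\<Sum>xs\<in>words n k. F xs) = (\<Sum>c\<in>patterns k. F c * card {xs \<in> words n k. canonical xs = c})"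
proof -
  have "canonical ` words n k \<subseteq> patterns k"
    using set_canonical by (auto simp: patterns_def words_def canonical_idem)
  moreover have "finite (patterns k)"
    by (simp add: patterns_def)
  ultimately have "(\<Sum>xs\<in>words n k. F xs) = (\<Sum>c\<in>patterns k. \<Sum>xs\<in>{xs \<in> words n k. canonical xs = c}. F xs)"
    by (intro sum.group[symmetric]) auto
  also have "\<dots> = (\<Sum>c\<in>patterns k. \<Sum>xs\<in>{xs \<in> words n k. canonical xs = c}. F c)"
  proof (intro sum.cong refl)
    fix c xs assume "xs \<in> {xs \<in> words n k. canonical xs = c}"
    then show "F xs = F c"
      using inv[OF inj_nth_canonical[of xs]] by (auto simp: map_nth_canonical words_def)
  qed
  finally show ?thesis
    by (simp add: mult.commute)
qed

lemma card_pattern_upper: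
  "card {xs \<in> words n k. canonical xs = c} \<le> n ^ card (set c)"
proof -
  let ?S = "{xs \<in> words n k. canonical xs = c}"
  let ?\<phi> = "\<lambda>xs. restrict ((!) xs) (set c)"
  have "inj_on ?\<phi> ?S"
  proof (rule inj_onI)
    fix xs ys assume xs: "xs \<in> ?S" and ys: "ys \<in> ?S" and eq: "?\<phi> xs = ?\<phi> ys"
    have "xs ! i = ys ! i" if "i \<in> set c" for i
      using eq that by (metis restrict_apply')
    then have "map ((!) xs) c = map ((!) ys) c" by simp
    moreover have "map ((!) xs) c = xs" "map ((!) ys) c = ys"
      using xs ys map_nth_canonical[of xs] map_nth_canonical[of ys] by auto
    ultimately show "xs = ys" by metis
  qed
  moreover have "?\<phi> ` ?S \<subseteq> set c \<rightarrow>\<^sub>E {..<n}"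
  proof
    fix f assume "f \<in> ?\<phi> ` ?S"
    then obtain xs where xs: "xs \<in> words n k" "canonical xs = c" "f = ?\<phi> xs" by auto
    have "xs ! i < n" if "i \<in> set c" for i
    proof -
      have "i < length xs" using set_canonical[of xs] xs(2) that by auto
      then have "xs ! i \<in> set xs" by simp
      then show ?thesis using xs(1) by (auto simp: words_def)
    qed
    then show "f \<in> set c \<rightarrow>\<^sub>E {..<n}" unfolding xs(3) by auto
  qed
  ultimately have "card ?S \<le> card (set c \<rightarrow>\<^sub>E {..<n})"
    by (intro card_inj_on_le finite_PiE) auto
  then show ?thesis by (simp add: card_PiE)
qed

text \<open>A walk of pattern \<open>c\<close> is an injective labelling of the \<open>Suc m\<close> letters of \<open>c\<close>. There are
\<open>n * (n - 1) * \<dots> * (n - m)\<close> of them, and each factor but the first is at least \<open>n'\<close>.\<close>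

lemma card_pattern_lower:
  assumes c: "c \<in> patterns k" and v: "card (set c) = Suc m" and m: "m \<le> n'" and n: "n = n' + b" "m \<le> b"
  shows "n * n' ^ m \<le> card {xs \<in> words n k. canonical xs = c}"
proof -
  let ?S = "{xs \<in> words n k. canonical xs = c}"
  define es where "es = remdups c"
  have es: "distinct es" "set es = set c" "length es = Suc m"
    using v by (simp_all add: es_def length_remdups_card_conv)
  define idx where "idx = (\<lambda>x. LEAST i. i < length es \<and> es ! i = x)"
  have idx: "idx x < length es" "es ! idx x = x" if "x \<in> set c" for x
    using canonical_props[of x es] that es(2) by (auto simp: idx_def)
  have idx_nth: "idx (es ! i) = i" if "i < length es" for i
    using idx[of "es ! i"] es that nth_eq_iff_index_eq[OF es(1)] by (metis nth_mem)
  let ?T = "{ds. length ds = Suc m \<and> distinct ds \<and> set ds \<subseteq> {..<n}}"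
  let ?\<psi> = "\<lambda>ds. map (\<lambda>x. ds ! idx x) c"
  have "inj_on ?\<psi> ?T"
  proof (rule inj_onI)
    fix ds ds' assume ds: "ds \<in> ?T" "ds' \<in> ?T" and eq: "?\<psi> ds = ?\<psi> ds'"
    show "ds = ds'"
    proof (rule nth_equalityI)
      show "length ds = length ds'" using ds by simp
      fix i assume "i < length ds"
      then have i: "i < length es" using ds es by simp
      then have "es ! i \<in> set c" using es by (metis nth_mem)
      then have "ds ! idx (es ! i) = ds' ! idx (es ! i)" using eq by simp
      then show "ds ! i = ds' ! i" using idx_nth[OF i] by simp
    qed
  qed
  moreover have "?\<psi> ` ?T \<subseteq> ?S"
  proof
    fix xs assume "xs \<in> ?\<psi> ` ?T"
    then obtain ds where ds: "length ds = Suc m" "distinct ds" "set ds \<subseteq> {..<n}" "xs = ?\<psi> ds" by auto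
    have "inj_on (\<lambda>x. ds ! idx x) (set c)"
    proof (rule inj_onI)
      fix x y assume xy: "x \<in> set c" "y \<in> set c" "ds ! idx x = ds ! idx y"
      then have "idx x = idx y"
        using idx(1)[OF xy(1)] idx(1)[OF xy(2)] ds(1) es(3)
            nth_eq_iff_index_eq[OF ds(2), of "idx x" "idx y"] by simp
      then show "x = y" using idx(2)[OF xy(1)] idx(2)[OF xy(2)] by metis
    qed
    from canonical_map[OF this] have "canonical xs = c"
      using c ds(4) by (simp add: patterns_def)
    moreover have "xs \<in> words n k"
    proof -
      have "ds ! idx x < n" if "x \<in> set c" for x
      proof -
        have "ds ! idx x \<in> set ds" using idx(1)[OF that] ds es by simp
        then show ?thesis using ds(3) by auto
      qed
      then show ?thesis using c ds(4) by (auto simp: words_def patterns_def)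
    qed
    ultimately show "xs \<in> ?S" by simp
  qed
  ultimately have "card ?T \<le> card ?S"
    by (intro card_inj_on_le) auto
  moreover have "card ?T = \<Prod>{n - m .. n}" if "0 < n"
  proof -
    have "card ?T = \<Prod>{card {..<n} - Suc m + 1 .. card {..<n}}"
      using n m that by (intro card_lists_distinct_length_eq) auto
    then show ?thesis using n m that by (simp add: Suc_diff_Suc)
  qed
  moreover have "n * n' ^ m \<le> \<Prod>{n - m .. n}"
  proof -
    have "{n - m .. n} = insert n {n - m ..< n}" using n by auto
    then have "\<Prod>{n - m .. n} = n * \<Prod>{n - m ..< n}" by simp
    moreover have "n' ^ m = (\<Prod>i\<in>{n - m ..< n}. n')"
      using n by simp
    moreover have "\<dots> \<le> \<Prod>{n - m ..< n}"
      using n by (intro prod_mono) auto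
    ultimately show ?thesis by simp
  qed
  ultimately show ?thesis
    using m n by (cases "n = 0") auto
qed

text \<open>A pattern with \<open>Suc m\<close> vertices occurs at most \<open>n ^ Suc m\<close> times on \<open>n\<close> vertices and at least \<open>N * N' ^ m\<close>
times on \<open>N\<close> vertices. Weighted by \<open>p ^ m\<close>, the former is \<open>n * (n * p) ^ m\<close>, so \<open>n * p \<le> N'\<close> makes the dense
count win for every pattern at once. No pattern has to be counted.\<close>

lemma doubly_covered_comparison:
  fixes p :: real
  assumes k: "0 < k" and N: "N = N' + k" and p: "0 \<le> p" and np: "real n * p \<le> real N'" and N': "k \<le> N'"
  shows "real N * (\<Sum>xs\<in>words n (2 * k). if doubly_covered xs then p ^ (card (set xs) - 1) else 0) \<le>
    real n * real (card {xs \<in> words N (2 * k). doubly_covered xs})"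
proof -
  let ?P = "patterns (2 * k)"
  let ?fib = "\<lambda>n c. card {xs \<in> words n (2 * k). canonical xs = c}"
  have inv: "doubly_covered (map g xs) = doubly_covered xs" "card (set (map g xs)) = card (set xs)"
    if "inj_on g (set xs)" "length xs = 2 * k" for g :: "nat \<Rightarrow> nat" and xs
  proof -
    have "xs \<noteq> []" using that(2) k by auto
    then show "doubly_covered (map g xs) = doubly_covered xs" by (rule doubly_covered_map[OF that(1)])
    show "card (set (map g xs)) = card (set xs)" using card_image[OF that(1)] by simp
  qed
  have "real N * (\<Sum>xs\<in>words n (2 * k). if doubly_covered xs then p ^ (card (set xs) - 1) else 0) =
      (\<Sum>c\<in>?P. real N * ((if doubly_covered c then p ^ (card (set c) - 1) else 0) * real (?fib n c)))"
    unfolding sum_distrib_left[symmetric]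
    by (subst sum_words_by_pattern) (simp_all only: inv)
  also have "\<dots> \<le> (\<Sum>c\<in>?P. real n * ((if doubly_covered c then 1 else 0) * real (?fib N c)))"
  proof (intro sum_mono)
    fix c assume c: "c \<in> ?P"
    show "real N * ((if doubly_covered c then p ^ (card (set c) - 1) else 0) * real (?fib n c)) \<le>
        real n * ((if doubly_covered c then 1 else 0) * real (?fib N c))"
    proof (cases "doubly_covered c")
      case True
      have len: "length c = 2 * k" using c by (simp add: patterns_def words_def)
      then have "c \<noteq> []" using k by auto
      then have "card (set c) \<noteq> 0" by simp
      then obtain m where m: "card (set c) = Suc m" using not0_implies_Suc by blast
      have mk: "m \<le> k" using doubly_covered_card_le[OF True len k] m by linarith
      have "real (?fib n c) \<le> real (n ^ Suc m)"
        using card_pattern_upper[of n "2 * k" c] unfolding m by (rule of_nat_mono)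
      then have "p ^ m * real (?fib n c) \<le> p ^ m * real (n ^ Suc m)"
        using p by (intro mult_left_mono) auto
      also have "\<dots> = real n * (real n * p) ^ m"
        by (simp add: power_mult_distrib)
      also have "\<dots> \<le> real n * real N' ^ m"
        using np p by (intro mult_left_mono power_mono) auto
      finally have "real N * (p ^ m * real (?fib n c)) \<le> real N * (real n * real N' ^ m)"
        by (rule mult_left_mono) simp
      also have "\<dots> = real n * real (N * N' ^ m)" by simp
      also have "\<dots> \<le> real n * real (?fib N c)"
        using card_pattern_lower[OF c m _ N mk] mk N' by (intro mult_left_mono of_nat_mono) auto
      finally show ?thesis using True m by simp
    qed simp
  qed
  also have "\<dots> = real n * (\<Sum>xs\<in>words N (2 * k). if doubly_covered xs then 1 else 0)"
    unfolding sum_distrib_left[symmetric]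
    by (subst sum_words_by_pattern[of "2 * k" "\<lambda>xs. if doubly_covered xs then 1 else 0"]) (simp_all only: inv)
  also have "\<dots> = real n * real (card {xs \<in> words N (2 * k). doubly_covered xs})"
    by (simp add: sum.If_cases Int_def)
  finally show ?thesis .
qed

section \<open>Moments of random symmetric kernels\<close>

lemma expectation_pair_pmf_mult:
  fixes f :: "'a \<Rightarrow> real" and g :: "'b \<Rightarrow> real"
  assumes "finite (set_pmf P)" "finite (set_pmf Q)"
  shows "measure_pmf.expectation (pair_pmf P Q) (\<lambda>x. f (fst x) * g (snd x)) =
    measure_pmf.expectation P f * measure_pmf.expectation Q g"
proof -
  have "measure_pmf.expectation (pair_pmf P Q) (\<lambda>x. f (fst x) * g (snd x)) =
      (\<Sum>x\<in>set_pmf P \<times> set_pmf Q. f (fst x) * g (snd x) * pmf (pair_pmf P Q) x)"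
    using assms by (intro integral_measure_pmf_real) auto
  also have "\<dots> = (\<Sum>x\<in>set_pmf P. \<Sum>y\<in>set_pmf Q. (f x * pmf P x) * (g y * pmf Q y))"
    unfolding sum.cartesian_product by (intro sum.cong refl) (auto simp: pmf_pair)
  also have "\<dots> = (\<Sum>x\<in>set_pmf P. f x * pmf P x) * (\<Sum>y\<in>set_pmf Q. g y * pmf Q y)"
    by (simp add: sum_product)
  also have "\<dots> = measure_pmf.expectation P f * measure_pmf.expectation Q g"
    using assms by (simp add: integral_measure_pmf_real[of "set_pmf P" P f] integral_measure_pmf_real[of "set_pmf Q" Q g])
  finally show ?thesis .
qed

lemma finite_set_Pi_pmf:
  assumes "finite V" "\<And>e. e \<in> V \<Longrightarrow> finite (set_pmf (P e))"
  shows "finite (set_pmf (Pi_pmf V d P))"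
  using assms by (simp add: set_Pi_pmf finite_PiE_dflt)

text \<open>Finite supports make every function integrable, so the factors may have any sign, as odd moments require.\<close>

lemma expectation_prod_Pi_pmf_signed:
  fixes f :: "'e \<Rightarrow> 'a \<Rightarrow> real"
  assumes "finite V" "\<And>e. e \<in> V \<Longrightarrow> finite (set_pmf (P e))"
  shows "measure_pmf.expectation (Pi_pmf V d P) (\<lambda>\<omega>. \<Prod>e\<in>V. f e (\<omega> e)) =
    (\<Prod>e\<in>V. measure_pmf.expectation (P e) (f e))"
  using assms
proof (induction V rule: finite_induct)
  case (insert e V)
  have "measure_pmf.expectation (Pi_pmf (insert e V) d P) (\<lambda>\<omega>. \<Prod>e\<in>insert e V. f e (\<omega> e)) =
      measure_pmf.expectation (pair_pmf (P e) (Pi_pmf V d P))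
        (\<lambda>x. \<Prod>e'\<in>insert e V. f e' (((snd x)(e := fst x)) e'))"
    unfolding Pi_pmf_insert[OF insert(1,2)] by (simp add: case_prod_beta)
  also have "\<dots> = measure_pmf.expectation (pair_pmf (P e) (Pi_pmf V d P))
        (\<lambda>x. f e (fst x) * (\<Prod>e'\<in>V. f e' (snd x e')))"
  proof (intro Bochner_Integration.integral_cong refl)
    fix x
    have "(\<Prod>e'\<in>V. f e' (((snd x)(e := fst x)) e')) = (\<Prod>e'\<in>V. f e' (snd x e'))"
      using insert(2) by (intro prod.cong) auto
    then show "(\<Prod>e'\<in>insert e V. f e' (((snd x)(e := fst x)) e')) = f e (fst x) * (\<Prod>e'\<in>V. f e' (snd x e'))"
      using insert(1,2) by simp
  qed
  also have "\<dots> = measure_pmf.expectation (P e) (f e) *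
      measure_pmf.expectation (Pi_pmf V d P) (\<lambda>\<omega>. \<Prod>e'\<in>V. f e' (\<omega> e'))"
    using insert by (intro expectation_pair_pmf_mult finite_set_Pi_pmf) auto
  finally show ?case
    using insert by simp
qed simp

lemma expectation_walk_weight:
  fixes X :: "nat \<times> nat \<Rightarrow> 'a \<Rightarrow> real"
  assumes fin: "\<And>e. e \<in> vertex_pairs n \<Longrightarrow> finite (set_pmf (P e))" and xs: "set xs \<subseteq> {..<n}"
  shows "measure_pmf.expectation (Pi_pmf (vertex_pairs n) d P) (\<lambda>\<omega>. walk_weight (edge_kernel (\<lambda>e. X e (\<omega> e))) xs) =
    (if loopfree xs then \<Prod>e\<in>vertex_pairs n. measure_pmf.expectation (P e) (\<lambda>a. X e a ^ count_list (walk_edges xs) e)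
     else 0)"
proof (cases "loopfree xs")
  case True
  have "walk_weight (edge_kernel (\<lambda>e. X e (\<omega> e))) xs =
      (\<Prod>e\<in>vertex_pairs n. X e (\<omega> e) ^ count_list (walk_edges xs) e)" for \<omega>
    using True prod_list_eq_prod_count[OF finite_vertex_pairs walk_edges_subset[OF xs True], of "\<lambda>e. X e (\<omega> e)"]
    by (simp add: walk_weight_edge_kernel)
  then show ?thesis
    using True fin expectation_prod_Pi_pmf_signed[OF finite_vertex_pairs, of n P d "\<lambda>e a. X e a ^ count_list (walk_edges xs) e"]
    by simp
qed (simp add: walk_weight_edge_kernel)

lemma words_close_walk:
  assumes "xs \<in> words n k" "0 < k"
  shows "xs \<noteq> []" "length xs = k" "set (close_walk xs) \<subseteq> {..<n}"
proof -
  show ne: "xs \<noteq> []" and "length xs = k"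
    using assms by (auto simp: words_def)
  show "set (close_walk xs) \<subseteq> {..<n}"
    using assms(1) hd_in_set[OF ne] by (simp add: words_def) blast
qed

text \<open>A factor of order one vanishes, and a factor of order \<open>c \<ge> 2\<close> is at most \<open>2 ^ c * p\<close> because the entries
are bounded by \<open>2\<close> and have variance at most \<open>p\<close>. A doubly covered walk has at least \<open>card (set xs) - 1\<close>
distinct edges, and \<open>p \<le> 1\<close>.\<close>

lemma expectation_closed_walk_sum_upper:
  fixes X :: "nat \<times> nat \<Rightarrow> 'a \<Rightarrow> real"
  assumes fin: "\<And>e. e \<in> vertex_pairs n \<Longrightarrow> finite (set_pmf (P e))" and k: "0 < k" and p: "0 \<le> p" "p \<le> 1"
    and bd: "\<And>e a. e \<in> vertex_pairs n \<Longrightarrow> a \<in> set_pmf (P e) \<Longrightarrow> \<bar>X e a\<bar> \<le> 2"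
    and mean: "\<And>e. e \<in> vertex_pairs n \<Longrightarrow> measure_pmf.expectation (P e) (X e) = 0"
    and var: "\<And>e. e \<in> vertex_pairs n \<Longrightarrow> measure_pmf.expectation (P e) (\<lambda>a. (X e a)\<^sup>2) \<le> p"
  shows "measure_pmf.expectation (Pi_pmf (vertex_pairs n) d P)
      (\<lambda>\<omega>. closed_walk_sum n (edge_kernel (\<lambda>e. X e (\<omega> e))) (2 * k)) \<le>
    4 ^ k * (\<Sum>xs\<in>words n (2 * k). if doubly_covered xs then p ^ (card (set xs) - 1) else 0)"
proof -
  let ?E = "measure_pmf.expectation (Pi_pmf (vertex_pairs n) d P)"
  let ?V = "vertex_pairs n"
  have int: "integrable (Pi_pmf ?V d P) (f :: _ \<Rightarrow> real)" for f
    using fin by (intro integrable_measure_pmf_finite finite_set_Pi_pmf) auto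
  have moment: "\<bar>measure_pmf.expectation (P e) (\<lambda>a. X e a ^ c)\<bar> \<le> 2 ^ c * (if c = 0 then 1 else p)"
    if e: "e \<in> ?V" and c: "c \<noteq> 1" for e c
  proof (cases "c = 0")
    case False
    then have "2 \<le> c" using c by simp
    then obtain b where b: "c = b + 2" using that[of "c - 2"] by simp
    have intP: "integrable (P e) (f :: _ \<Rightarrow> real)" for f
      by (intro integrable_measure_pmf_finite fin e)
    have "\<bar>measure_pmf.expectation (P e) (\<lambda>a. X e a ^ c)\<bar> \<le> measure_pmf.expectation (P e) (\<lambda>a. \<bar>X e a ^ c\<bar>)"
      by (rule integral_abs_bound)
    also have "\<dots> \<le> measure_pmf.expectation (P e) (\<lambda>a. 2 ^ b * (X e a)\<^sup>2)"
    proof (intro integral_mono_AE intP AE_pmfI)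
      fix a assume "a \<in> set_pmf (P e)"
      then have "\<bar>X e a\<bar> ^ b \<le> 2 ^ b" using bd[OF e] by (intro power_mono) auto
      then have "\<bar>X e a\<bar> ^ b * (X e a)\<^sup>2 \<le> 2 ^ b * (X e a)\<^sup>2" by (rule mult_right_mono) simp
      then show "\<bar>X e a ^ c\<bar> \<le> 2 ^ b * (X e a)\<^sup>2"
        by (simp only: b power_add abs_mult power_abs power2_abs)
    qed
    also have "\<dots> \<le> 2 ^ b * p"
      using var[OF e] by simp
    also have "\<dots> \<le> 2 ^ c * p"
      using p by (simp add: b power_add)
    finally show ?thesis using False by simp
  qed simp
  have each: "?E (\<lambda>\<omega>. walk_weight (edge_kernel (\<lambda>e. X e (\<omega> e))) (close_walk xs)) \<le>
      4 ^ k * (if doubly_covered xs then p ^ (card (set xs) - 1) else 0)" if xs: "xs \<in> words n (2 * k)" for xs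
  proof -
    have ne: "xs \<noteq> []" and len: "length xs = 2 * k" and sub: "set (close_walk xs) \<subseteq> {..<n}"
      using words_close_walk[OF xs] k by simp_all
    let ?es = "walk_edges (close_walk xs)"
    let ?m = "\<lambda>e. measure_pmf.expectation (P e) (\<lambda>a. X e a ^ count_list ?es e)"
    have E: "?E (\<lambda>\<omega>. walk_weight (edge_kernel (\<lambda>e. X e (\<omega> e))) (close_walk xs)) =
        (if loopfree (close_walk xs) then \<Prod>e\<in>?V. ?m e else 0)"
      by (rule expectation_walk_weight[OF fin sub])
    show ?thesis
    proof (cases "doubly_covered xs")
      case True
      then have lf: "loopfree (close_walk xs)" by (simp add: doubly_covered_def)
      have sub': "set ?es \<subseteq> ?V" by (rule walk_edges_subset[OF sub lf])
      have "(\<Prod>e\<in>?V. ?m e) \<le> \<bar>\<Prod>e\<in>?V. ?m e\<bar>" by simp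
      also have "\<dots> = (\<Prod>e\<in>?V. \<bar>?m e\<bar>)" by (rule abs_prod)
      also have "\<dots> \<le> (\<Prod>e\<in>?V. 2 ^ count_list ?es e * (if count_list ?es e = 0 then 1 else p))"
      proof (rule prod_mono, intro conjI)
        fix e assume e: "e \<in> ?V"
        show "0 \<le> \<bar>?m e\<bar>" by simp
        have "count_list ?es e \<noteq> 1"
        proof (cases "e \<in> set ?es")
          case mem: True
          then have "2 \<le> count_list ?es e" using True unfolding doubly_covered_def by blast
          then show ?thesis by linarith
        next
          case False
          then show ?thesis by (metis count_list_0_iff zero_neq_one)
        qed
        then show "\<bar>?m e\<bar> \<le> 2 ^ count_list ?es e * (if count_list ?es e = 0 then 1 else p)"
          by (rule moment[OF e])
      qed
      also have "\<dots> = 2 ^ (\<Sum>e\<in>?V. count_list ?es e) * (\<Prod>e\<in>?V. if count_list ?es e = 0 then 1 else p)"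
        by (simp only: prod.distrib power_sum)
      also have "(\<Sum>e\<in>?V. count_list ?es e) = 2 * k"
        using sum_count_set[OF sub' finite_vertex_pairs] len by (simp add: steps_def)
      also have "(\<Prod>e\<in>?V. if count_list ?es e = 0 then 1 else p) = (\<Prod>e\<in>set ?es. p)"
        using sub' by (intro prod.mono_neutral_cong_right) (auto simp: count_list_0_iff)
      also have "\<dots> = p ^ card (set ?es)" by simp
      also have "(2::real) ^ (2 * k) * p ^ card (set ?es) \<le> 4 ^ k * p ^ (card (set xs) - 1)"
        using doubly_covered_card_le(2)[OF True len k] p by (simp add: power_mult power_decreasing)
      finally show ?thesis using True E lf by simp
    next
      case False
      have zero: "(\<Prod>e\<in>?V. ?m e) = 0" if lf: "loopfree (close_walk xs)"
      proof -
        obtain e where e: "e \<in> set ?es" "\<not> 2 \<le> count_list ?es e"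
          using False lf unfolding doubly_covered_def by blast
        moreover have "count_list ?es e \<noteq> 0" using e(1) by (metis count_list_0_iff)
        ultimately have "count_list ?es e = 1" by linarith
        moreover have eV: "e \<in> ?V" using walk_edges_subset[OF sub lf] e(1) by blast
        ultimately have "?m e = 0" using mean by simp
        with eV have "\<exists>e\<in>?V. ?m e = 0" by (rule bexI[rotated])
        then show ?thesis by (rule prod_zero[OF finite_vertex_pairs])
      qed
      have "(if loopfree (close_walk xs) then \<Prod>e\<in>?V. ?m e else 0) = 0"
        using zero by presburger
      then show ?thesis unfolding E using False by (simp only: if_False mult_zero_right order_refl)
    qed
  qed
  have "?E (\<lambda>\<omega>. closed_walk_sum n (edge_kernel (\<lambda>e. X e (\<omega> e))) (2 * k)) =
      (\<Sum>xs\<in>words n (2 * k). ?E (\<lambda>\<omega>. walk_weight (edge_kernel (\<lambda>e. X e (\<omega> e))) (close_walk xs)))"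
    unfolding closed_walk_sum_def by (intro Bochner_Integration.integral_sum int)
  also have "\<dots> \<le> (\<Sum>xs\<in>words n (2 * k). 4 ^ k * (if doubly_covered xs then p ^ (card (set xs) - 1) else 0))"
    by (intro sum_mono each)
  finally show ?thesis
    by (simp only: sum_distrib_left)
qed

text \<open>With probability \<open>1 / 3\<close> for the value \<open>2\<close> this variable has mean zero, and the positive skewness makes its
odd moments positive too. A symmetric variable would not do: its odd moments vanish, while walks traversing an
edge three times must be counted.\<close>

definition skew :: "bool \<Rightarrow> real" where
  "skew b = (if b then 2 else -1)"

abbreviation skew_pmf :: "bool pmf" where
  "skew_pmf \<equiv> bernoulli_pmf (1 / 3)"

lemma expectation_skew:
  "measure_pmf.expectation skew_pmf (\<lambda>b. f (skew b)) = (f 2 + 2 * f (-1)) / (3 :: real)"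
  by (simp add: integral_bernoulli_pmf skew_def field_simps)

lemma skew_moment_ge_1:
  assumes "c \<noteq> 1"
  shows "1 \<le> measure_pmf.expectation skew_pmf (\<lambda>b. skew b ^ c)"
proof (cases "c = 0")
  case False
  then have "2 \<le> c" using assms by simp
  then obtain b where b: "c = b + 2" using that[of "c - 2"] by simp
  define u v where "u = (2 :: real) ^ b" and "v = (-1 :: real) ^ b"
  have "v = 1 \<and> 1 \<le> u \<or> v = -1 \<and> 2 \<le> u"
  proof (cases "even b")
    case False
    then obtain l where "b = Suc l" by (cases b) auto
    then show ?thesis using False by (simp add: u_def v_def)
  qed (simp add: u_def v_def)
  moreover have c: "(2 :: real) ^ c = 4 * u" "(-1 :: real) ^ c = v"
    unfolding u_def v_def b by (simp_all add: power_add)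
  ultimately show ?thesis
    unfolding expectation_skew[of "\<lambda>x. x ^ c"] c by auto
qed simp

text \<open>The trace moment of the dense ensemble counts every doubly covered walk with weight at least one and every
other walk with nonnegative weight.\<close>

lemma card_doubly_covered_le_expectation:
  assumes k: "0 < k"
  shows "real (card {xs \<in> words n (2 * k). doubly_covered xs}) \<le>
    measure_pmf.expectation (Pi_pmf (vertex_pairs n) True (\<lambda>_. skew_pmf))
      (\<lambda>\<omega>. closed_walk_sum n (edge_kernel (\<lambda>e. skew (\<omega> e))) (2 * k))"
proof -
  let ?E = "measure_pmf.expectation (Pi_pmf (vertex_pairs n) True (\<lambda>_. skew_pmf))"
  let ?V = "vertex_pairs n"
  have int: "integrable (Pi_pmf ?V True (\<lambda>_. skew_pmf)) (f :: _ \<Rightarrow> real)" for f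
    by (intro integrable_measure_pmf_finite finite_set_Pi_pmf) auto
  have each: "(if doubly_covered xs then 1 else 0) \<le> ?E (\<lambda>\<omega>. walk_weight (edge_kernel (\<lambda>e. skew (\<omega> e))) (close_walk xs))"
    if xs: "xs \<in> words n (2 * k)" for xs
  proof -
    have sub: "set (close_walk xs) \<subseteq> {..<n}"
      using words_close_walk[OF xs] k by simp
    let ?es = "walk_edges (close_walk xs)"
    let ?m = "\<lambda>e. measure_pmf.expectation skew_pmf (\<lambda>a. skew a ^ count_list ?es e)"
    have E: "?E (\<lambda>\<omega>. walk_weight (edge_kernel (\<lambda>e. skew (\<omega> e))) (close_walk xs)) =
        (if loopfree (close_walk xs) then \<Prod>e\<in>?V. ?m e else 0)"
      by (rule expectation_walk_weight[OF _ sub]) simp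
    have m0: "0 \<le> ?m e" for e
    proof (cases "count_list ?es e = 1")
      case True
      then show ?thesis using expectation_skew[of "\<lambda>x. x"] by simp
    next
      case False
      from skew_moment_ge_1[OF this] show ?thesis by linarith
    qed
    show ?thesis
    proof (cases "doubly_covered xs")
      case True
      have "1 \<le> (\<Prod>e\<in>?V. ?m e)"
      proof (rule prod_ge_1)
        fix e assume e: "e \<in> ?V"
        have "count_list ?es e \<noteq> 1"
        proof (cases "e \<in> set ?es")
          case mem: True
          then have "2 \<le> count_list ?es e" using True unfolding doubly_covered_def by blast
          then show ?thesis by linarith
        next
          case False
          then show ?thesis by (metis count_list_0_iff zero_neq_one)
        qed
        then show "1 \<le> ?m e" by (rule skew_moment_ge_1)
      qed
      then show ?thesis using True E by (simp add: doubly_covered_def)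
    next
      case False
      have "0 \<le> (\<Prod>e\<in>?V. ?m e)" by (rule prod_nonneg) (rule m0)
      then show ?thesis using E False by simp
    qed
  qed
  have "real (card {xs \<in> words n (2 * k). doubly_covered xs}) = (\<Sum>xs\<in>words n (2 * k). if doubly_covered xs then 1 else 0)"
    by (simp add: sum.If_cases Int_def)
  also have "\<dots> \<le> (\<Sum>xs\<in>words n (2 * k). ?E (\<lambda>\<omega>. walk_weight (edge_kernel (\<lambda>e. skew (\<omega> e))) (close_walk xs)))"
    by (intro sum_mono each)
  also have "\<dots> = ?E (\<lambda>\<omega>. closed_walk_sum n (edge_kernel (\<lambda>e. skew (\<omega> e))) (2 * k))"
    unfolding closed_walk_sum_def by (intro Bochner_Integration.integral_sum[symmetric] int)
  finally show ?thesis .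
qed

lemma pmf_mgf_le:
  fixes f :: "'a \<Rightarrow> real"
  assumes fin: "finite (set_pmf P)" and mean: "measure_pmf.expectation P f = 0"
    and bd: "\<And>x. x \<in> set_pmf P \<Longrightarrow> a \<le> f x \<and> f x \<le> b"
  shows "measure_pmf.expectation P (\<lambda>x. exp (s * f x)) \<le> exp (s\<^sup>2 * (b - a)\<^sup>2 / 8)"
proof -
  have pos: "measure_pmf.expectation P (\<lambda>x. exp (s * f x)) \<le> exp (s\<^sup>2 * (b - a)\<^sup>2 / 8)"
    if s: "0 < s" and mean: "measure_pmf.expectation P f = 0"
      and bd: "\<And>x. x \<in> set_pmf P \<Longrightarrow> a \<le> f x \<and> f x \<le> b" for s a b and f :: "'a \<Rightarrow> real"
  proof -
    interpret interval_bounded_random_variable "measure_pmf P" f a b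
      by unfold_locales (auto simp: AE_measure_pmf_iff bd)
    have "ennreal (measure_pmf.expectation P (\<lambda>x. exp (s * f x))) = nn_integral P (\<lambda>x. exp (s * f x))"
      by (intro nn_integral_eq_integral[symmetric] integrable_measure_pmf_finite fin) auto
    also have "\<dots> \<le> ennreal (exp (s\<^sup>2 * (b - a)\<^sup>2 / 8))"
      by (rule Hoeffdings_lemma_nn_integral_0[OF s mean])
    finally show ?thesis by (subst (asm) ennreal_le_iff) simp_all
  qed
  consider "s = 0" | "0 < s" | "0 < - s" by linarith
  then show ?thesis
  proof cases
    case 2
    show ?thesis by (rule pos[OF 2 mean bd])
  next
    case 3
    have "measure_pmf.expectation P (\<lambda>x. - f x) = 0" using mean by simp
    then have "measure_pmf.expectation P (\<lambda>x. exp (- s * - f x)) \<le> exp ((- s)\<^sup>2 * (- a - (- b))\<^sup>2 / 8)"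
      by (rule pos[OF 3]) (use bd in auto)
    then show ?thesis by (simp add: power2_commute)
  qed simp
qed

section \<open>Rounding quadratic forms to lattice points\<close>

definition quadratic_form :: "nat \<Rightarrow> (nat \<Rightarrow> nat \<Rightarrow> real) \<Rightarrow> (nat \<Rightarrow> real) \<Rightarrow> real" where
  "quadratic_form n W x = (\<Sum>i<n. \<Sum>j<n. W i j * x i * x j)"

lemma quadratic_form_update_affine:
  assumes diag: "W m m = 0"
  shows "quadratic_form n W (x(m := (1 - \<theta>) * lo + \<theta> * hi)) =
    (1 - \<theta>) * quadratic_form n W (x(m := lo)) + \<theta> * quadratic_form n W (x(m := hi))"
  unfolding quadratic_form_def sum_distrib_left sum.distrib[symmetric]
proof (intro sum.cong refl)
  fix i j
  show "W i j * (x(m := (1 - \<theta>) * lo + \<theta> * hi)) i * (x(m := (1 - \<theta>) * lo + \<theta> * hi)) j =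
      (1 - \<theta>) * (W i j * (x(m := lo)) i * (x(m := lo)) j) + \<theta> * (W i j * (x(m := hi)) i * (x(m := hi)) j)"
    using diag by (cases "i = m"; cases "j = m") (auto simp: algebra_simps)
qed

text \<open>Without diagonal terms a quadratic form is affine in each single variable, so moving that variable to one of
the ends of an interval around it does not decrease the absolute value.\<close>

lemma quadratic_form_round_coordinate:
  assumes diag: "W m m = 0" and lo: "lo \<le> x m" "x m \<le> hi" "lo < hi"
  shows "\<exists>t\<in>{lo, hi}. \<bar>quadratic_form n W x\<bar> \<le> \<bar>quadratic_form n W (x(m := t))\<bar>"
proof -
  define \<theta> where "\<theta> = (x m - lo) / (hi - lo)"
  have \<theta>: "0 \<le> \<theta>" "\<theta> \<le> 1"
    using lo by (auto simp: \<theta>_def field_simps)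
  have "\<theta> * (hi - lo) = x m - lo"
    using lo by (simp add: \<theta>_def)
  then have "x m = (1 - \<theta>) * lo + \<theta> * hi"
    by (simp add: algebra_simps)
  then have "quadratic_form n W x = quadratic_form n W (x(m := (1 - \<theta>) * lo + \<theta> * hi))"
    by (metis fun_upd_triv)
  also have "\<dots> = (1 - \<theta>) * quadratic_form n W (x(m := lo)) + \<theta> * quadratic_form n W (x(m := hi))"
    by (rule quadratic_form_update_affine) (rule diag)
  finally have "\<bar>quadratic_form n W x\<bar> \<le> \<bar>(1 - \<theta>) * quadratic_form n W (x(m := lo))\<bar> + \<bar>\<theta> * quadratic_form n W (x(m := hi))\<bar>"
    by linarith
  also have "\<dots> = (1 - \<theta>) * \<bar>quadratic_form n W (x(m := lo))\<bar> + \<theta> * \<bar>quadratic_form n W (x(m := hi))\<bar>"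
    using \<theta> by (simp add: abs_mult)
  also have "\<dots> \<le> max \<bar>quadratic_form n W (x(m := lo))\<bar> \<bar>quadratic_form n W (x(m := hi))\<bar>"
    using \<theta> by (intro convex_bound_le) auto
  finally show ?thesis
    by (auto simp: max_def split: if_splits)
qed

lemma quadratic_form_round:
  assumes diag: "\<And>i. W i i = 0" and c: "0 < c"
  shows "\<exists>a :: nat \<Rightarrow> int. (\<forall>i<m. \<bar>of_int (a i) / c - x i\<bar> \<le> 1 / c) \<and>
    \<bar>quadratic_form n W x\<bar> \<le> \<bar>quadratic_form n W (\<lambda>i. if i < m then of_int (a i) / c else x i)\<bar>"
proof (induction m)
  case (Suc m)
  then obtain a :: "nat \<Rightarrow> int" where a: "\<And>i. i < m \<Longrightarrow> \<bar>of_int (a i) / c - x i\<bar> \<le> 1 / c"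
    and le: "\<bar>quadratic_form n W x\<bar> \<le> \<bar>quadratic_form n W (\<lambda>i. if i < m then of_int (a i) / c else x i)\<bar>"
    by blast
  define y where "y = (\<lambda>i. if i < m then of_int (a i) / c else x i)"
  define z where "z = \<lfloor>x m * c\<rfloor>"
  have z: "of_int z \<le> x m * c" "x m * c < of_int z + 1"
    unfolding z_def by linarith+
  have "\<exists>t\<in>{of_int z / c, (of_int z + 1) / c}. \<bar>quadratic_form n W y\<bar> \<le> \<bar>quadratic_form n W (y(m := t))\<bar>"
    using z c by (intro quadratic_form_round_coordinate diag) (auto simp: y_def field_simps)
  then obtain b :: int where b: "b \<in> {z, z + 1}" "\<bar>quadratic_form n W y\<bar> \<le> \<bar>quadratic_form n W (y(m := of_int b / c))\<bar>"
    by (metis insert_iff of_int_1 of_int_add singletonD)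
  have "\<bar>of_int b / c - x m\<bar> \<le> 1 / c"
    using b(1) z c by (auto simp: field_simps abs_le_iff)
  moreover have "y(m := of_int b / c) = (\<lambda>i. if i < Suc m then of_int ((a(m := b)) i) / c else x i)"
    by (auto simp: y_def fun_eq_iff)
  ultimately show ?case
    using a b(2) le unfolding y_def[symmetric]
    by (intro exI[of _ "a(m := b)"]) (auto simp: less_Suc_eq)
qed simp

text \<open>Integer points in the ball of radius \<open>2 * sqrt n\<close>; divided by \<open>sqrt n\<close> they replace a net of the unit ball.
The range \<open>{- 4 * int n..4 * int n}\<close> only makes finiteness evident.\<close>

definition lattice_points :: "nat \<Rightarrow> (nat \<Rightarrow> int) set" where
  "lattice_points n = {a \<in> {..<n} \<rightarrow>\<^sub>E {- 4 * int n..4 * int n}. (\<Sum>i<n. (a i)\<^sup>2) \<le> 4 * int n}"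

lemma finite_lattice_points [simp]: "finite (lattice_points n)"
  unfolding lattice_points_def by (rule finite_subset[of _ "{..<n} \<rightarrow>\<^sub>E {- 4 * int n..4 * int n}"]) (auto intro: finite_PiE)

text \<open>Rounding every coordinate of a unit vector to the lattice of mesh \<open>1 / sqrt n\<close> moves it by at most \<open>1\<close> in
norm, so it stays in the ball of radius \<open>2\<close>. Nothing is lost in the value of the form.\<close>

lemma quadratic_form_le_lattice:
  assumes diag: "\<And>i. W i i = 0" and n: "0 < n" and x: "(\<Sum>i<n. (x i)\<^sup>2) \<le> 1"
  shows "\<exists>a\<in>lattice_points n. \<bar>quadratic_form n W x\<bar> \<le> \<bar>quadratic_form n W (\<lambda>i. of_int (a i) / sqrt n)\<bar>"
proof -
  obtain a :: "nat \<Rightarrow> int" where a: "\<And>i. i < n \<Longrightarrow> \<bar>of_int (a i) / sqrt n - x i\<bar> \<le> 1 / sqrt n"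
    and le: "\<bar>quadratic_form n W x\<bar> \<le> \<bar>quadratic_form n W (\<lambda>i. if i < n then of_int (a i) / sqrt n else x i)\<bar>"
    using quadratic_form_round[where W = W and c = "sqrt (real n)" and m = n and n = n and x = x] diag n by auto
  define b where "b = restrict a {..<n}"
  have "(of_int (a i) / sqrt n)\<^sup>2 \<le> 2 * (x i)\<^sup>2 + 2 / n" if "i < n" for i
  proof -
    define d where "d = of_int (a i) / sqrt n - x i"
    have "d\<^sup>2 \<le> (1 / sqrt n)\<^sup>2"
      using a[OF that] unfolding d_def[symmetric] by (rule abs_le_square_iff[THEN iffD1, OF order.trans[OF _ abs_ge_self]])
    then have d: "d\<^sup>2 \<le> 1 / n" by (simp add: power_divide)
    have "(of_int (a i) / sqrt n)\<^sup>2 = (x i + d)\<^sup>2" by (simp add: d_def)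
    also have "\<dots> \<le> 2 * (x i)\<^sup>2 + 2 * d\<^sup>2"
      using zero_le_power2[of "x i - d"] by (simp add: power2_eq_square algebra_simps)
    finally show ?thesis using d by simp
  qed
  then have "(\<Sum>i<n. (of_int (a i) / sqrt n)\<^sup>2) \<le> (\<Sum>i<n. 2 * (x i)\<^sup>2 + 2 / n)"
    by (intro sum_mono) simp
  also have "\<dots> \<le> 4"
    using x n by (simp add: sum.distrib sum_distrib_left[symmetric])
  finally have "(\<Sum>i<n. (of_int (a i))\<^sup>2) / n \<le> (4::real)"
    by (simp add: power_divide sum_divide_distrib)
  then have "of_int (\<Sum>i<n. (a i)\<^sup>2) \<le> (of_int (4 * int n) :: real)"
    using n by (simp add: field_simps)
  then have sq: "(\<Sum>i<n. (a i)\<^sup>2) \<le> 4 * int n"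
    by (simp only: of_int_le_iff)
  have "a i \<in> {- 4 * int n..4 * int n}" if "i < n" for i
  proof -
    have "\<bar>a i\<bar> \<le> (a i)\<^sup>2"
      using self_le_power[of "\<bar>a i\<bar>" 2] by (cases "a i = 0") auto
    also have "(a i)\<^sup>2 \<le> (\<Sum>i<n. (a i)\<^sup>2)"
      using that by (intro member_le_sum) auto
    finally show ?thesis using sq by auto
  qed
  then have "b \<in> lattice_points n"
    using sq by (auto simp: b_def lattice_points_def)
  moreover have "quadratic_form n W (\<lambda>i. if i < n then of_int (a i) / sqrt n else x i) = quadratic_form n W (\<lambda>i. of_int (b i) / sqrt n)"
    unfolding quadratic_form_def by (intro sum.cong refl) (simp add: b_def)
  ultimately show ?thesis
    using le by auto
qed

lemma sum_half_powers: "(\<Sum>z\<in>{- int m..int m}. (1 / 2 :: real) ^ nat \<bar>z\<bar>) = 3 - 2 * (1 / 2) ^ m"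
proof (induction m)
  case (Suc m)
  have "{- int (Suc m)..int (Suc m)} = insert (- int (Suc m)) (insert (int (Suc m)) {- int m..int m})"
    by auto
  then show ?case
    using Suc by (simp add: nat_add_distrib)
qed simp

text \<open>Points are counted with weights \<open>(1/2) ^ \<bar>a i\<bar>\<close>, for which the sum over all of \<open>\<int>\<^sup>n\<close> factorizes and is at most
\<open>3 ^ n\<close>. Since \<open>\<bar>a i\<bar> \<le> (a i)^2\<close>, a point of the ball has weight at least \<open>(1/2) ^ (4 * n)\<close>, and
\<open>48 = 3 * 2 ^ 4\<close>.\<close>

lemma card_lattice_points: "real (card (lattice_points n)) \<le> 48 ^ n"
proof -
  have w: "(1 / 2 :: real) ^ (4 * n) \<le> (\<Prod>i<n. (1 / 2) ^ nat \<bar>a i\<bar>)" if "a \<in> lattice_points n" for a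
  proof -
    have "(\<Sum>i<n. \<bar>a i\<bar>) \<le> (\<Sum>i<n. (a i)\<^sup>2)"
    proof (intro sum_mono)
      fix i show "\<bar>a i\<bar> \<le> (a i)\<^sup>2"
        using self_le_power[of "\<bar>a i\<bar>" 2] by (cases "a i = 0") auto
    qed
    then have "(\<Sum>i<n. \<bar>a i\<bar>) \<le> 4 * int n"
      using that by (simp add: lattice_points_def)
    moreover have "int (\<Sum>i<n. nat \<bar>a i\<bar>) = (\<Sum>i<n. \<bar>a i\<bar>)"
      by simp
    ultimately have "(\<Sum>i<n. nat \<bar>a i\<bar>) \<le> 4 * n"
      by linarith
    then show ?thesis
      by (simp add: power_sum[symmetric] power_decreasing)
  qed
  have "real (card (lattice_points n)) * (1 / 2) ^ (4 * n) = (\<Sum>a\<in>lattice_points n. (1 / 2) ^ (4 * n))"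
    by simp
  also have "\<dots> \<le> (\<Sum>a\<in>lattice_points n. \<Prod>i<n. (1 / 2) ^ nat \<bar>a i\<bar>)"
    by (intro sum_mono w)
  also have "\<dots> \<le> (\<Sum>a\<in>{..<n} \<rightarrow>\<^sub>E {- 4 * int n..4 * int n}. \<Prod>i<n. (1 / 2) ^ nat \<bar>a i\<bar>)"
  proof (rule sum_mono2)
    show "finite ({..<n} \<rightarrow>\<^sub>E {- 4 * int n..4 * int n})"
      by (intro finite_PiE) auto
    show "lattice_points n \<subseteq> {..<n} \<rightarrow>\<^sub>E {- 4 * int n..4 * int n}"
      unfolding lattice_points_def by blast
    show "0 \<le> (\<Prod>i<n. (1 / 2 :: real) ^ nat \<bar>a i\<bar>)" for a :: "nat \<Rightarrow> int"
      by (rule prod_nonneg) simp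
  qed
  also have "\<dots> = (\<Prod>i<n. \<Sum>z\<in>{- 4 * int n..4 * int n}. (1 / 2) ^ nat \<bar>z\<bar>)"
    by (intro prod_sum_PiE[symmetric]) auto
  also have "\<dots> \<le> (\<Prod>i<n. 3)"
  proof (rule prod_mono, rule conjI)
    show "0 \<le> (\<Sum>z\<in>{- 4 * int n..4 * int n}. (1 / 2 :: real) ^ nat \<bar>z\<bar>)"
      by (rule sum_nonneg) simp
    have "(\<Sum>z\<in>{- 4 * int n..4 * int n}. (1 / 2 :: real) ^ nat \<bar>z\<bar>) = 3 - 2 * (1 / 2) ^ (4 * n)"
      using sum_half_powers[of "4 * n"] by simp
    moreover have "0 \<le> (1 / 2 :: real) ^ (4 * n)" by (rule zero_le_power) simp
    ultimately show "(\<Sum>z\<in>{- 4 * int n..4 * int n}. (1 / 2 :: real) ^ nat \<bar>z\<bar>) \<le> 3"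
      by linarith
  qed
  finally have "real (card (lattice_points n)) * (1 / 2) ^ (4 * n) \<le> 3 ^ n" by simp
  moreover have "(1 / 2 :: real) ^ (4 * n) = 1 / 16 ^ n"
    by (simp add: power_mult power_divide)
  moreover have "(48::real) ^ n = 3 ^ n * 16 ^ n"
    by (simp add: power_mult_distrib[symmetric])
  ultimately show ?thesis
    by (simp add: field_simps)
qed

lemma quadratic_form_scale: "quadratic_form n W (\<lambda>i. c * x i) = c\<^sup>2 * quadratic_form n W x"
  unfolding quadratic_form_def sum_distrib_left by (intro sum.cong refl) (simp add: power2_eq_square mult_ac)

text \<open>Polarization: the form bound gives \<open>4 * t * A \<le> M * (2 * B + 2 * t^2 * A)\<close> for the squared norms \<open>A\<close> of the image
and \<open>B\<close> of \<open>x\<close>, and \<open>t = 1 / M\<close> is the optimal choice.\<close>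

lemma kernel_norm_le_form_bound:
  assumes sym: "\<And>i j. W i j = W j i" and M: "0 \<le> M"
    and bd: "\<And>x. (\<Sum>i<n. (x i)\<^sup>2) \<le> 1 \<Longrightarrow> \<bar>quadratic_form n W x\<bar> \<le> M"
  shows "(\<Sum>i<n. (kernel_apply n W x i)\<^sup>2) \<le> M\<^sup>2 * (\<Sum>i<n. (x i)\<^sup>2)"
proof -
  have q: "\<bar>quadratic_form n W v\<bar> \<le> M * (\<Sum>i<n. (v i)\<^sup>2)" for v
  proof (cases "(\<Sum>i<n. (v i)\<^sup>2) = 0")
    case True
    then have "\<forall>i<n. v i = 0"
      by (subst (asm) sum_nonneg_eq_0_iff) auto
    then show ?thesis using True by (simp add: quadratic_form_def)
  next
    case False
    define c where "c = sqrt (\<Sum>i<n. (v i)\<^sup>2)"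
    have c2: "c\<^sup>2 = (\<Sum>i<n. (v i)\<^sup>2)"
      unfolding c_def by (simp add: sum_nonneg)
    have c0: "c \<noteq> 0" using False c2 by auto
    have "(\<Sum>i<n. (1 / c * v i)\<^sup>2) = 1"
      using c0 by (simp add: power_divide sum_divide_distrib[symmetric] c2[symmetric])
    then have "\<bar>quadratic_form n W (\<lambda>i. 1 / c * v i)\<bar> \<le> M"
      by (intro bd) simp
    then show ?thesis
      unfolding quadratic_form_scale c2[symmetric] using c0 by (simp add: abs_mult power_divide field_simps)
  qed
  define y where "y = kernel_apply n W x"
  define A where "A = (\<Sum>i<n. (y i)\<^sup>2)"
  define B where "B = (\<Sum>i<n. (x i)\<^sup>2)"
  have pol: "4 * t * A \<le> M * (2 * B + 2 * t\<^sup>2 * A)" for t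
  proof -
    have cross: "(\<Sum>i<n. \<Sum>j<n. W i j * x i * y j) = (\<Sum>i<n. \<Sum>j<n. W i j * y i * x j)"
      by (subst sum.swap) (intro sum.cong refl, simp add: sym mult_ac)
    have A: "A = (\<Sum>i<n. \<Sum>j<n. W i j * y i * x j)"
      unfolding A_def power2_eq_square by (subst (2) y_def) (simp add: kernel_apply_def sum_distrib_left mult_ac)
    have e: "quadratic_form n W (\<lambda>i. x i + s * y i) = quadratic_form n W x + 2 * s * A + s\<^sup>2 * quadratic_form n W y" for s
    proof -
      have "quadratic_form n W (\<lambda>i. x i + s * y i) = quadratic_form n W x + s * (\<Sum>i<n. \<Sum>j<n. W i j * x i * y j)
          + s * (\<Sum>i<n. \<Sum>j<n. W i j * y i * x j) + s\<^sup>2 * quadratic_form n W y"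
        unfolding quadratic_form_def sum_distrib_left sum.distrib[symmetric]
        by (intro sum.cong refl) (simp add: power2_eq_square algebra_simps)
      then show ?thesis unfolding cross A by simp
    qed
    have n2: "(\<Sum>i<n. (x i + s * y i)\<^sup>2) = B + 2 * s * (\<Sum>i<n. x i * y i) + s\<^sup>2 * A" for s
      unfolding A_def B_def sum_distrib_left sum.distrib[symmetric]
      by (intro sum.cong refl) (simp add: power2_eq_square algebra_simps)
    have "4 * t * A = quadratic_form n W (\<lambda>i. x i + t * y i) - quadratic_form n W (\<lambda>i. x i + (- t) * y i)"
      unfolding e by simp
    also have "\<dots> \<le> M * (\<Sum>i<n. (x i + t * y i)\<^sup>2) + M * (\<Sum>i<n. (x i + (- t) * y i)\<^sup>2)"
      using q[of "\<lambda>i. x i + t * y i"] q[of "\<lambda>i. x i + (- t) * y i"] by linarith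
    also have "\<dots> = M * (2 * B + 2 * t\<^sup>2 * A)"
      unfolding n2 by (simp add: algebra_simps)
    finally show ?thesis .
  qed
  have "A \<le> M\<^sup>2 * B"
  proof (cases "M = 0")
    case True
    then show ?thesis using pol[of 1] by simp
  next
    case False
    then have "0 < M" using M by simp
    then show ?thesis using pol[of "1 / M"] by (simp add: power2_eq_square field_simps)
  qed
  then show ?thesis by (simp add: A_def B_def y_def)
qed

text \<open>A maximum over finitely many points is at most the sum of even powers, whose expectations can be taken one
by one.\<close>

lemma closed_walk_sum_le_lattice:
  assumes sym: "\<And>i j. W i j = W j i" and diag: "\<And>i. W i i = 0" and n: "0 < n" and k: "0 < k"
  shows "closed_walk_sum n W (2 * k) \<le> real n * (\<Sum>a\<in>lattice_points n. quadratic_form n W (\<lambda>i. of_int (a i) / sqrt n) ^ (2 * k))"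
proof -
  define Q where "Q = (\<lambda>a :: nat \<Rightarrow> int. \<bar>quadratic_form n W (\<lambda>i. of_int (a i) / sqrt n)\<bar>)"
  define M where "M = Max (Q ` lattice_points n)"
  have ne: "lattice_points n \<noteq> {}"
    using quadratic_form_le_lattice[of W n "\<lambda>_. 0"] diag n by auto
  have "M \<in> Q ` lattice_points n"
    unfolding M_def using ne by (intro Max_in) auto
  then obtain a where a: "a \<in> lattice_points n" "M = Q a" by auto
  have M0: "0 \<le> M" unfolding a(2) Q_def by simp
  have bd: "\<bar>quadratic_form n W x\<bar> \<le> M" if x: "(\<Sum>i<n. (x i)\<^sup>2) \<le> 1" for x
  proof -
    obtain b where b: "b \<in> lattice_points n" "\<bar>quadratic_form n W x\<bar> \<le> Q b"
      using quadratic_form_le_lattice[of W n x] diag n x unfolding Q_def by auto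
    have "Q b \<le> M" unfolding M_def using b(1) by (intro Max_ge) auto
    then show ?thesis using b(2) by linarith
  qed
  have "closed_walk_sum n W (2 * k) \<le> real n * (M\<^sup>2) ^ k"
  proof (rule closed_walk_sum_le_norm[OF _ k])
    show "(\<Sum>i<n. (kernel_apply n W x i)\<^sup>2) \<le> M\<^sup>2 * (\<Sum>i<n. (x i)\<^sup>2)" for x
      by (rule kernel_norm_le_form_bound) (fact sym M0 bd)+
  qed (rule sym, simp)
  also have "(M\<^sup>2) ^ k = quadratic_form n W (\<lambda>i. of_int (a i) / sqrt n) ^ (2 * k)"
    unfolding a(2) Q_def by (simp add: power_mult)
  also have "\<dots> \<le> (\<Sum>a\<in>lattice_points n. quadratic_form n W (\<lambda>i. of_int (a i) / sqrt n) ^ (2 * k))"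
    using a(1) by (intro member_le_sum) (auto simp: power_mult)
  finally show ?thesis
    by (simp add: mult_left_mono)
qed

lemma quadratic_form_edge_kernel:
  "quadratic_form n (edge_kernel f) x = (\<Sum>e\<in>vertex_pairs n. 2 * x (fst e) * x (snd e) * f e)"
proof -
  define g where "g = (\<lambda>e. edge_kernel f (fst e) (snd e) * x (fst e) * x (snd e))"
  let ?V = "vertex_pairs n"
  have "quadratic_form n (edge_kernel f) x = (\<Sum>e\<in>{..<n} \<times> {..<n}. g e)"
    by (simp add: quadratic_form_def g_def sum.cartesian_product case_prod_beta)
  also have "\<dots> = (\<Sum>e\<in>?V \<union> prod.swap ` ?V. g e)"
  proof (rule sum.mono_neutral_right)
    show "\<forall>e\<in>{..<n} \<times> {..<n} - (?V \<union> prod.swap ` ?V). g e = 0"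
    proof
      fix e assume "e \<in> {..<n} \<times> {..<n} - (?V \<union> prod.swap ` ?V)"
      moreover have "(i, j) \<in> prod.swap ` ?V" if "j < i" "i < n" for i j
        using that by (intro image_eqI[of _ _ "(j, i)"]) (auto simp: vertex_pairs_def)
      ultimately have "fst e = snd e"
        by (cases e) (auto simp: vertex_pairs_def intro: linorder_cases)
      then show "g e = 0" by (simp add: g_def edge_kernel_def)
    qed
  qed (auto simp: vertex_pairs_def)
  also have "\<dots> = (\<Sum>e\<in>?V. g e) + (\<Sum>e\<in>prod.swap ` ?V. g e)"
    by (intro sum.union_disjoint finite_imageI finite_vertex_pairs) (auto simp: vertex_pairs_def)
  also have "(\<Sum>e\<in>prod.swap ` ?V. g e) = (\<Sum>e\<in>?V. g (prod.swap e))"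
    by (subst sum.reindex) (auto simp: inj_on_def)
  also have "(\<Sum>e\<in>?V. g (prod.swap e)) = (\<Sum>e\<in>?V. g e)"
    by (intro sum.cong refl) (simp add: g_def edge_kernel_sym[of f "snd _"])
  also have "(\<Sum>e\<in>?V. g e) + (\<Sum>e\<in>?V. g e) = (\<Sum>e\<in>?V. 2 * x (fst e) * x (snd e) * f e)"
    unfolding sum.distrib[symmetric]
    by (intro sum.cong refl) (auto simp: g_def edge_kernel_def sorted_pair_def vertex_pairs_def)
  finally show ?thesis .
qed

text \<open>The coefficients of the independent entries in a quadratic form have sum of squares at most twice the fourth
power of the norm of \<open>x\<close>.\<close>

lemma sum_pair_coefficients:
  "(\<Sum>e\<in>vertex_pairs n. (2 * x (fst e) * x (snd e))\<^sup>2) \<le> 2 * (\<Sum>i<n. (x i)\<^sup>2)\<^sup>2" for x :: "nat \<Rightarrow> real"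
proof -
  have "(\<Sum>e\<in>vertex_pairs n. (2 * x (fst e) * x (snd e))\<^sup>2) = 2 * quadratic_form n (edge_kernel (\<lambda>_. 1)) (\<lambda>i. (x i)\<^sup>2)"
    unfolding quadratic_form_edge_kernel sum_distrib_left
    by (intro sum.cong refl) (simp add: power_mult_distrib)
  also have "quadratic_form n (edge_kernel (\<lambda>_. 1)) (\<lambda>i. (x i)\<^sup>2) \<le> (\<Sum>i<n. \<Sum>j<n. (x i)\<^sup>2 * (x j)\<^sup>2)"
    unfolding quadratic_form_def by (intro sum_mono) (simp add: edge_kernel_def)
  finally show ?thesis
    by (simp add: power2_eq_square[of "sum _ _"] sum_product)
qed

lemma power_over_fact_le_exp:
  fixes v :: real
  assumes "0 \<le> v"
  shows "v ^ m / fact m \<le> exp v"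
proof -
  have s: "(\<lambda>n. v ^ n /\<^sub>R fact n) sums exp v" by (rule exp_converges)
  have "(\<Sum>n\<in>{m}. v ^ n /\<^sub>R fact n) \<le> exp v"
    unfolding sums_unique[OF s] by (rule sum_le_suminf) (use s assms in \<open>auto simp: sums_iff\<close>)
  then show ?thesis by (simp add: divide_inverse mult.commute)
qed

section \<open>The norm of a sparse random kernel\<close>

lemma skew_form_mgf:
  assumes b: "(\<Sum>i<n. (b i)\<^sup>2) \<le> 4"
  shows "measure_pmf.expectation (Pi_pmf (vertex_pairs n) True (\<lambda>_. skew_pmf))
      (\<lambda>\<omega>. exp (s * quadratic_form n (edge_kernel (\<lambda>e. skew (\<omega> e))) b)) \<le> exp (36 * s\<^sup>2)"
proof -
  let ?V = "vertex_pairs n"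
  let ?c = "\<lambda>e. s * (2 * b (fst e) * b (snd e))"
  have "measure_pmf.expectation (Pi_pmf ?V True (\<lambda>_. skew_pmf))
      (\<lambda>\<omega>. exp (s * quadratic_form n (edge_kernel (\<lambda>e. skew (\<omega> e))) b)) =
    measure_pmf.expectation (Pi_pmf ?V True (\<lambda>_. skew_pmf)) (\<lambda>\<omega>. \<Prod>e\<in>?V. exp (?c e * skew (\<omega> e)))"
    by (simp add: quadratic_form_edge_kernel exp_sum[symmetric] sum_distrib_left mult.assoc)
  also have "\<dots> = (\<Prod>e\<in>?V. measure_pmf.expectation skew_pmf (\<lambda>a. exp (?c e * skew a)))"
    by (rule expectation_prod_Pi_pmf_signed) auto
  also have "\<dots> \<le> (\<Prod>e\<in>?V. exp ((?c e)\<^sup>2 * (2 - (-1))\<^sup>2 / 8))"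
  proof (rule prod_mono, rule conjI)
    fix e
    show "0 \<le> measure_pmf.expectation skew_pmf (\<lambda>a. exp (?c e * skew a))"
      by (intro Bochner_Integration.integral_nonneg) simp
    show "measure_pmf.expectation skew_pmf (\<lambda>a. exp (?c e * skew a)) \<le> exp ((?c e)\<^sup>2 * (2 - (-1))\<^sup>2 / 8)"
      by (rule pmf_mgf_le) (use expectation_skew[of "\<lambda>x. x"] in \<open>auto simp: skew_def\<close>)
  qed
  also have "\<dots> = exp (9 / 8 * (s\<^sup>2 * (\<Sum>e\<in>?V. (2 * b (fst e) * b (snd e))\<^sup>2)))"
    unfolding exp_sum[OF finite_vertex_pairs, symmetric] sum_distrib_left
    by (intro arg_cong[of _ _ exp] sum.cong refl) (simp add: power_mult_distrib)
  also have "\<dots> \<le> exp (9 / 8 * (s\<^sup>2 * 32))"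
  proof -
    have "(\<Sum>i<n. (b i)\<^sup>2)\<^sup>2 \<le> 4\<^sup>2"
      using b by (intro power_mono sum_nonneg) auto
    then have "(\<Sum>e\<in>?V. (2 * b (fst e) * b (snd e))\<^sup>2) \<le> 32"
      using sum_pair_coefficients[where n = n and x = b] by simp
    then have "s\<^sup>2 * (\<Sum>e\<in>?V. (2 * b (fst e) * b (snd e))\<^sup>2) \<le> s\<^sup>2 * 32"
      by (rule mult_left_mono) simp
    then show ?thesis by simp
  qed
  finally show ?thesis by simp
qed

text \<open>A single term of the exponential series at \<open>sqrt k * \<bar>u\<bar>\<close>; the tilt \<open>sqrt k\<close> balances \<open>(2 * k)!\<close> against the
Gaussian bound \<open>exp (36 * k)\<close> of the generating function.\<close>

lemma even_power_le_exp:
  fixes u :: real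
  assumes k: "0 < k"
  shows "u ^ (2 * k) \<le> (4 * real k) ^ k * (exp (sqrt k * u) + exp (- sqrt k * u))"
proof -
  define v where "v = sqrt k * \<bar>u\<bar>"
  have v0: "0 \<le> v" by (simp add: v_def)
  have pv: "v ^ (2 * k) = real k ^ k * u ^ (2 * k)"
    by (simp add: v_def power_mult power_mult_distrib)
  have f1: "v ^ (2 * k) \<le> fact (2 * k) * exp v"
    using power_over_fact_le_exp[OF v0, of "2 * k"] by (simp add: field_simps)
  have f2: "fact (2 * k) * exp v \<le> real (2 * k) ^ (2 * k) * exp v"
    using fact_le_power[of "2 * k", where 'a = real] by (intro mult_right_mono) auto
  have e: "real (2 * k) ^ (2 * k) = real k ^ k * (4 * real k) ^ k"
  proof -
    have "real (2 * k) ^ (2 * k) = ((2 * real k)\<^sup>2) ^ k" by (simp add: power_mult)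
    also have "(2 * real k)\<^sup>2 = real k * (4 * real k)" by (simp add: power2_eq_square)
    finally show ?thesis by (simp only: power_mult_distrib)
  qed
  have "real k ^ k * u ^ (2 * k) \<le> real k ^ k * (4 * real k) ^ k * exp v"
    unfolding pv[symmetric] e[symmetric] by (rule order.trans[OF f1 f2])
  then have "real k ^ k * u ^ (2 * k) \<le> real k ^ k * ((4 * real k) ^ k * exp v)"
    by (simp only: mult.assoc)
  then have "u ^ (2 * k) \<le> (4 * real k) ^ k * exp v"
    using k by (simp add: mult_le_cancel_left)
  also have "\<dots> \<le> (4 * real k) ^ k * (exp (sqrt k * u) + exp (- sqrt k * u))"
    by (intro mult_left_mono) (auto simp: v_def abs_if)
  finally show ?thesis by simp
qed

text \<open>The dense ensemble has dimension \<open>2 * k\<close>, of the order of the length of the walks. Hence the factor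
\<open>48 ^ (2 * k)\<close> from the lattice points is just another constant to the power \<open>k\<close>.\<close>

lemma card_doubly_covered_le:
  assumes k: "0 < k"
  shows "real (card {xs \<in> words (2 * k) (2 * k). doubly_covered xs}) \<le> real (2 * k) * (2 * (9216 * exp 36 * real k) ^ k)"
proof -
  let ?N = "2 * k"
  let ?P = "Pi_pmf (vertex_pairs ?N) True (\<lambda>_. skew_pmf)"
  let ?q = "\<lambda>a \<omega>. quadratic_form ?N (edge_kernel (\<lambda>e. skew (\<omega> e))) (\<lambda>i. of_int (a i) / sqrt ?N)"
  have int: "integrable ?P (f :: _ \<Rightarrow> real)" for f
    by (intro integrable_measure_pmf_finite finite_set_Pi_pmf) auto
  have each: "measure_pmf.expectation ?P (\<lambda>\<omega>. ?q a \<omega> ^ (2 * k)) \<le> 2 * (4 * exp 36 * real k) ^ k"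
    if a: "a \<in> lattice_points ?N" for a
  proof -
    have "real_of_int (\<Sum>i<?N. (a i)\<^sup>2) \<le> real_of_int (4 * int ?N)"
      using a unfolding of_int_le_iff by (simp add: lattice_points_def)
    then have b: "(\<Sum>i<?N. (real_of_int (a i) / sqrt ?N)\<^sup>2) \<le> 4"
      using k by (simp add: power_divide sum_divide_distrib[symmetric] field_simps)
    have "measure_pmf.expectation ?P (\<lambda>\<omega>. ?q a \<omega> ^ (2 * k)) \<le>
        measure_pmf.expectation ?P (\<lambda>\<omega>. (4 * real k) ^ k * (exp (sqrt k * ?q a \<omega>) + exp (- sqrt k * ?q a \<omega>)))"
      by (intro integral_mono int even_power_le_exp k)
    also have "\<dots> = (4 * real k) ^ k * (measure_pmf.expectation ?P (\<lambda>\<omega>. exp (sqrt k * ?q a \<omega>))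
        + measure_pmf.expectation ?P (\<lambda>\<omega>. exp (- sqrt k * ?q a \<omega>)))"
      by (simp add: Bochner_Integration.integral_add[OF int int] del: of_nat_power)
    also have "\<dots> \<le> (4 * real k) ^ k * (exp (36 * (sqrt k)\<^sup>2) + exp (36 * (- sqrt k)\<^sup>2))"
      by (intro mult_left_mono add_mono skew_form_mgf b) simp
    also have "\<dots> = 2 * (4 * exp 36 * real k) ^ k"
      by (simp add: power_mult_distrib exp_of_nat_mult[symmetric] mult_ac)
    finally show ?thesis .
  qed
  have "real (card {xs \<in> words ?N (2 * k). doubly_covered xs}) \<le> measure_pmf.expectation ?P
      (\<lambda>\<omega>. closed_walk_sum ?N (edge_kernel (\<lambda>e. skew (\<omega> e))) (2 * k))"
    by (rule card_doubly_covered_le_expectation[OF k])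
  also have "\<dots> \<le> measure_pmf.expectation ?P (\<lambda>\<omega>. real ?N * (\<Sum>a\<in>lattice_points ?N. ?q a \<omega> ^ (2 * k)))"
  proof (intro integral_mono int)
    fix \<omega>
    show "closed_walk_sum ?N (edge_kernel (\<lambda>e. skew (\<omega> e))) (2 * k) \<le> real ?N * (\<Sum>a\<in>lattice_points ?N. ?q a \<omega> ^ (2 * k))"
      by (rule closed_walk_sum_le_lattice[OF edge_kernel_sym]) (use k in \<open>auto simp: edge_kernel_def\<close>)
  qed
  also have "\<dots> = real ?N * (\<Sum>a\<in>lattice_points ?N. measure_pmf.expectation ?P (\<lambda>\<omega>. ?q a \<omega> ^ (2 * k)))"
    by (simp add: Bochner_Integration.integral_sum[OF int])
  also have "\<dots> \<le> real ?N * (\<Sum>a\<in>lattice_points ?N. 2 * (4 * exp 36 * real k) ^ k)"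
    by (intro mult_left_mono sum_mono each) auto
  also have "\<dots> = real ?N * (real (card (lattice_points ?N)) * (2 * (4 * exp 36 * real k) ^ k))"
    by simp
  also have "\<dots> \<le> real ?N * (48 ^ ?N * (2 * (4 * exp 36 * real k) ^ k))"
    by (intro mult_left_mono mult_right_mono card_lattice_points) auto
  also have "(48 :: real) ^ ?N * (2 * (4 * exp 36 * real k) ^ k) = 2 * (9216 * exp 36 * real k) ^ k"
  proof -
    have "(48 :: real) ^ ?N = 2304 ^ k" by (simp add: power_mult)
    moreover have "(9216 * exp 36 * real k) ^ k = 2304 ^ k * (4 * exp 36 * real k) ^ k"
      unfolding power_mult_distrib[symmetric] by (rule arg_cong[of _ _ "\<lambda>x. x ^ k"]) simp
    ultimately show ?thesis by simp
  qed
  finally show ?thesis .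
qed

text \<open>Four times \<open>9216 * exp 36\<close>, the base in the walk count, times \<open>exp 1\<close> to leave room for Markov's inequality.\<close>

definition noise_const :: real where
  "noise_const = 36864 * exp 37"

lemma noise_const_pos: "0 < noise_const"
  by (simp add: noise_const_def)

text \<open>The squared norm is of order \<open>k\<close>, where \<open>k\<close> may be anything above \<open>n * p\<close>; choosing it also above a multiple of
\<open>ln n\<close> makes the failure probability small.\<close>

lemma random_kernel_norm:
  fixes X :: "nat \<times> nat \<Rightarrow> 'a \<Rightarrow> real"
  assumes fin: "\<And>e. e \<in> vertex_pairs n \<Longrightarrow> finite (set_pmf (P e))" and k: "0 < k" and p: "0 \<le> p" "p \<le> 1"
    and np: "real n * p \<le> real k"
    and bd: "\<And>e a. e \<in> vertex_pairs n \<Longrightarrow> a \<in> set_pmf (P e) \<Longrightarrow> \<bar>X e a\<bar> \<le> 2"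
    and mean: "\<And>e. e \<in> vertex_pairs n \<Longrightarrow> measure_pmf.expectation (P e) (X e) = 0"
    and var: "\<And>e. e \<in> vertex_pairs n \<Longrightarrow> measure_pmf.expectation (P e) (\<lambda>a. (X e a)\<^sup>2) \<le> p"
  shows "measure_pmf.prob (Pi_pmf (vertex_pairs n) d P)
      {\<omega>. \<not> (\<forall>x. (\<Sum>i<n. (kernel_apply n (edge_kernel (\<lambda>e. X e (\<omega> e))) x i)\<^sup>2)
          \<le> noise_const * real k * (\<Sum>i<n. (x i)\<^sup>2))} \<le> 2 * real n * exp (- real k)"
proof -
  let ?P = "Pi_pmf (vertex_pairs n) d P"
  let ?W = "\<lambda>\<omega>. edge_kernel (\<lambda>e. X e (\<omega> e))"
  let ?S = "\<Sum>xs\<in>words n (2 * k). if doubly_covered xs then p ^ (card (set xs) - 1) else 0"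
  let ?L = "9216 * exp 36 * real k"
  have int: "integrable ?P (f :: _ \<Rightarrow> real)" for f
    using fin by (intro integrable_measure_pmf_finite finite_set_Pi_pmf) auto
  have "real (2 * k) * ?S \<le> real n * real (card {xs \<in> words (2 * k) (2 * k). doubly_covered xs})"
    by (rule doubly_covered_comparison[where N' = k]) (use k p np in auto)
  also have "\<dots> \<le> real n * (real (2 * k) * (2 * ?L ^ k))"
    by (intro mult_left_mono card_doubly_covered_le k) auto
  finally have "real (2 * k) * ?S \<le> real (2 * k) * (2 * real n * ?L ^ k)"
    by (simp only: mult_ac)
  then have S: "?S \<le> 2 * real n * ?L ^ k"
    using k by (simp only: mult_le_cancel_left_pos of_nat_0_less_iff zero_less_mult_iff zero_less_numeral simp_thms)
  define c where "c = (noise_const * real k) ^ k"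
  have c0: "0 < c"
    using k noise_const_pos by (simp add: c_def)
  have cw0: "0 \<le> closed_walk_sum n (?W \<omega>) (2 * k)" for \<omega>
    by (subst closed_walk_sum_eq_trace[OF edge_kernel_sym k]) (simp add: sum_nonneg)
  have "{\<omega>. \<not> (\<forall>x. (\<Sum>i<n. (kernel_apply n (?W \<omega>) x i)\<^sup>2) \<le> noise_const * real k * (\<Sum>i<n. (x i)\<^sup>2))}
      \<subseteq> {\<omega>. c \<le> closed_walk_sum n (?W \<omega>) (2 * k)}"
  proof (rule subsetI, rule CollectI, rule ccontr)
    fix \<omega> assume \<omega>: "\<omega> \<in> {\<omega>. \<not> (\<forall>x. (\<Sum>i<n. (kernel_apply n (?W \<omega>) x i)\<^sup>2) \<le> noise_const * real k * (\<Sum>i<n. (x i)\<^sup>2))}"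
      and "\<not> c \<le> closed_walk_sum n (?W \<omega>) (2 * k)"
    then have lt: "closed_walk_sum n (?W \<omega>) (2 * k) \<le> c" by simp
    have "(\<Sum>i<n. (kernel_apply n (?W \<omega>) x i)\<^sup>2) \<le> noise_const * real k * (\<Sum>i<n. (x i)\<^sup>2)" for x
    proof -
      have "(\<Sum>i<n. (kernel_apply n (?W \<omega>) x i)\<^sup>2) ^ k \<le> closed_walk_sum n (?W \<omega>) (2 * k) * (\<Sum>i<n. (x i)\<^sup>2) ^ k"
        by (rule kernel_norm_le_closed_walk_sum[OF edge_kernel_sym k])
      also have "\<dots> \<le> c * (\<Sum>i<n. (x i)\<^sup>2) ^ k"
        by (rule mult_right_mono[OF lt]) (simp add: sum_nonneg)
      also have "\<dots> = (noise_const * real k * (\<Sum>i<n. (x i)\<^sup>2)) ^ k"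
        by (simp add: c_def power_mult_distrib)
      finally show ?thesis
        using k noise_const_pos by (subst (asm) power_mono_iff) (auto intro!: sum_nonneg mult_nonneg_nonneg)
    qed
    then show False using \<omega> by blast
  qed
  then have "measure_pmf.prob ?P {\<omega>. \<not> (\<forall>x. (\<Sum>i<n. (kernel_apply n (?W \<omega>) x i)\<^sup>2) \<le> noise_const * real k * (\<Sum>i<n. (x i)\<^sup>2))}
      \<le> measure_pmf.prob ?P {\<omega>. c \<le> closed_walk_sum n (?W \<omega>) (2 * k)}"
    by (intro measure_pmf.finite_measure_mono) auto
  also have "\<dots> \<le> measure_pmf.expectation ?P (\<lambda>\<omega>. closed_walk_sum n (?W \<omega>) (2 * k)) / c"
    using integral_Markov_inequality_measure[where M = ?P and u = "\<lambda>\<omega>. closed_walk_sum n (?W \<omega>) (2 * k)" and A = UNIV and c = c]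
      int cw0 c0 by simp
  also have "\<dots> \<le> 4 ^ k * ?S / c"
    using c0 by (intro divide_right_mono expectation_closed_walk_sum_upper fin k p bd mean var) auto
  also have "\<dots> \<le> 4 ^ k * (2 * real n * ?L ^ k) / c"
    using S c0 by (intro divide_right_mono mult_left_mono) auto
  also have "\<dots> = 2 * real n * exp (- real k)"
  proof -
    have "c = (4 * ?L) ^ k * exp (real k)"
    proof -
      have e: "exp (37 :: real) = exp 36 * exp 1" by (simp add: exp_add[symmetric])
      have "c = (4 * ?L * exp 1) ^ k"
        unfolding c_def noise_const_def e by (simp add: mult_ac)
      then show ?thesis
        by (simp add: power_mult_distrib exp_of_nat_mult[symmetric])
    qed
    then have "2 * real n * exp (- real k) * c = 2 * real n * (4 * ?L) ^ k * (exp (- real k) * exp (real k))"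
      by (simp only: mult_ac)
    also have "\<dots> = 4 ^ k * (2 * real n * ?L ^ k)"
      unfolding power_mult_distrib[of 4 ?L] by (simp add: exp_minus)
    finally have "4 ^ k * (2 * real n * ?L ^ k) = 2 * real n * exp (- real k) * c" ..
    then show ?thesis
      using c0 by (simp only: nonzero_mult_div_cancel_right less_imp_neq[symmetric] not_False_eq_True)
  qed
  finally show ?thesis .
qed

section \<open>Chernoff bounds and synchronization\<close>

lemma form_le_of_kernel_norm:
  assumes "\<And>x. (\<Sum>i<n. (kernel_apply n W x i)\<^sup>2) \<le> c * (\<Sum>i<n. (x i)\<^sup>2)"
  shows "\<bar>\<Sum>i<n. \<Sum>j<n. W i j * f i * f j\<bar> \<le> sqrt c * (\<Sum>i<n. (f i)\<^sup>2)"
proof -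
  define F where "F = (\<Sum>i<n. (f i)\<^sup>2)"
  have F0: "0 \<le> F" by (simp add: F_def sum_nonneg)
  have "(\<Sum>i<n. \<Sum>j<n. W i j * f i * f j)\<^sup>2 = (\<Sum>i<n. f i * kernel_apply n W f i)\<^sup>2"
    by (simp add: kernel_apply_def sum_distrib_left mult_ac)
  also have "\<dots> \<le> F * (\<Sum>i<n. (kernel_apply n W f i)\<^sup>2)"
    unfolding F_def by (rule Cauchy_Schwarz_ineq_sum)
  also have "\<dots> \<le> F * (c * F)"
    using F0 assms[of f] unfolding F_def by (intro mult_left_mono) auto
  finally have sq: "(\<Sum>i<n. \<Sum>j<n. W i j * f i * f j)\<^sup>2 \<le> c * F\<^sup>2"
    by (simp only: power2_eq_square mult.left_commute)
  have "\<bar>\<Sum>i<n. \<Sum>j<n. W i j * f i * f j\<bar> = sqrt ((\<Sum>i<n. \<Sum>j<n. W i j * f i * f j)\<^sup>2)"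
    by (rule real_sqrt_abs[symmetric])
  also have "\<dots> \<le> sqrt (c * F\<^sup>2)"
    by (rule real_sqrt_le_mono[OF sq])
  also have "\<dots> = sqrt c * F"
    using F0 by (simp add: real_sqrt_mult)
  finally show ?thesis by (simp add: F_def)
qed

text \<open>Edges outside \<open>I\<close> enter the product over \<open>V\<close> with the factor \<open>1\<close>.\<close>

lemma chernoff_lower_tail:
  fixes Y :: "'e \<Rightarrow> 'a \<Rightarrow> real"
  assumes V: "finite V" "I \<subseteq> V" and fin: "\<And>e. e \<in> V \<Longrightarrow> finite (set_pmf (P e))" and s: "0 \<le> s"
  shows "measure_pmf.prob (Pi_pmf V d P) {\<omega>. (\<Sum>e\<in>I. Y e (\<omega> e)) \<le> \<theta>} \<le>
    exp (s * \<theta>) * (\<Prod>e\<in>I. measure_pmf.expectation (P e) (\<lambda>a. exp (- s * Y e a)))"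
proof -
  let ?P = "Pi_pmf V d P"
  let ?u = "\<lambda>\<omega>. exp (- s * (\<Sum>e\<in>I. Y e (\<omega> e)))"
  have int: "integrable ?P (f :: _ \<Rightarrow> real)" for f
    using V fin by (intro integrable_measure_pmf_finite finite_set_Pi_pmf) auto
  have "measure_pmf.prob ?P {\<omega>. (\<Sum>e\<in>I. Y e (\<omega> e)) \<le> \<theta>} \<le> measure_pmf.prob ?P {\<omega>. exp (- s * \<theta>) \<le> ?u \<omega>}"
    using s by (intro measure_pmf.finite_measure_mono) (auto intro: mult_left_mono)
  also have "\<dots> \<le> measure_pmf.expectation ?P ?u / exp (- s * \<theta>)"
    using integral_Markov_inequality_measure[where M = ?P and u = ?u and A = UNIV and c = "exp (- s * \<theta>)"] int
    by simp
  also have "measure_pmf.expectation ?P ?u =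
      measure_pmf.expectation ?P (\<lambda>\<omega>. \<Prod>e\<in>V. if e \<in> I then exp (- s * Y e (\<omega> e)) else 1)"
  proof (intro Bochner_Integration.integral_cong refl)
    fix \<omega>
    have "?u \<omega> = (\<Prod>e\<in>I. exp (- s * Y e (\<omega> e)))"
      using finite_subset[OF V(2,1)] by (simp only: sum_distrib_left exp_sum)
    also have "\<dots> = (\<Prod>e\<in>V. if e \<in> I then exp (- s * Y e (\<omega> e)) else 1)"
      using V by (simp add: prod.If_cases Int_absorb1)
    finally show "?u \<omega> = (\<Prod>e\<in>V. if e \<in> I then exp (- s * Y e (\<omega> e)) else 1)" .
  qed
  also have "\<dots> = (\<Prod>e\<in>V. measure_pmf.expectation (P e) (\<lambda>a. if e \<in> I then exp (- s * Y e a) else 1))"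
    by (rule expectation_prod_Pi_pmf_signed[OF V(1) fin])
  also have "\<dots> = (\<Prod>e\<in>V. if e \<in> I then measure_pmf.expectation (P e) (\<lambda>a. exp (- s * Y e a)) else 1)"
    by (intro prod.cong refl) simp
  also have "\<dots> = (\<Prod>e\<in>I. measure_pmf.expectation (P e) (\<lambda>a. exp (- s * Y e a)))"
    using V by (simp add: prod.If_cases Int_absorb1)
  finally show ?thesis
    by (simp add: exp_minus field_simps)
qed

definition incident_pairs :: "nat \<Rightarrow> nat \<Rightarrow> (nat \<times> nat) set" where
  "incident_pairs n i = (\<lambda>j. sorted_pair (i, j)) ` ({..<n} - {i})"

lemma inj_on_incident_pairs: "inj_on (\<lambda>j. sorted_pair (i, j)) ({..<n} - {i})"
  by (auto simp: inj_on_def sorted_pair_def min_def max_def split: if_splits)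

lemma incident_pairs_subset: "i < n \<Longrightarrow> incident_pairs n i \<subseteq> vertex_pairs n"
  by (auto simp: incident_pairs_def sorted_pair_def vertex_pairs_def min_def max_def)

lemma sum_incident_pairs: "(\<Sum>e\<in>incident_pairs n i. g e) = (\<Sum>j\<in>{..<n} - {i}. g (sorted_pair (i, j)))"
  unfolding incident_pairs_def by (simp add: sum.reindex[OF inj_on_incident_pairs])

lemma prod_incident_pairs: "(\<Prod>e\<in>incident_pairs n i. g e) = (\<Prod>j\<in>{..<n} - {i}. g (sorted_pair (i, j)))"
  unfolding incident_pairs_def by (simp add: prod.reindex[OF inj_on_incident_pairs])

lemma mat_of_upper_index:
  "i < n \<Longrightarrow> j < n \<Longrightarrow> mat_of_upper n f $$ (i, j) = (if i = j then 0 else f (sorted_pair (i, j)))"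
  by (auto simp: mat_of_upper_def sorted_pair_def min_def max_def)

lemma sym_mat_of_upper: "sym_mat n (mat_of_upper n f)"
  unfolding sym_mat_def by (auto intro!: eq_matI simp: mat_of_upper_def)

text \<open>The common skeleton of both random models: a union bound over the failure of the norm estimate and the
failure of one of the \<open>n\<close> rows. \<open>R i\<close> is the aligned signal in row \<open>i\<close>.\<close>

lemma success_probability_bound:
  fixes X :: "nat \<times> nat \<Rightarrow> 'a \<Rightarrow> real" and R :: "nat \<Rightarrow> (nat \<times> nat \<Rightarrow> 'a) \<Rightarrow> real"
  assumes fin: "\<And>e. e \<in> vertex_pairs n \<Longrightarrow> finite (set_pmf (P e))" and k: "0 < k" and p: "0 \<le> p" "p \<le> 1"
    and np: "real n * p \<le> real k"
    and bd: "\<And>e a. e \<in> vertex_pairs n \<Longrightarrow> a \<in> set_pmf (P e) \<Longrightarrow> \<bar>X e a\<bar> \<le> 2"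
    and mean: "\<And>e. e \<in> vertex_pairs n \<Longrightarrow> measure_pmf.expectation (P e) (X e) = 0"
    and var: "\<And>e. e \<in> vertex_pairs n \<Longrightarrow> measure_pmf.expectation (P e) (\<lambda>a. (X e a)\<^sup>2) \<le> p"
    and rows: "\<And>i. i < n \<Longrightarrow> measure_pmf.prob (Pi_pmf (vertex_pairs n) d P) {\<omega>. R i \<omega> \<le> \<theta>} \<le> \<eta>"
    and event: "\<And>\<omega>. (\<And>f. \<bar>\<Sum>i<n. \<Sum>j<n. edge_kernel (\<lambda>e. X e (\<omega> e)) i j * f i * f j\<bar>
        \<le> sqrt (noise_const * real k) * (\<Sum>i<n. (f i)\<^sup>2)) \<Longrightarrow> (\<And>i. i < n \<Longrightarrow> \<theta> < R i \<omega>) \<Longrightarrow> \<omega> \<in> G"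
  shows "1 - 2 * real n * exp (- real k) - real n * \<eta> \<le> measure_pmf.prob (Pi_pmf (vertex_pairs n) d P) G"
proof -
  let ?P = "Pi_pmf (vertex_pairs n) d P"
  define B where "B = {\<omega>. \<not> (\<forall>x. (\<Sum>i<n. (kernel_apply n (edge_kernel (\<lambda>e. X e (\<omega> e))) x i)\<^sup>2)
          \<le> noise_const * real k * (\<Sum>i<n. (x i)\<^sup>2))}"
  define Rw where "Rw = (\<Union>i<n. {\<omega>. R i \<omega> \<le> \<theta>})"
  have "- G \<subseteq> B \<union> Rw"
  proof
    fix \<omega> assume "\<omega> \<in> - G"
    show "\<omega> \<in> B \<union> Rw"
    proof (rule ccontr)
      assume n: "\<omega> \<notin> B \<union> Rw"
      then have norm: "(\<Sum>i<n. (kernel_apply n (edge_kernel (\<lambda>e. X e (\<omega> e))) x i)\<^sup>2)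
          \<le> noise_const * real k * (\<Sum>i<n. (x i)\<^sup>2)" for x
        by (auto simp: B_def)
      have "\<theta> < R i \<omega>" if "i < n" for i
      proof -
        have "\<not> R i \<omega> \<le> \<theta>" using n that by (auto simp: Rw_def)
        then show ?thesis by simp
      qed
      then have "\<omega> \<in> G"
        by (intro event form_le_of_kernel_norm norm)
      then show False using \<open>\<omega> \<in> - G\<close> by simp
    qed
  qed
  then have "measure_pmf.prob ?P (- G) \<le> measure_pmf.prob ?P (B \<union> Rw)"
    by (intro measure_pmf.finite_measure_mono) auto
  also have "\<dots> \<le> measure_pmf.prob ?P B + measure_pmf.prob ?P Rw"
    by (intro measure_subadditive) auto
  also have "measure_pmf.prob ?P B \<le> 2 * real n * exp (- real k)"
    unfolding B_def by (rule random_kernel_norm[OF fin k p np bd mean var])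
  also have "measure_pmf.prob ?P Rw \<le> (\<Sum>i<n. measure_pmf.prob ?P {\<omega>. R i \<omega> \<le> \<theta>})"
    unfolding Rw_def by (intro measure_pmf.finite_measure_subadditive_finite) auto
  also have "\<dots> \<le> (\<Sum>i<n. \<eta>)"
    by (intro sum_mono rows) simp
  finally have "measure_pmf.prob ?P (- G) \<le> 2 * real n * exp (- real k) + real n * \<eta>"
    by simp
  moreover have "measure_pmf.prob ?P (- G) = 1 - measure_pmf.prob ?P G"
    using measure_pmf.prob_compl[of G ?P] by (simp add: Compl_eq_Diff_UNIV)
  ultimately show ?thesis by simp
qed

text \<open>The measurement on an edge after conjugation by the labels. The first component says whether the edge is
present, the second whether the measurement is correct.\<close>

definition edge_signal :: "bool \<times> bool \<Rightarrow> real" where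
  "edge_signal a = (if fst a then (if snd a then 1 else -1) else 0)"

abbreviation sync_edge_pmf :: "real \<Rightarrow> real \<Rightarrow> (bool \<times> bool) pmf" where
  "sync_edge_pmf p \<delta> \<equiv> pair_pmf (bernoulli_pmf p) (bernoulli_pmf ((1 + \<delta>) / 2))"

lemma expectation_bernoulli_pair:
  assumes "0 \<le> p" "p \<le> 1" "0 \<le> q" "q \<le> 1"
  shows "measure_pmf.expectation (pair_pmf (bernoulli_pmf p) (bernoulli_pmf q)) f =
    p * q * f (True, True) + p * (1 - q) * f (True, False) + (1 - p) * q * f (False, True)
    + (1 - p) * (1 - q) * (f (False, False) :: real)"
proof -
  have "measure_pmf.expectation (pair_pmf (bernoulli_pmf p) (bernoulli_pmf q)) f =
      (\<Sum>a\<in>UNIV \<times> UNIV. f a * pmf (pair_pmf (bernoulli_pmf p) (bernoulli_pmf q)) a)"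
    by (intro integral_measure_pmf_real) auto
  also have "\<dots> = (\<Sum>a\<in>UNIV. \<Sum>b\<in>UNIV. f (a, b) * pmf (pair_pmf (bernoulli_pmf p) (bernoulli_pmf q)) (a, b))"
    by (simp add: sum.cartesian_product)
  finally show ?thesis
    using assms by (simp add: UNIV_bool pmf_pair algebra_simps)
qed

text \<open>The two-stage experiment, first a random graph and then random signs on its edges, is the same as drawing both
independently for all pairs: signs of absent edges are drawn as well but not looked at.\<close>

lemma sync_pmf_eq:
  "sync_pmf n p \<delta> z = map_pmf (\<lambda>\<omega>. mat_of_upper n (\<lambda>e. z $ fst e * z $ snd e * edge_signal (\<omega> e)))
    (Pi_pmf (vertex_pairs n) (False, True) (\<lambda>_. sync_edge_pmf p \<delta>))"
proof -
  let ?V = "vertex_pairs n"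
  let ?q = "bernoulli_pmf ((1 + \<delta>) / 2)"
  have V: "finite ?V" by simp
  let ?M = "\<lambda>X T. mat_of_upper n (\<lambda>(i, j). if X (i, j) then (if T (i, j) then z $ i * z $ j else - (z $ i * z $ j)) else 0)"
  have upper: "mat_of_upper n f = mat_of_upper n g" if "\<And>e. e \<in> ?V \<Longrightarrow> f e = g e" for f g
    unfolding mat_of_upper_def using that by (intro eq_matI) (auto simp: vertex_pairs_def)
  have "sync_pmf n p \<delta> z = bind_pmf (Pi_pmf ?V False (\<lambda>_. bernoulli_pmf p)) (\<lambda>X.
      bind_pmf (Pi_pmf {e \<in> ?V. X e} True (\<lambda>_. ?q)) (\<lambda>T. return_pmf (?M (\<lambda>e. e \<in> ?V \<and> X e) T)))"
    by (simp add: sync_pmf_def erdos_renyi_pmf_def bind_map_pmf map_pmf_def[of _ "Pi_pmf _ _ _"] bind_assoc_pmf bind_return_pmf)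
  also have "\<dots> = bind_pmf (Pi_pmf ?V False (\<lambda>_. bernoulli_pmf p)) (\<lambda>X.
      bind_pmf (Pi_pmf ?V True (\<lambda>_. ?q)) (\<lambda>T. return_pmf (?M X T)))"
  proof (rule bind_pmf_cong[OF refl])
    fix X :: "nat \<times> nat \<Rightarrow> bool"
    have sub: "{e \<in> ?V. X e} \<subseteq> ?V" by auto
    have "?M (\<lambda>e. e \<in> ?V \<and> X e) (\<lambda>x. if x \<in> {e \<in> ?V. X e} then T x else True) = ?M X T" for T
      by (rule upper) auto
    then show "bind_pmf (Pi_pmf {e \<in> ?V. X e} True (\<lambda>_. ?q)) (\<lambda>T. return_pmf (?M (\<lambda>e. e \<in> ?V \<and> X e) T)) =
        bind_pmf (Pi_pmf ?V True (\<lambda>_. ?q)) (\<lambda>T. return_pmf (?M X T))"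
      unfolding Pi_pmf_subset[OF V sub] bind_map_pmf by (simp only:)
  qed
  also have "\<dots> = bind_pmf (Pi_pmf ?V False (\<lambda>_. bernoulli_pmf p)) (\<lambda>X.
      bind_pmf (Pi_pmf ?V True (\<lambda>_. ?q)) (\<lambda>T. bind_pmf
        (Pi_pmf ?V (False, True) (\<lambda>e. return_pmf (X e, T e)))
        (\<lambda>\<omega>. return_pmf (mat_of_upper n (\<lambda>e. z $ fst e * z $ snd e * edge_signal (\<omega> e))))))"
    unfolding Pi_pmf_return_pmf[OF V] bind_return_pmf
    by (intro bind_pmf_cong refl arg_cong[of _ _ return_pmf] upper) (auto simp: edge_signal_def)
  also have "\<dots> = bind_pmf (Pi_pmf ?V (False, True) (\<lambda>_. sync_edge_pmf p \<delta>))
        (\<lambda>\<omega>. return_pmf (mat_of_upper n (\<lambda>e. z $ fst e * z $ snd e * edge_signal (\<omega> e))))"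
  proof -
    have "Pi_pmf ?V (False, True) (\<lambda>_. sync_edge_pmf p \<delta>) = bind_pmf (Pi_pmf ?V False (\<lambda>_. bernoulli_pmf p))
        (\<lambda>X. Pi_pmf ?V (False, True) (\<lambda>e. bind_pmf ?q (\<lambda>t. return_pmf (X e, t))))"
      unfolding pair_pmf_def by (rule Pi_pmf_bind[OF V])
    also have "\<dots> = bind_pmf (Pi_pmf ?V False (\<lambda>_. bernoulli_pmf p)) (\<lambda>X. bind_pmf (Pi_pmf ?V True (\<lambda>_. ?q))
        (\<lambda>T. Pi_pmf ?V (False, True) (\<lambda>e. return_pmf (X e, T e))))"
      by (rule bind_pmf_cong[OF refl], rule Pi_pmf_bind[OF V])
    finally show ?thesis
      by (simp only: bind_assoc_pmf)
  qed
  finally show ?thesis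
    by (simp add: map_pmf_def)
qed

text \<open>The minimum over \<open>s\<close> of \<open>cosh s - x * sinh s\<close>, attained where \<open>exp s\<close> is \<open>sqrt ((1 + x) / (1 - x))\<close>.\<close>

lemma optimal_tilt:
  fixes x :: real
  assumes x: "0 \<le> x" "x < 1"
  shows "\<exists>s\<ge>0. (exp s + exp (- s)) / 2 - x * ((exp s - exp (- s)) / 2) = sqrt (1 - x\<^sup>2)"
proof -
  define w where "w = sqrt (1 - x\<^sup>2)"
  have "x\<^sup>2 < 1" using x by (simp add: power_less_one_iff abs_square_less_1)
  then have w0: "0 < w" and w2: "w * w = (1 - x) * (1 + x)"
    by (simp_all add: w_def algebra_simps power2_eq_square)
  define s where "s = ln (w / (1 - x))"
  have e1: "exp s = w / (1 - x)"
    using x w0 by (simp add: s_def)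
  have e2: "exp (- s) = w / (1 + x)"
    unfolding exp_minus e1 using x w0 w2 by (simp add: field_simps)
  have "(1 - x) * (1 - x) \<le> w * w"
    unfolding w2 using x by (intro mult_left_mono) auto
  then have "1 - x \<le> w"
    using w0 x by (meson mult_strict_mono not_le less_imp_le diff_ge_0_iff_ge order.strict_trans1 order_less_imp_le)
  then have "0 \<le> s"
    using x by (simp add: s_def)
  moreover have "(exp s + exp (- s)) / 2 - x * ((exp s - exp (- s)) / 2) = ((1 - x) * exp s + (1 + x) * exp (- s)) / 2"
    by (simp add: field_simps)
  then have "(exp s + exp (- s)) / 2 - x * ((exp s - exp (- s)) / 2) = w"
    unfolding e1 e2 using x by simp
  ultimately show ?thesis
    unfolding w_def by blast
qed

lemma le_sinh:
  fixes s :: real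
  assumes "0 \<le> s"
  shows "s \<le> (exp s - exp (- s)) / 2"
  using real_le_x_sinh[OF assms] by (simp add: exp_minus)

text \<open>The Chernoff exponent per pair is \<open>p\<close> times \<open>(1 - \<beta>) * \<delta> * s + cosh s - \<delta> * sinh s - 1\<close>. Replacing \<open>s\<close> by
\<open>sinh s\<close> in the first term merges it with the third into \<open>- \<beta> * \<delta> * sinh s\<close>, and the minimum becomes explicit.\<close>

lemma sync_row_tail:
  assumes i: "i < n" and p: "0 \<le> p" "p \<le> 1" and \<delta>: "0 < \<delta>" "\<delta> \<le> 1" and \<beta>: "0 \<le> \<beta>" "\<beta> < 1"
  shows "measure_pmf.prob (Pi_pmf (vertex_pairs n) (False, True) (\<lambda>_. sync_edge_pmf p \<delta>))
      {\<omega>. (\<Sum>j\<in>{..<n} - {i}. edge_signal (\<omega> (sorted_pair (i, j)))) \<le> (1 - \<beta>) * ((real n - 1) * p * \<delta>)} \<le>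
    exp (- ((real n - 1) * p * (1 - sqrt (1 - (\<beta> * \<delta>)\<^sup>2))))"
proof -
  have "\<beta> * \<delta> \<le> \<beta> * 1" using \<beta> \<delta> by (intro mult_left_mono) auto
  then have x: "0 \<le> \<beta> * \<delta>" "\<beta> * \<delta> < 1" using \<beta> \<delta> by auto
  obtain s where s: "0 \<le> s"
    and opt: "(exp s + exp (- s)) / 2 - \<beta> * \<delta> * ((exp s - exp (- s)) / 2) = sqrt (1 - (\<beta> * \<delta>)\<^sup>2)"
    using optimal_tilt[OF x] by blast
  define g where "g = (exp s + exp (- s)) / 2 - \<delta> * ((exp s - exp (- s)) / 2) - 1"
  have mgf: "measure_pmf.expectation (sync_edge_pmf p \<delta>) (\<lambda>a. exp (- s * edge_signal a)) \<le> exp (p * g)"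
  proof -
    have "measure_pmf.expectation (sync_edge_pmf p \<delta>) (\<lambda>a. exp (- s * edge_signal a)) = 1 + p * g"
      using p \<delta> by (subst expectation_bernoulli_pair) (auto simp: edge_signal_def g_def field_simps)
    then show ?thesis using exp_ge_add_one_self[of "p * g"] by simp
  qed
  define \<theta> where "\<theta> = (1 - \<beta>) * ((real n - 1) * p * \<delta>)"
  have "measure_pmf.prob (Pi_pmf (vertex_pairs n) (False, True) (\<lambda>_. sync_edge_pmf p \<delta>))
      {\<omega>. (\<Sum>e\<in>incident_pairs n i. edge_signal (\<omega> e)) \<le> \<theta>} \<le>
    exp (s * \<theta>) * (\<Prod>e\<in>incident_pairs n i. measure_pmf.expectation (sync_edge_pmf p \<delta>) (\<lambda>a. exp (- s * edge_signal a)))"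
    by (rule chernoff_lower_tail[OF finite_vertex_pairs incident_pairs_subset[OF i] _ s]) simp
  also have "\<dots> \<le> exp (s * \<theta>) * (\<Prod>e\<in>incident_pairs n i. exp (p * g))"
    by (intro mult_left_mono prod_mono conjI mgf Bochner_Integration.integral_nonneg) auto
  also have "\<dots> = exp (s * \<theta> + (real n - 1) * (p * g))"
    unfolding prod_incident_pairs using i by (simp add: exp_add exp_of_nat_mult[symmetric] of_nat_diff)
  also have "\<dots> \<le> exp (- ((real n - 1) * p * (1 - sqrt (1 - (\<beta> * \<delta>)\<^sup>2))))"
  proof -
    have c: "0 \<le> (real n - 1) * p" using i p by simp
    have "(1 - \<beta>) * \<delta> * s \<le> (1 - \<beta>) * \<delta> * ((exp s - exp (- s)) / 2)"
      using le_sinh[OF s] \<beta> \<delta> by (intro mult_left_mono) auto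
    then have "(1 - \<beta>) * \<delta> * s + g \<le> (1 - \<beta>) * \<delta> * ((exp s - exp (- s)) / 2) + g" by simp
    also have "\<dots> = sqrt (1 - (\<beta> * \<delta>)\<^sup>2) - 1"
    proof -
      define E where "E = (exp s - exp (- s)) / 2"
      show ?thesis
        unfolding opt[symmetric] g_def E_def[symmetric] by (simp add: algebra_simps)
    qed
    finally have "(real n - 1) * p * ((1 - \<beta>) * \<delta> * s + g) \<le> (real n - 1) * p * (sqrt (1 - (\<beta> * \<delta>)\<^sup>2) - 1)"
      using c by (rule mult_left_mono)
    moreover have "s * \<theta> + (real n - 1) * (p * g) = (real n - 1) * p * ((1 - \<beta>) * \<delta> * s + g)"
      unfolding \<theta>_def by (simp add: algebra_simps)
    moreover have "(real n - 1) * p * (sqrt (1 - (\<beta> * \<delta>)\<^sup>2) - 1) = - ((real n - 1) * p * (1 - sqrt (1 - (\<beta> * \<delta>)\<^sup>2)))"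
      by (simp add: algebra_simps)
    ultimately show ?thesis by simp
  qed
  finally show ?thesis
    unfolding sum_incident_pairs \<theta>_def .
qed

text \<open>The gap between \<open>\<beta>\<close> and \<open>(r - 3) / (r - 1)\<close> pays for the norm of the noise; the factor \<open>3\<close> covers
\<open>(r + 3) / (r - 1)\<close>.\<close>

lemma sync_success_probability:
  assumes n: "0 < n" and z: "sign_vec n z" and r: "4 \<le> r" and p: "0 < p" "p \<le> 1" and \<delta>: "0 < \<delta>" "\<delta> \<le> 1"
    and \<beta>: "0 \<le> \<beta>" "\<beta> + \<eta> \<le> (real r - 3) / (real r - 1)" and \<eta>: "0 < \<eta>"
    and k: "0 < k" "real n * p \<le> real k" and noise: "3 * sqrt (noise_const * real k) \<le> \<eta> * (real n * p * \<delta>)"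
  shows "1 - 2 * real n * exp (- real k) - real n * exp (- ((real n - 1) * p * (1 - sqrt (1 - (\<beta> * \<delta>)\<^sup>2)))) \<le>
    measure_pmf.prob (sync_pmf n p \<delta> z) {C. \<forall>\<Delta>p. monotone_perturbation z \<Delta>p \<longrightarrow> property_R (C + \<Delta>p) r z}"
proof -
  let ?V = "vertex_pairs n"
  let ?P = "Pi_pmf ?V (False, True) (\<lambda>_. sync_edge_pmf p \<delta>)"
  let ?C = "\<lambda>\<omega>. mat_of_upper n (\<lambda>e. z $ fst e * z $ snd e * edge_signal (\<omega> e))"
  let ?X = "\<lambda>(_ :: nat \<times> nat) a. edge_signal a - p * \<delta>"
  let ?B = "sqrt (noise_const * real k)"
  have pd: "0 < p * \<delta>" "p * \<delta> \<le> 1"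
    using p \<delta> by (auto intro: mult_le_one)
  have \<kappa>: "(real r - 3) / (real r - 1) < 1" using r by simp
  have zz: "z $ i * z $ i = 1" if "i < n" for i
    using z that unfolding sign_vec_def by auto
  have "1 - 2 * real n * exp (- real k) - real n * exp (- ((real n - 1) * p * (1 - sqrt (1 - (\<beta> * \<delta>)\<^sup>2)))) \<le>
    measure_pmf.prob ?P {\<omega>. \<forall>\<Delta>p. monotone_perturbation z \<Delta>p \<longrightarrow> property_R (?C \<omega> + \<Delta>p) r z}"
  proof (rule success_probability_bound[where X = ?X and p = p and \<theta> = "(1 - \<beta>) * ((real n - 1) * p * \<delta>)"
        and R = "\<lambda>i \<omega>. \<Sum>j\<in>{..<n} - {i}. edge_signal (\<omega> (sorted_pair (i, j)))"])
    show "\<bar>?X e a\<bar> \<le> 2" for e :: "nat \<times> nat" and a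
      using pd by (auto simp: edge_signal_def)
    show "measure_pmf.expectation (sync_edge_pmf p \<delta>) (?X e) = 0" for e :: "nat \<times> nat"
      using p \<delta> by (subst expectation_bernoulli_pair) (auto simp: edge_signal_def field_simps)
    show "measure_pmf.expectation (sync_edge_pmf p \<delta>) (\<lambda>a. (?X e a)\<^sup>2) \<le> p" for e :: "nat \<times> nat"
    proof -
      have "measure_pmf.expectation (sync_edge_pmf p \<delta>) (\<lambda>a. (?X e a)\<^sup>2) = p - (p * \<delta>)\<^sup>2"
        using p \<delta> by (subst expectation_bernoulli_pair) (auto simp: edge_signal_def field_simps power2_eq_square)
      then show ?thesis by simp
    qed
    show "measure_pmf.prob ?P {\<omega>. (\<Sum>j\<in>{..<n} - {i}. edge_signal (\<omega> (sorted_pair (i, j)))) \<le> (1 - \<beta>) * ((real n - 1) * p * \<delta>)}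
        \<le> exp (- ((real n - 1) * p * (1 - sqrt (1 - (\<beta> * \<delta>)\<^sup>2))))" if "i < n" for i
      using that p \<delta> \<beta> \<eta> \<kappa> by (intro sync_row_tail) auto
    fix \<omega>
    assume form: "\<And>f. \<bar>\<Sum>i<n. \<Sum>j<n. edge_kernel (\<lambda>e. ?X e (\<omega> e)) i j * f i * f j\<bar> \<le> ?B * (\<Sum>i<n. (f i)\<^sup>2)"
      and row: "\<And>i. i < n \<Longrightarrow> (1 - \<beta>) * ((real n - 1) * p * \<delta>) < (\<Sum>j\<in>{..<n} - {i}. edge_signal (\<omega> (sorted_pair (i, j))))"
    have "property_R (?C \<omega> + \<Delta>p) r z" if P: "monotone_perturbation z \<Delta>p" for \<Delta>p
    proof (rule property_R_mean_plus_noise[OF sym_mat_of_upper z n r P pd(1), where B = ?B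
          and D = "edge_kernel (\<lambda>e. ?X e (\<omega> e))" and \<rho> = "\<beta> * ((real n - 1) * p * \<delta>)"])
      show "edge_kernel (\<lambda>e. ?X e (\<omega> e)) i j = (if i = j then 0 else z $ i * z $ j * ?C \<omega> $$ (i, j) - p * \<delta>)"
        if "i < n" "j < n" for i j
      proof -
        have "z $ fst (sorted_pair (i, j)) * z $ snd (sorted_pair (i, j)) = z $ i * z $ j"
          by (simp add: sorted_pair_def min_def max_def mult.commute)
        then have "z $ i * z $ j * (z $ fst (sorted_pair (i, j)) * z $ snd (sorted_pair (i, j)) * a) = a" for a
          using zz[OF that(1)] zz[OF that(2)] by (metis (no_types, lifting) mult.assoc mult.commute mult_1)
        then show ?thesis
          using that by (simp add: edge_kernel_def mat_of_upper_index)
      qed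
      show "- (\<beta> * ((real n - 1) * p * \<delta>)) \<le> (\<Sum>j<n. edge_kernel (\<lambda>e. ?X e (\<omega> e)) i j)" if "i < n" for i
      proof -
        have "(\<Sum>j<n. edge_kernel (\<lambda>e. ?X e (\<omega> e)) i j) = (\<Sum>j\<in>{..<n} - {i}. edge_kernel (\<lambda>e. ?X e (\<omega> e)) i j)"
          by (intro sum.mono_neutral_right) (auto simp: edge_kernel_def)
        also have "\<dots> = (\<Sum>j\<in>{..<n} - {i}. edge_signal (\<omega> (sorted_pair (i, j))) - p * \<delta>)"
          by (intro sum.cong refl) (auto simp: edge_kernel_def)
        also have "\<dots> = (\<Sum>j\<in>{..<n} - {i}. edge_signal (\<omega> (sorted_pair (i, j)))) - (real n - 1) * p * \<delta>"
          using that by (simp add: sum_subtractf of_nat_diff)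
        finally show ?thesis
          using row[OF that] by (simp add: algebra_simps)
      qed
      show "(real r - 1) * (\<beta> * ((real n - 1) * p * \<delta>)) + (real r + 3) * ?B \<le> (real r - 3) * (real n * (p * \<delta>))"
      proof -
        have "\<beta> * ((real n - 1) * p * \<delta>) \<le> \<beta> * (real n * p * \<delta>)"
          using \<beta> p \<delta> by (intro mult_left_mono mult_right_mono) auto
        moreover have "(\<beta> + \<eta>) * (real n * p * \<delta>) \<le> (real r - 3) / (real r - 1) * (real n * p * \<delta>)"
          using \<beta> p \<delta> by (intro mult_right_mono) auto
        ultimately have "\<beta> * ((real n - 1) * p * \<delta>) + 3 * ?B \<le> (real r - 3) / (real r - 1) * (real n * p * \<delta>)"
          using noise unfolding distrib_right by linarith
        then have "(real r - 1) * (\<beta> * ((real n - 1) * p * \<delta>) + 3 * ?B) \<le>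
            (real r - 1) * ((real r - 3) / (real r - 1) * (real n * p * \<delta>))"
          using r by (intro mult_left_mono) auto
        also have "\<dots> = (real r - 3) * (real n * (p * \<delta>))"
          using r by (simp add: mult.assoc)
        finally have "(real r - 1) * (\<beta> * ((real n - 1) * p * \<delta>)) + (real r - 1) * (3 * ?B) \<le> (real r - 3) * (real n * (p * \<delta>))"
          unfolding distrib_left .
        moreover have "(real r + 3) * ?B \<le> (real r - 1) * 3 * ?B"
          using r noise_const_pos by (intro mult_right_mono) auto
        ultimately show ?thesis by (simp only: mult.assoc)
      qed
    qed (rule form)
    then show "\<omega> \<in> {\<omega>. \<forall>\<Delta>p. monotone_perturbation z \<Delta>p \<longrightarrow> property_R (?C \<omega> + \<Delta>p) r z}"
      by simp
  qed (use p k in auto)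
  then show ?thesis
    unfolding sync_pmf_eq by (simp add: vimage_def)
qed

section \<open>The stochastic block model\<close>

lemma sbm_pmf_eq:
  "sbm_pmf n p q z = map_pmf (\<lambda>\<omega>. mat_of_upper n (\<lambda>e. of_bool (\<omega> e)))
    (Pi_pmf (vertex_pairs n) False (\<lambda>e. bernoulli_pmf (if z $ fst e = z $ snd e then p else q)))"
  unfolding sbm_pmf_def case_prod_unfold by simp

text \<open>As for synchronization, the bound \<open>2 * s \<le> exp s - exp (- s)\<close> absorbs the threshold into the edge
probabilities, which become \<open>p'\<close> and \<open>q'\<close>. Then \<open>exp s = sqrt (p' / q')\<close> is optimal.\<close>

lemma block_tilt:
  fixes a p q :: real
  assumes a: "0 < a" "a < 1 / 2" and pq: "0 \<le> q" "q < p"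
  defines "p' \<equiv> p - a * (p - q)" and "q' \<equiv> q + a * (p - q)"
  shows "\<exists>s\<ge>0. 2 * a * s * (p - q) - p * (1 - exp (- s)) + q * (exp s - 1) \<le> - (sqrt p' - sqrt q')\<^sup>2"
proof -
  have d: "0 < a * (p - q)" using a pq by simp
  then have q0: "0 < q'" using pq by (simp add: q'_def)
  have "0 < (1 - 2 * a) * (p - q)" using a pq by simp
  then have lt: "q' < p'" by (simp add: p'_def q'_def algebra_simps)
  define u v where "u = sqrt p'" and "v = sqrt q'"
  have uv: "0 < v" "v < u" "u * u = p'" "v * v = q'"
    using q0 lt by (simp_all add: u_def v_def)
  define s where "s = ln (u / v)"
  have e: "exp s = u / v" "exp (- s) = v / u"
    using uv by (simp_all add: s_def exp_minus)
  have s: "0 \<le> s" using uv by (simp add: s_def)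
  have "2 * a * s * (p - q) = a * (p - q) * (2 * s)" by simp
  also have "\<dots> \<le> a * (p - q) * (exp s - exp (- s))"
    using le_sinh[OF s] d by (intro mult_left_mono) auto
  finally have "2 * a * s * (p - q) - p * (1 - exp (- s)) + q * (exp s - 1) \<le>
      a * (p - q) * (exp s - exp (- s)) - p * (1 - exp (- s)) + q * (exp s - 1)" by simp
  also have "\<dots> = p' * exp (- s) + q' * exp s - p' - q'"
    unfolding p'_def q'_def by (simp add: algebra_simps)
  also have "p' * exp (- s) = u * v"
    unfolding e uv(3)[symmetric] using uv(1,2) by simp
  also have "q' * exp s = u * v"
    unfolding e uv(4)[symmetric] using uv(1,2) by simp
  also have "u * v + u * v - p' - q' = - (u - v)\<^sup>2"
    unfolding uv(3,4)[symmetric] by (simp add: power2_eq_square algebra_simps)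
  finally show ?thesis
    using s unfolding u_def v_def by blast
qed

text \<open>The exponent \<open>G\<close> of a pair is written as an affine function of the product of its labels, so that its sum
over a row follows from the balance of the labels. The \<open>1\<close> in the result pays for the missing diagonal pair.\<close>

lemma sbm_row_tail:
  fixes a p q :: real
  assumes i: "i < n" and z: "sign_vec n z" and balanced: "(\<Sum>j<n. z $ j) = 0"
    and a: "0 < a" "a < 1 / 2" and pq: "0 \<le> q" "q < p" "p \<le> 1"
  shows "measure_pmf.prob (Pi_pmf (vertex_pairs n) False (\<lambda>e. bernoulli_pmf (if z $ fst e = z $ snd e then p else q)))
      {\<omega>. (\<Sum>j\<in>{..<n} - {i}. z $ i * z $ j * of_bool (\<omega> (sorted_pair (i, j)))) \<le> a * (real n * (p - q))} \<le>
    exp (1 - real n / 2 * (sqrt (p - a * (p - q)) - sqrt (q + a * (p - q)))\<^sup>2)"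
proof -
  let ?P = "\<lambda>e. bernoulli_pmf (if z $ fst e = z $ snd e then p else q)"
  let ?\<sigma> = "\<lambda>e. z $ fst e * z $ snd e"
  let ?Y = "\<lambda>e b. ?\<sigma> e * of_bool b"
  let ?\<theta> = "a * (real n * (p - q))"
  define R where "R = (sqrt (p - a * (p - q)) - sqrt (q + a * (p - q)))\<^sup>2"
  obtain s where s: "0 \<le> s"
    and opt: "2 * a * s * (p - q) - p * (1 - exp (- s)) + q * (exp s - 1) \<le> - R"
    using block_tilt[OF a pq(1,2)] unfolding R_def by blast
  define \<alpha> where "\<alpha> = - (p * (1 - exp (- s)))"
  define \<gamma> where "\<gamma> = q * (exp s - 1)"
  define G where "G = (\<lambda>t. (\<alpha> + \<gamma>) / 2 + t * ((\<alpha> - \<gamma>) / 2))"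
  have zi: "z $ j = 1 \<or> z $ j = -1" if "j < n" for j
    using z that by (auto simp: sign_vec_def)
  have prod\<sigma>: "?\<sigma> (sorted_pair (i, j)) = z $ i * z $ j" for j
    by (simp add: sorted_pair_def min_def max_def mult.commute)
  have mgf: "measure_pmf.expectation (?P e) (\<lambda>b. exp (- s * ?Y e b)) \<le> exp (G (?\<sigma> e))" if e: "e \<in> vertex_pairs n" for e
  proof -
    have e': "fst e < n" "snd e < n" using e by (auto simp: vertex_pairs_def)
    consider "z $ fst e = z $ snd e" "?\<sigma> e = 1" | "z $ fst e \<noteq> z $ snd e" "?\<sigma> e = -1"
      using zi[OF e'(1)] zi[OF e'(2)] by force
    then show ?thesis
    proof cases
      case 1
      have "measure_pmf.expectation (?P e) (\<lambda>b. exp (- s * ?Y e b)) = 1 + \<alpha>"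
        using 1 pq by (simp add: \<alpha>_def algebra_simps)
      also have "\<dots> \<le> exp \<alpha>" by (rule exp_ge_add_one_self)
      also have "\<alpha> = G (?\<sigma> e)" using 1 by (simp add: G_def field_simps)
      finally show ?thesis .
    next
      case 2
      have "measure_pmf.expectation (?P e) (\<lambda>b. exp (- s * ?Y e b)) = 1 + \<gamma>"
        using 2 pq by (simp add: \<gamma>_def algebra_simps)
      also have "\<dots> \<le> exp \<gamma>" by (rule exp_ge_add_one_self)
      also have "\<gamma> = G (?\<sigma> e)" using 2 by (simp add: G_def field_simps)
      finally show ?thesis .
    qed
  qed
  have sumG: "(\<Sum>e\<in>incident_pairs n i. G (?\<sigma> e)) = real n * ((\<alpha> + \<gamma>) / 2) - \<alpha>"
  proof -
    have "(\<Sum>j\<in>{..<n} - {i}. z $ j) = - (z $ i)"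
      using balanced i by (simp add: sum_diff1)
    then have zs: "z $ i * (\<Sum>j\<in>{..<n} - {i}. z $ j) = - 1"
      using zi[OF i] by auto
    have "(\<Sum>e\<in>incident_pairs n i. G (?\<sigma> e)) = (\<Sum>j\<in>{..<n} - {i}. (\<alpha> + \<gamma>) / 2 + (\<alpha> - \<gamma>) / 2 * (z $ i * z $ j))"
      unfolding sum_incident_pairs prod\<sigma> by (simp add: G_def mult.commute)
    also have "\<dots> = (real n - 1) * ((\<alpha> + \<gamma>) / 2) + (\<alpha> - \<gamma>) / 2 * (z $ i * (\<Sum>j\<in>{..<n} - {i}. z $ j))"
      using i by (simp add: sum.distrib sum_distrib_left of_nat_diff)
    finally show ?thesis
      unfolding zs by (simp add: field_simps)
  qed
  have "measure_pmf.prob (Pi_pmf (vertex_pairs n) False ?P) {\<omega>. (\<Sum>e\<in>incident_pairs n i. ?Y e (\<omega> e)) \<le> ?\<theta>} \<le>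
    exp (s * ?\<theta>) * (\<Prod>e\<in>incident_pairs n i. measure_pmf.expectation (?P e) (\<lambda>b. exp (- s * ?Y e b)))"
    by (rule chernoff_lower_tail[OF finite_vertex_pairs incident_pairs_subset[OF i] _ s]) simp
  also have "\<dots> \<le> exp (s * ?\<theta>) * (\<Prod>e\<in>incident_pairs n i. exp (G (?\<sigma> e)))"
    using incident_pairs_subset[OF i]
    by (intro mult_left_mono prod_mono conjI mgf Bochner_Integration.integral_nonneg) auto
  also have "\<dots> = exp (s * ?\<theta> + real n * ((\<alpha> + \<gamma>) / 2) - \<alpha>)"
    using finite_subset[OF incident_pairs_subset[OF i] finite_vertex_pairs]
    by (simp add: exp_sum[symmetric] sumG exp_add[symmetric] add_diff_eq)
  also have "\<dots> \<le> exp (1 - real n / 2 * R)"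
  proof -
    have "real n / 2 * (2 * a * s * (p - q) + \<alpha> + \<gamma>) \<le> real n / 2 * (- R)"
      using opt unfolding \<alpha>_def \<gamma>_def by (intro mult_left_mono) auto
    moreover have "- \<alpha> \<le> 1"
      unfolding \<alpha>_def using pq s mult_mono[of p 1 "1 - exp (- s)" 1] by simp
    moreover have "s * ?\<theta> + real n * ((\<alpha> + \<gamma>) / 2) - \<alpha> = real n / 2 * (2 * a * s * (p - q) + \<alpha> + \<gamma>) - \<alpha>"
      by (simp add: field_simps)
    ultimately show ?thesis by simp
  qed
  finally show ?thesis
    unfolding sum_incident_pairs prod\<sigma> R_def .
qed

text \<open>The gap \<open>\<eta>\<close> pays for the norm of the noise; the factor \<open>15\<close> is the largest value of \<open>(r + 11) / (r - 3)\<close>,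
at \<open>r = 4\<close>.\<close>

lemma sbm_success_probability:
  fixes a p q \<eta> :: real
  assumes n: "0 < n" and z: "sign_vec n z" and balanced: "z \<bullet> ones_vec n = 0" and r: "4 \<le> r"
    and pq: "0 \<le> q" "q < p" "p \<le> 1" and a: "1 / (real r - 1) + \<eta> \<le> a" "a < 1 / 2" and \<eta>: "0 < \<eta>"
    and k: "0 < k" "real n * p \<le> real k" and noise: "15 * sqrt (noise_const * real k) \<le> \<eta> * (real n * (p - q))"
  shows "1 - 2 * real n * exp (- real k)
      - real n * exp (1 - real n / 2 * (sqrt (p - a * (p - q)) - sqrt (q + a * (p - q)))\<^sup>2) \<le>
    measure_pmf.prob (sbm_pmf n p q z) {A. \<forall>\<Delta>p. monotone_perturbation z \<Delta>p \<longrightarrow>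
      property_R (A - ((p + q) / 2) \<cdot>\<^sub>m outer (ones_vec n) (ones_vec n) + \<Delta>p) r z}"
proof -
  let ?m = "\<lambda>e. if z $ fst e = z $ snd e then p else q"
  let ?P = "Pi_pmf (vertex_pairs n) False (\<lambda>e. bernoulli_pmf (?m e))"
  let ?A = "\<lambda>\<omega>. mat_of_upper n (\<lambda>e. of_bool (\<omega> e))"
  let ?X = "\<lambda>e b. of_bool b - ?m e"
  let ?B = "sqrt (noise_const * real k)"
  have sum0: "(\<Sum>j<n. z $ j) = 0"
    using balanced by (simp add: scalar_prod_def ones_vec_def atLeast0LessThan)
  have zi: "z $ j = 1 \<or> z $ j = -1" if "j < n" for j
    using z that by (auto simp: sign_vec_def)
  have a0: "0 < a"
  proof -
    have "0 < 1 / (real r - 1)" using r by simp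
    then show ?thesis using a \<eta> by linarith
  qed
  have m: "0 \<le> ?m e" "?m e \<le> 1" "?m e \<le> p" for e
    using pq by auto
  have "1 - 2 * real n * exp (- real k)
      - real n * exp (1 - real n / 2 * (sqrt (p - a * (p - q)) - sqrt (q + a * (p - q)))\<^sup>2) \<le>
    measure_pmf.prob ?P {\<omega>. \<forall>\<Delta>p. monotone_perturbation z \<Delta>p \<longrightarrow>
      property_R (?A \<omega> - ((p + q) / 2) \<cdot>\<^sub>m outer (ones_vec n) (ones_vec n) + \<Delta>p) r z}"
  proof (rule success_probability_bound[where X = ?X and p = p and \<theta> = "a * (real n * (p - q))"
        and R = "\<lambda>i \<omega>. \<Sum>j\<in>{..<n} - {i}. z $ i * z $ j * of_bool (\<omega> (sorted_pair (i, j)))"])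
    show "\<bar>?X e b\<bar> \<le> 2" for e b
      using m[of e] by (auto simp: of_bool_def)
    show "measure_pmf.expectation (bernoulli_pmf (?m e)) (?X e) = 0" for e
      using m[of e] by (simp add: algebra_simps)
    show "measure_pmf.expectation (bernoulli_pmf (?m e)) (\<lambda>b. (?X e b)\<^sup>2) \<le> p" for e
    proof -
      define t where "t = ?m e"
      have t: "0 \<le> t" "t \<le> 1" "t \<le> p" using m[of e] by (simp_all add: t_def)
      have "measure_pmf.expectation (bernoulli_pmf t) (\<lambda>b. (of_bool b - t)\<^sup>2) = t - t\<^sup>2"
        using t by (simp add: power2_eq_square algebra_simps)
      also have "\<dots> \<le> p" using t zero_le_power2[of t] by linarith
      finally show ?thesis unfolding t_def .
    qed
    show "measure_pmf.prob ?P {\<omega>. (\<Sum>j\<in>{..<n} - {i}. z $ i * z $ j * of_bool (\<omega> (sorted_pair (i, j)))) \<le> a * (real n * (p - q))}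
        \<le> exp (1 - real n / 2 * (sqrt (p - a * (p - q)) - sqrt (q + a * (p - q)))\<^sup>2)" if "i < n" for i
      by (rule sbm_row_tail[OF that z sum0 a0 a(2) pq])
    fix \<omega>
    assume form: "\<And>f. \<bar>\<Sum>i<n. \<Sum>j<n. edge_kernel (\<lambda>e. ?X e (\<omega> e)) i j * f i * f j\<bar> \<le> ?B * (\<Sum>i<n. (f i)\<^sup>2)"
      and row: "\<And>i. i < n \<Longrightarrow> a * (real n * (p - q)) < (\<Sum>j\<in>{..<n} - {i}. z $ i * z $ j * of_bool (\<omega> (sorted_pair (i, j))))"
    define E where "E = (\<lambda>i j. if i = j then 0 else ?m (sorted_pair (i, j)))"
    have "property_R (?A \<omega> - ((p + q) / 2) \<cdot>\<^sub>m outer (ones_vec n) (ones_vec n) + \<Delta>p) r z"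
      if P: "monotone_perturbation z \<Delta>p" for \<Delta>p
    proof (rule property_R_block_model[OF n z balanced pq(1,2) sym_mat_of_upper _ r, where E = E and B = ?B])
      show "?A \<omega> $$ (i, i) = 0" if "i < n" for i
        using that by (simp add: mat_of_upper_index)
      show "E i j = (if i = j then 0 else (p - q) / 2 * (z $ i * z $ j) + (p + q) / 2)" if "i < n" "j < n" for i j
        using zi[OF that(1)] zi[OF that(2)]
        by (auto simp: E_def sorted_pair_def min_def max_def field_simps)
      show "0 \<le> ?B" using noise_const_pos by simp
      show "\<bar>\<Sum>i<n. \<Sum>j<n. (?A \<omega> $$ (i, j) - E i j) * f i * f j\<bar> \<le> ?B * (\<Sum>i<n. (f i)\<^sup>2)" for f
      proof -
        have "(\<Sum>i<n. \<Sum>j<n. (?A \<omega> $$ (i, j) - E i j) * f i * f j) =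
            (\<Sum>i<n. \<Sum>j<n. edge_kernel (\<lambda>e. ?X e (\<omega> e)) i j * f i * f j)"
          by (intro sum.cong refl) (auto simp: mat_of_upper_index E_def edge_kernel_def)
        then show ?thesis using form[of f] by simp
      qed
      show "(real r + 11) / (real r - 3) * ?B + real n * (p - q) / (real r - 1) \<le>
          z $ i * (\<Sum>j\<in>{..<n} - {i}. ?A \<omega> $$ (i, j) * z $ j)" if "i < n" for i
      proof -
        have "(real r + 11) / (real r - 3) \<le> 15" using r by (simp add: field_simps)
        then have "(real r + 11) / (real r - 3) * ?B \<le> 15 * ?B"
          using noise_const_pos by (intro mult_right_mono) auto
        also have "\<dots> \<le> \<eta> * (real n * (p - q))" by (rule noise)
        finally have "(real r + 11) / (real r - 3) * ?B + real n * (p - q) / (real r - 1) \<le>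
            real n * (p - q) / (real r - 1) + \<eta> * (real n * (p - q))"
          by simp
        also have "\<dots> = (1 / (real r - 1) + \<eta>) * (real n * (p - q))"
          by (simp add: distrib_right)
        also have "\<dots> \<le> a * (real n * (p - q))"
          using a pq by (intro mult_right_mono) auto
        also have "\<dots> \<le> (\<Sum>j\<in>{..<n} - {i}. z $ i * z $ j * of_bool (\<omega> (sorted_pair (i, j))))"
          using row[OF that] by simp
        also have "\<dots> = z $ i * (\<Sum>j\<in>{..<n} - {i}. ?A \<omega> $$ (i, j) * z $ j)"
          unfolding sum_distrib_left using that by (intro sum.cong refl) (auto simp: mat_of_upper_index)
        finally show ?thesis .
      qed
    qed (rule P)
    then show "\<omega> \<in> {\<omega>. \<forall>\<Delta>p. monotone_perturbation z \<Delta>p \<longrightarrow>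
      property_R (?A \<omega> - ((p + q) / 2) \<cdot>\<^sub>m outer (ones_vec n) (ones_vec n) + \<Delta>p) r z}"
      by simp
  qed (use pq k in auto)
  then show ?thesis
    unfolding sbm_pmf_eq by (simp add: vimage_def)
qed

lemma property_R_sbm:
  assumes n: "0 < n" and z: "sign_vec n z" and balanced: "z \<bullet> ones_vec n = 0"
    and pq: "0 \<le> q" "q < p" "p \<le> 1" and A: "A \<in> set_pmf (sbm_pmf n p q z)" and r: "4 \<le> r"
    and min: "Min ((\<lambda>i. z $ i * (\<Sum>j\<in>{..<n} - {i}. A $$ (i, j) * z $ j)) ` {..<n})
         \<ge> (real r + 11) / (real r - 3) * op_norm (A - mean_mat n (sbm_pmf n p q z))
            + real n * (p - q) / (real r - 1)"
    and P: "monotone_perturbation z \<Delta>p"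
  shows "property_R (A - ((p + q) / 2) \<cdot>\<^sub>m outer (ones_vec n) (ones_vec n) + \<Delta>p) r z"
proof -
  let ?M = "mean_mat n (sbm_pmf n p q z)"
  obtain f where A': "A = mat_of_upper n f"
    using A by (auto simp: sbm_pmf_def)
  have dz: "dim_vec z = n" using z by (auto simp: sign_vec_def)
  have zi: "z $ i = 1 \<or> z $ i = -1" if "i < n" for i
    using z that unfolding sign_vec_def by auto
  have M: "?M $$ (i, j) = (if i = j then 0 else (p - q) / 2 * (z $ i * z $ j) + (p + q) / 2)"
    if "i < n" "j < n" for i j
    using that pq zi[OF that(1)] dz
    by (subst sbm_mean[OF z]) (auto simp: outer_def ones_vec_def field_simps)
  have Ac: "A \<in> carrier_mat n n" "?M \<in> carrier_mat n n"
    unfolding A' by (auto simp: mat_of_upper_def mean_mat_def)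
  then have Dc: "A - ?M \<in> carrier_mat n n" by (simp add: minus_carrier_mat)
  show ?thesis
  proof (rule property_R_block_model[OF n z balanced pq(1,2) _ _ r, where E = "\<lambda>i j. ?M $$ (i, j)" and B = "op_norm (A - ?M)"])
    show "sym_mat n A" unfolding A' by (rule sym_mat_of_upper)
    show "A $$ (i, i) = 0" if "i < n" for i
      unfolding A' using that by (simp add: mat_of_upper_index)
    show "0 \<le> op_norm (A - ?M)"
      by (rule abs_quadratic_form_le_op_norm(2)[OF Dc])
    show "\<bar>\<Sum>i<n. \<Sum>j<n. (A $$ (i, j) - ?M $$ (i, j)) * f i * f j\<bar> \<le> op_norm (A - ?M) * (\<Sum>i<n. (f i)\<^sup>2)" for f
      using abs_quadratic_form_le_op_norm(1)[OF Dc, of f] Ac by simp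
    show "(real r + 11) / (real r - 3) * op_norm (A - ?M) + real n * (p - q) / (real r - 1) \<le>
        z $ i * (\<Sum>j\<in>{..<n} - {i}. A $$ (i, j) * z $ j)" if "i < n" for i
      by (rule order.trans[OF min]) (use that in \<open>auto intro: Min_le\<close>)
  qed (rule M P | assumption)+
qed

section \<open>Asymptotics\<close>

lemma one_minus_sqrt_bounds:
  fixes x :: real
  assumes "0 \<le> x" "x \<le> 1"
  shows "0 \<le> 1 - sqrt (1 - x\<^sup>2)" "1 - sqrt (1 - x\<^sup>2) \<le> x\<^sup>2" "x\<^sup>2 / 2 \<le> 1 - sqrt (1 - x\<^sup>2)"
    "1 - sqrt (1 - x\<^sup>2) \<le> 1"
proof -
  define w where "w = sqrt (1 - x\<^sup>2)"
  have x2: "x\<^sup>2 \<le> 1" using assms by (simp add: power_le_one)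
  have w: "0 \<le> w" "w \<le> 1" "w * w = 1 - x\<^sup>2"
    using x2 by (simp_all add: w_def)
  have "w * w \<le> w * 1" using w by (intro mult_left_mono) auto
  then show "1 - sqrt (1 - x\<^sup>2) \<le> x\<^sup>2"
    using w by (simp add: w_def[symmetric])
  show "0 \<le> 1 - sqrt (1 - x\<^sup>2)" "1 - sqrt (1 - x\<^sup>2) \<le> 1"
    using w by (simp_all add: w_def[symmetric])
  have "0 \<le> (1 - w)\<^sup>2" by simp
  then show "x\<^sup>2 / 2 \<le> 1 - sqrt (1 - x\<^sup>2)"
    using w unfolding w_def[symmetric] by (simp add: power2_eq_square algebra_simps)
qed

text \<open>The ratio of \<open>1 - sqrt (1 - u^2)\<close> to \<open>u^2\<close> increases with \<open>u\<close>. So a fixed relative increase of \<open>u\<close> raises the rate by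
a fixed factor, which turns a union bound that just fails into one that succeeds.\<close>

lemma one_minus_sqrt_scale:
  fixes u v l :: real
  assumes u: "0 \<le> u" and l: "1 \<le> l" "l * u \<le> v" and v: "v \<le> 1"
  shows "l\<^sup>2 * (1 - sqrt (1 - u\<^sup>2)) \<le> 1 - sqrt (1 - v\<^sup>2)"
proof -
  define a where "a = sqrt (1 - u\<^sup>2)"
  define b where "b = sqrt (1 - v\<^sup>2)"
  have "u * 1 \<le> u * l" using u l by (intro mult_left_mono) auto
  then have uv: "u \<le> v" using l by (simp add: mult.commute)
  have v0: "0 \<le> v" using u uv by linarith
  have sq: "u\<^sup>2 \<le> v\<^sup>2" "v\<^sup>2 \<le> 1"
    using u uv v v0 by (auto intro: power_mono simp: power_le_one)
  have ab: "0 \<le> b" "b \<le> a" "a * a = 1 - u\<^sup>2" "b * b = 1 - v\<^sup>2"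
    using sq by (simp_all add: a_def b_def)
  have "(l * u)\<^sup>2 \<le> v\<^sup>2"
    using l u by (intro power_mono) auto
  then have "l\<^sup>2 * ((1 - a) * (1 + a)) \<le> (1 - b) * (1 + b)"
  proof -
    have "(1 - a) * (1 + a) = u\<^sup>2" "(1 - b) * (1 + b) = v\<^sup>2"
      using ab(3,4) by (simp_all add: algebra_simps)
    with \<open>(l * u)\<^sup>2 \<le> v\<^sup>2\<close> show ?thesis by (simp only: power_mult_distrib)
  qed
  also have "\<dots> \<le> (1 - b) * (1 + a)"
  proof -
    have "b * b \<le> 1" using ab(4) zero_le_power2[of v] by linarith
    then have "b \<le> 1" using ab(1) by (metis abs_square_le_1 abs_of_nonneg power2_eq_square)
    then show ?thesis using ab by (intro mult_left_mono) auto
  qed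
  finally have "(l\<^sup>2 * (1 - a)) * (1 + a) \<le> (1 - b) * (1 + a)" by (simp add: mult.assoc)
  then have "l\<^sup>2 * (1 - a) \<le> 1 - b"
    by (rule mult_right_le_imp_le) (use ab in linarith)
  then show ?thesis by (simp add: a_def b_def)
qed

lemma failure_rate_tendsto:
  fixes c :: real
  assumes "0 < c"
  shows "(\<lambda>n. 1 - 2 / real n - exp 1 * exp (- c * ln (real n))) \<longlonglongrightarrow> 1"
proof -
  have "filterlim (\<lambda>n. - c * ln (real n)) at_bot sequentially"
    using assms by (intro filterlim_tendsto_neg_mult_at_bot[OF tendsto_const]
      filterlim_compose[OF ln_at_top filterlim_real_sequentially]) auto
  then have "(\<lambda>n. exp (- c * ln (real n))) \<longlonglongrightarrow> 0"
    by (rule filterlim_compose[OF exp_at_bot])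
  then have "(\<lambda>n. 1 - 2 / real n - exp 1 * exp (- c * ln (real n))) \<longlonglongrightarrow> 1 - 0 - exp 1 * 0"
    by (intro tendsto_intros lim_const_over_n)
  then show ?thesis by simp
qed

lemma exp_ceiling_bound:
  assumes n: "0 < n" and k: "2 * ln (real n) \<le> real k"
  shows "2 * real n * exp (- real k) \<le> 2 / real n"
proof -
  have "exp (- real k) \<le> exp (- (2 * ln (real n)))" using k by simp
  also have "\<dots> = 1 / (real n * real n)"
  proof -
    have "exp (2 * ln (real n)) = real n * real n"
      using n by (simp only: mult_2 exp_add exp_ln of_nat_0_less_iff)
    then show ?thesis by (simp only: exp_minus inverse_eq_divide)
  qed
  finally have "2 * real n * exp (- real k) \<le> 2 * real n * (1 / (real n * real n))"
    by (intro mult_left_mono) auto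
  then show ?thesis using n by simp
qed

lemma eventually_ln_ge: "eventually (\<lambda>n. K \<le> ln (real n)) sequentially"
  using filterlim_compose[OF ln_at_top filterlim_real_sequentially]
  by (simp add: filterlim_at_top)

text \<open>The rate condition gives \<open>n * p * \<delta>^2 \<ge> ln n\<close>, hence \<open>n * p \<ge> ln n\<close>, so that \<open>k\<close> is at most \<open>4 * n * p\<close> and the
norm of the noise, of order \<open>sqrt (n * p)\<close>, is negligible against the signal \<open>n * p * \<delta>\<close>.\<close>

lemma sync_limit:
  fixes \<beta> p \<delta> :: "nat \<Rightarrow> real" and c \<eta> :: real
  assumes hyp: "\<And>n. sign_vec n (z n) \<and> 0 \<le> p n \<and> p n \<le> 1 \<and> 0 < \<delta> n \<and> \<delta> n \<le> 1 \<and> 4 \<le> r n"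
    and \<eta>: "0 < \<eta>" and c: "0 < c"
    and \<beta>: "\<And>n. 0 \<le> \<beta> n" "\<And>n. \<beta> n + \<eta> \<le> (real (r n) - 3) / (real (r n) - 1)"
    and ev: "\<forall>\<^sub>F n in sequentially.
      (1 + c) * ln (real n) \<le> real n * p n * (1 - sqrt (1 - (\<beta> n * \<delta> n)\<^sup>2))"
  shows "(\<lambda>n. measure_pmf.prob (sync_pmf n (p n) (\<delta> n) (z n))
              {C. \<forall>\<Delta>p. monotone_perturbation (z n) \<Delta>p \<longrightarrow> property_R (C + \<Delta>p) (r n) (z n)})
            \<longlonglongrightarrow> 1" (is "?f \<longlonglongrightarrow> 1")
proof (rule tendsto_sandwich[OF _ _ failure_rate_tendsto[OF c] tendsto_const])
  show "\<forall>\<^sub>F n in sequentially. ?f n \<le> 1" by simp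
  have "\<forall>\<^sub>F n in sequentially. 0 < n" by (rule eventually_gt_at_top)
  with ev eventually_ln_ge[of 1] eventually_ln_ge[of "36 * noise_const / \<eta>\<^sup>2"]
  show "\<forall>\<^sub>F n in sequentially. 1 - 2 / real n - exp 1 * exp (- c * ln (real n)) \<le> ?f n"
  proof eventually_elim
    case (elim n)
    define L where "L = ln (real n)"
    define x where "x = \<beta> n * \<delta> n"
    define h where "h = 1 - sqrt (1 - x\<^sup>2)"
    define m where "m = real n * p n"
    have H: "sign_vec n (z n)" "0 \<le> p n" "p n \<le> 1" "0 < \<delta> n" "\<delta> n \<le> 1" "4 \<le> r n"
      using hyp[of n] by auto
    have L1: "1 \<le> L" and n: "0 < n" and cond: "(1 + c) * L \<le> m * h"
      and L2: "36 * noise_const / \<eta>\<^sup>2 \<le> L"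
      using elim by (simp_all add: L_def m_def h_def x_def)
    have "(real (r n) - 3) / (real (r n) - 1) < 1" using H by simp
    then have "\<beta> n \<le> 1" using \<beta>(2)[of n] \<eta> by linarith
    then have xd: "x \<le> \<delta> n"
      using H mult_right_mono[of "\<beta> n" 1 "\<delta> n"] by (simp add: x_def)
    have "0 \<le> x" using H \<beta>(1)[of n] by (simp add: x_def)
    then have x: "0 \<le> x" "x \<le> \<delta> n" "x \<le> 1"
      using xd H(5) by linarith+
    have h: "0 \<le> h" "h \<le> x\<^sup>2" "h \<le> 1"
      using one_minus_sqrt_bounds[OF x(1,3)] by (simp_all add: h_def)
    have "x\<^sup>2 \<le> (\<delta> n)\<^sup>2" using x by (intro power_mono) auto
    then have hd: "h \<le> (\<delta> n)\<^sup>2" using h by linarith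
    have m0: "0 \<le> m" using H by (simp add: m_def)
    have "1 * L \<le> (1 + c) * L" using c L1 by (intro mult_right_mono) auto
    then have Lmh: "L \<le> m * h" using cond by linarith
    have "m * h \<le> m * (\<delta> n)\<^sup>2" using hd m0 by (rule mult_left_mono)
    then have Lmd: "L \<le> m * (\<delta> n)\<^sup>2" using Lmh by linarith
    have "m * h \<le> m * 1" using h m0 by (intro mult_left_mono) auto
    then have Lm: "L \<le> m" using Lmh by linarith
    have p0: "0 < p n"
    proof (rule ccontr)
      assume "\<not> 0 < p n"
      then have "m = 0" using H by (simp add: m_def)
      then show False using Lm L1 by linarith
    qed
    define k where "k = nat \<lceil>m + 2 * L\<rceil>"
    have "0 \<le> m + 2 * L" using m0 L1 by linarith
    then have k: "m + 2 * L \<le> real k" "real k \<le> m + 2 * L + 1"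
      unfolding k_def by linarith+
    have "0 < real k" using k(1) m0 L1 by linarith
    then have k0: "0 < k" "real n * p n \<le> real k"
      using k(1) L1 unfolding m_def by linarith+
    have k4: "real k \<le> 4 * m" using k(2) Lm L1 by linarith
    have noise: "3 * sqrt (noise_const * real k) \<le> \<eta> * (real n * p n * \<delta> n)"
    proof (rule power2_le_imp_le)
      have "36 * noise_const \<le> \<eta>\<^sup>2 * L" using L2 \<eta> by (simp add: field_simps)
      also have "\<dots> \<le> \<eta>\<^sup>2 * (m * (\<delta> n)\<^sup>2)" using Lmd by (intro mult_left_mono) auto
      finally have "m * (36 * noise_const) \<le> m * (\<eta>\<^sup>2 * (m * (\<delta> n)\<^sup>2))"
        using m0 by (rule mult_left_mono)
      moreover have "9 * noise_const * real k \<le> 9 * noise_const * (4 * m)"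
        using k4 noise_const_pos by (intro mult_left_mono) auto
      ultimately have "9 * noise_const * real k \<le> (\<eta> * (m * \<delta> n))\<^sup>2"
        by (simp add: power2_eq_square algebra_simps)
      then show "(3 * sqrt (noise_const * real k))\<^sup>2 \<le> (\<eta> * (real n * p n * \<delta> n))\<^sup>2"
        using noise_const_pos by (simp add: power_mult_distrib m_def)
      show "0 \<le> \<eta> * (real n * p n * \<delta> n)" using \<eta> H by simp
    qed
    have succ: "1 - 2 * real n * exp (- real k) - real n * exp (- ((real n - 1) * p n * h)) \<le> ?f n"
      unfolding h_def x_def
      by (rule sync_success_probability[where \<eta> = \<eta>])
        (use n H p0 \<beta> \<eta> k0 noise in auto)
    have "2 * real n * exp (- real k) \<le> 2 / real n"
      using n k(1) m0 by (intro exp_ceiling_bound) (auto simp: L_def)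
    moreover have "real n * exp (- ((real n - 1) * p n * h)) \<le> exp 1 * exp (- c * ln (real n))"
    proof -
      have "p n * h \<le> 1" using H h by (intro mult_le_one) auto
      then have "- ((real n - 1) * p n * h) \<le> 1 - (1 + c) * L"
        using cond by (simp add: m_def algebra_simps)
      then have "real n * exp (- ((real n - 1) * p n * h)) \<le> real n * exp (1 - (1 + c) * L)"
        by (intro mult_left_mono) auto
      also have "\<dots> = exp L * exp (1 - (1 + c) * L)"
        using n by (simp add: L_def)
      also have "\<dots> = exp 1 * exp (- c * ln (real n))"
        unfolding exp_add[symmetric] by (simp add: L_def algebra_simps)
      finally show ?thesis .
    qed
    ultimately show ?case using succ by linarith
  qed
qed

text \<open>Both hypotheses have some room, half of which is given to \<open>\<beta>\<close>: under the first \<open>\<beta>\<close> is larger than in the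
hypothesis by \<open>\<epsilon> / 2\<close>, under the second \<open>1 - sqrt (1 - x^2) \<ge> x^2 / 2\<close> reduces the rate to a quadratic expression.\<close>

lemma sync_whp:
  fixes p \<delta> :: "nat \<Rightarrow> real"
  assumes hyp: "\<And>n. sign_vec n (z n) \<and> 0 \<le> p n \<and> p n \<le> 1 \<and> 0 < \<delta> n \<and> \<delta> n \<le> 1 \<and> 4 \<le> r n"
    and cond: "((\<exists>\<epsilon>::real. 0 < \<epsilon> \<and> \<epsilon> \<le> 1 / 3 \<and>
          (\<forall>\<^sub>F n in sequentially.
             real n * p n / ln (real n) *
               (1 - sqrt (1 - ((real (r n) - 3) / (real (r n) - 1) - \<epsilon>)\<^sup>2 * (\<delta> n)\<^sup>2)) \<ge> 1)) \<or>
        (\<exists>\<epsilon>::real. 0 < \<epsilon> \<and>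
          (\<forall>\<^sub>F n in sequentially.
             1 / \<delta> n \<le> (real (r n) - 3) / (real (r n) - 1) *
               sqrt (real n * p n / ((2 + \<epsilon>) * ln (real n))))))"
  shows "(\<lambda>n. measure_pmf.prob (sync_pmf n (p n) (\<delta> n) (z n))
              {C. \<forall>\<Delta>p. monotone_perturbation (z n) \<Delta>p \<longrightarrow> property_R (C + \<Delta>p) (r n) (z n)})
            \<longlonglongrightarrow> 1"
proof -
  define \<kappa> where "\<kappa> = (\<lambda>n. (real (r n) - 3) / (real (r n) - 1))"
  have \<kappa>: "1 / 3 \<le> \<kappa> n" "\<kappa> n < 1" for n
    using hyp[of n] by (auto simp: \<kappa>_def field_simps)
  have \<kappa>n: "(real (r n) - 3) / (real (r n) - 1) = \<kappa> n" for n
    by (simp add: \<kappa>_def)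
  have \<delta>: "0 < \<delta> n" "\<delta> n \<le> 1" and p: "0 \<le> p n" for n using hyp[of n] by auto
  from cond show ?thesis
  proof (elim disjE exE conjE)
    fix \<epsilon> :: real
    assume \<epsilon>: "0 < \<epsilon>" "\<epsilon> \<le> 1 / 3"
      and ev: "\<forall>\<^sub>F n in sequentially. real n * p n / ln (real n) *
               (1 - sqrt (1 - ((real (r n) - 3) / (real (r n) - 1) - \<epsilon>)\<^sup>2 * (\<delta> n)\<^sup>2)) \<ge> 1"
    show ?thesis
    proof (rule sync_limit[OF hyp, where \<beta> = "\<lambda>n. \<kappa> n - \<epsilon> / 2" and \<eta> = "\<epsilon> / 2" and c = \<epsilon>])
      show "0 \<le> \<kappa> n - \<epsilon> / 2" for n using \<kappa>[of n] \<epsilon> by linarith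
      show "\<kappa> n - \<epsilon> / 2 + \<epsilon> / 2 \<le> (real (r n) - 3) / (real (r n) - 1)" for n by (simp add: \<kappa>_def)
      show "\<forall>\<^sub>F n in sequentially. (1 + \<epsilon>) * ln (real n) \<le>
          real n * p n * (1 - sqrt (1 - ((\<kappa> n - \<epsilon> / 2) * \<delta> n)\<^sup>2))"
        using ev eventually_ln_ge[of 1]
      proof eventually_elim
        case (elim n)
        define L where "L = ln (real n)"
        define h where "h = 1 - sqrt (1 - ((\<kappa> n - \<epsilon>) * \<delta> n)\<^sup>2)"
        define h' where "h' = 1 - sqrt (1 - ((\<kappa> n - \<epsilon> / 2) * \<delta> n)\<^sup>2)"
        have L: "1 \<le> L" and e: "1 \<le> real n * p n / L * h"
          using elim by (simp_all add: L_def h_def \<kappa>_def power_mult_distrib)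
        then have Lh: "L \<le> real n * p n * h" by (simp add: field_simps)
        have "(1 + \<epsilon> / 2)\<^sup>2 * h \<le> h'"
          unfolding h_def h'_def
        proof (rule one_minus_sqrt_scale)
          show "0 \<le> (\<kappa> n - \<epsilon>) * \<delta> n" using \<kappa>[of n] \<epsilon> \<delta>[of n] by simp
          show "(\<kappa> n - \<epsilon> / 2) * \<delta> n \<le> 1" using \<kappa>[of n] \<epsilon> \<delta>[of n] by (intro mult_le_one) auto
          have "(\<epsilon> / 2) * (\<kappa> n - \<epsilon>) \<le> (\<epsilon> / 2) * 1"
            using \<kappa>[of n] \<epsilon> by (intro mult_left_mono) auto
          then have "(1 + \<epsilon> / 2) * (\<kappa> n - \<epsilon>) \<le> \<kappa> n - \<epsilon> / 2" by (simp add: algebra_simps)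
          then show "(1 + \<epsilon> / 2) * ((\<kappa> n - \<epsilon>) * \<delta> n) \<le> (\<kappa> n - \<epsilon> / 2) * \<delta> n"
            using mult_right_mono[of _ _ "\<delta> n"] \<delta>[of n] by (simp add: mult.assoc[symmetric])
        qed (use \<epsilon> in simp)
        then have "real n * p n * ((1 + \<epsilon> / 2)\<^sup>2 * h) \<le> real n * p n * h'"
          using p[of n] by (intro mult_left_mono) auto
        moreover have "(1 + \<epsilon> / 2)\<^sup>2 * L \<le> (1 + \<epsilon> / 2)\<^sup>2 * (real n * p n * h)"
          using Lh by (intro mult_left_mono) auto
        moreover have "(1 + \<epsilon>) * L \<le> (1 + \<epsilon> / 2)\<^sup>2 * L"
          using L by (intro mult_right_mono) (auto simp: power2_eq_square algebra_simps)
        ultimately have "(1 + \<epsilon>) * L \<le> real n * p n * h'"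
          by (simp add: mult_ac)
        then show ?case by (simp add: L_def h'_def)
      qed
    qed (use \<epsilon> in auto)
  next
    fix \<epsilon> :: real
    assume \<epsilon>: "0 < \<epsilon>"
      and ev: "\<forall>\<^sub>F n in sequentially. 1 / \<delta> n \<le> (real (r n) - 3) / (real (r n) - 1) *
               sqrt (real n * p n / ((2 + \<epsilon>) * ln (real n)))"
    \<comment> \<open>Chosen such that \<open>(1 - 2 * t) * (1 + \<epsilon> / 2) = 1 + \<epsilon> / 4\<close>.\<close>
    define t where "t = \<epsilon> / (8 + 4 * \<epsilon>)"
    have t: "0 < t" "t < 1" using \<epsilon> by (auto simp: t_def field_simps)
    have tt: "(1 - 2 * t) * (1 + \<epsilon> / 2) = 1 + \<epsilon> / 4"
      using \<epsilon> by (simp add: t_def field_simps)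
    show ?thesis
    proof (rule sync_limit[OF hyp, where \<beta> = "\<lambda>n. \<kappa> n * (1 - t)" and \<eta> = "t / 3" and c = "\<epsilon> / 4"])
      show "0 \<le> \<kappa> n * (1 - t)" for n using \<kappa>[of n] t by (intro mult_nonneg_nonneg) linarith+
      show "\<kappa> n * (1 - t) + t / 3 \<le> (real (r n) - 3) / (real (r n) - 1)" for n
        using mult_right_mono[OF \<kappa>(1)[of n], of t] t unfolding \<kappa>n by (simp add: algebra_simps)
      show "\<forall>\<^sub>F n in sequentially. (1 + \<epsilon> / 4) * ln (real n) \<le>
          real n * p n * (1 - sqrt (1 - (\<kappa> n * (1 - t) * \<delta> n)\<^sup>2))"
        using ev eventually_ln_ge[of 1]
      proof eventually_elim
        case (elim n)
        define L where "L = ln (real n)"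
        define m where "m = real n * p n"
        define x where "x = \<kappa> n * (1 - t) * \<delta> n"
        have L: "1 \<le> L" and e: "1 / \<delta> n \<le> \<kappa> n * sqrt (m / ((2 + \<epsilon>) * L))"
          using elim by (simp_all add: L_def m_def \<kappa>_def)
        have m0: "0 \<le> m" using p[of n] by (simp add: m_def)
        have Q0: "0 \<le> m / ((2 + \<epsilon>) * L)" using m0 \<epsilon> L by simp
        have "(1 / \<delta> n)\<^sup>2 \<le> (\<kappa> n * sqrt (m / ((2 + \<epsilon>) * L)))\<^sup>2"
          using e \<delta>[of n] by (intro power_mono) auto
        then have "(1 / \<delta> n)\<^sup>2 \<le> (\<kappa> n)\<^sup>2 * (m / ((2 + \<epsilon>) * L))"
          unfolding power_mult_distrib real_sqrt_pow2[OF Q0] .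
        moreover define Z where "Z = (2 + \<epsilon>) * L"
        moreover have "0 < Z" using L \<epsilon> by (simp add: Z_def)
        ultimately have "Z \<le> m * ((\<kappa> n)\<^sup>2 * (\<delta> n)\<^sup>2)"
          using \<delta>[of n] unfolding Z_def[symmetric] by (simp add: power_divide field_simps)
        then have "(2 + \<epsilon>) * L \<le> m * ((\<kappa> n)\<^sup>2 * (\<delta> n)\<^sup>2)"
          by (simp add: Z_def)
        then have b: "(1 + \<epsilon> / 2) * L \<le> m * ((\<kappa> n)\<^sup>2 * (\<delta> n)\<^sup>2) / 2"
          by (simp add: algebra_simps)
        have "(1 - 2 * t) * ((1 + \<epsilon> / 2) * L) \<le> (1 - t)\<^sup>2 * ((1 + \<epsilon> / 2) * L)"
          using \<epsilon> L by (intro mult_right_mono) (auto simp: power2_eq_square algebra_simps)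
        also have "\<dots> \<le> (1 - t)\<^sup>2 * (m * ((\<kappa> n)\<^sup>2 * (\<delta> n)\<^sup>2) / 2)"
          using b by (intro mult_left_mono) auto
        also have "\<dots> = m * (x\<^sup>2 / 2)"
          by (simp add: x_def power_mult_distrib)
        also have "\<dots> \<le> m * (1 - sqrt (1 - x\<^sup>2))"
        proof (rule mult_left_mono[OF _ m0], rule one_minus_sqrt_bounds(3))
          show "0 \<le> x" unfolding x_def using \<kappa>[of n] t \<delta>[of n] by (intro mult_nonneg_nonneg) linarith+
          show "x \<le> 1" unfolding x_def using \<kappa>[of n] t \<delta>[of n] by (intro mult_le_one mult_nonneg_nonneg) linarith+
        qed
        finally have "(1 + \<epsilon> / 4) * L \<le> m * (1 - sqrt (1 - x\<^sup>2))"
          unfolding mult.assoc[symmetric] tt .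
        then show ?case by (simp add: L_def m_def x_def)
      qed
    qed (use \<epsilon> t in auto)
  qed
qed

text \<open>The difference of the square roots is \<open>(1 - 2 * a) * (p - q)\<close> divided by their sum. The square of the sum is \<open>p + q\<close> plus
twice the geometric mean of the radicands, which increases with \<open>a\<close>, so lowering \<open>a\<close> raises the numerator and lowers the denominator.\<close>

lemma sqrt_gap_scale:
  fixes a a' p q \<epsilon> :: real
  assumes pq: "0 \<le> q" "q < p" and a: "0 < a'" "a = a' + \<epsilon> / 2" "a < 1 / 2" and \<epsilon>: "0 < \<epsilon>"
  defines "g \<equiv> \<lambda>a. (sqrt (p - a * (p - q)) - sqrt (q + a * (p - q)))\<^sup>2"
  shows "(1 + \<epsilon>) * g a \<le> g a'" "p * g a \<le> (p - q)\<^sup>2"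
proof -
  define d where "d = p - q"
  have d0: "0 < d" using pq by (simp add: d_def)
  have within: "0 \<le> p - b * d" "0 \<le> q + b * d" if "0 < b" "b < 1 / 2" for b
  proof -
    have "b * d \<le> 1 * d" "0 \<le> b * d" using that d0 by (auto intro: mult_right_mono)
    then show "0 \<le> p - b * d" "0 \<le> q + b * d"
      using pq d_def by linarith+
  qed
  have ident: "g b * (p + q + 2 * sqrt ((p - b * d) * (q + b * d))) = ((1 - 2 * b) * d)\<^sup>2"
    if b: "0 < b" "b < 1 / 2" for b
  proof -
    define u v where "u = sqrt (p - b * d)" and "v = sqrt (q + b * d)"
    have nn: "0 \<le> p - b * d" "0 \<le> q + b * d"
      using within[of b] b by auto
    have uv: "u * u = p - b * d" "v * v = q + b * d"
      using nn by (simp_all add: u_def v_def)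
    have "g b * (p + q + 2 * sqrt ((p - b * d) * (q + b * d))) = (u - v)\<^sup>2 * (u * u + v * v + 2 * (u * v))"
      unfolding uv by (simp add: g_def u_def v_def d_def[symmetric] real_sqrt_mult)
    also have "\<dots> = (u * u - v * v)\<^sup>2" by (simp add: power2_eq_square algebra_simps)
    also have "u * u - v * v = (1 - 2 * b) * d" unfolding uv by (simp add: d_def algebra_simps)
    finally show ?thesis .
  qed
  have a': "a' < 1 / 2" and a0: "0 < a" using a \<epsilon> by auto
  define s where "s = (\<lambda>b. p + q + 2 * sqrt ((p - b * d) * (q + b * d)))"
  have I: "g a * s a = ((1 - 2 * a) * d)\<^sup>2" "g a' * s a' = ((1 - 2 * a') * d)\<^sup>2"
    using ident[OF a0 a(3)] ident[OF a(1) a'] by (simp_all add: s_def)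
  have nn: "0 \<le> (p - a * d) * (q + a * d)"
    using within[OF a0 a(3)] by simp
  have g0: "0 \<le> g b" for b by (simp add: g_def)
  have sa: "p \<le> s a" using pq nn by (simp add: s_def)
  have "(p - a' * d) * (q + a' * d) \<le> (p - a * d) * (q + a * d)"
  proof -
    have "(p - a * d) * (q + a * d) - (p - a' * d) * (q + a' * d) = (a - a') * (1 - a - a') * d\<^sup>2"
      by (simp add: d_def power2_eq_square algebra_simps)
    also have "0 \<le> \<dots>" using a a' \<epsilon> by (intro mult_nonneg_nonneg) auto
    finally show ?thesis by simp
  qed
  then have ss: "s a' \<le> s a" by (simp add: s_def)
  have nn': "0 < s a'"
  proof -
    have "0 \<le> (p - a' * d) * (q + a' * d)"
      using within[OF a(1) a'] by simp
    then show ?thesis using pq by (simp add: s_def add_pos_nonneg)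
  qed
  have "p * g a \<le> s a * g a" using sa g0 by (rule mult_right_mono)
  also have "\<dots> = ((1 - 2 * a) * d)\<^sup>2" using I(1) by (simp add: mult.commute)
  also have "\<dots> \<le> (1 * d)\<^sup>2" using a a0 d0 by (intro power_mono mult_right_mono) auto
  finally show "p * g a \<le> (p - q)\<^sup>2" by (simp add: d_def)
  have "(1 + \<epsilon>) * (1 - 2 * a)\<^sup>2 \<le> (1 - 2 * a')\<^sup>2"
  proof -
    define y where "y = 1 - 2 * a"
    have y: "0 < y" "y \<le> 1" "1 - 2 * a' = y + \<epsilon>" using a a0 by (auto simp: y_def)
    have "\<epsilon> * (y * y) \<le> \<epsilon> * (2 * y)" using y \<epsilon> by (intro mult_left_mono) (auto intro: order.trans[OF mult_left_mono[of y 1 y]])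
    moreover have "(1 + \<epsilon>) * y\<^sup>2 = y * y + \<epsilon> * (y * y)" "(y + \<epsilon>)\<^sup>2 = y * y + \<epsilon> * (2 * y) + \<epsilon> * \<epsilon>"
      by (simp_all add: power2_eq_square algebra_simps)
    moreover have "0 \<le> \<epsilon> * \<epsilon>" by simp
    ultimately have "(1 + \<epsilon>) * y\<^sup>2 \<le> (y + \<epsilon>)\<^sup>2" by linarith
    then show ?thesis unfolding y(3) y_def[symmetric] .
  qed
  then have "(1 + \<epsilon>) * (1 - 2 * a)\<^sup>2 * d\<^sup>2 \<le> (1 - 2 * a')\<^sup>2 * d\<^sup>2" by (rule mult_right_mono) simp
  then have "((1 + \<epsilon>) * g a) * s a \<le> g a' * s a'"
    using I by (simp add: power_mult_distrib mult.assoc)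
  moreover have "((1 + \<epsilon>) * g a) * s a' \<le> ((1 + \<epsilon>) * g a) * s a"
    using ss g0 \<epsilon> by (intro mult_left_mono) auto
  ultimately have "((1 + \<epsilon>) * g a) * s a' \<le> g a' * s a'" by linarith
  then show "(1 + \<epsilon>) * g a \<le> g a'" using nn' by (rule mult_right_le_imp_le)
qed

text \<open>Half of \<open>\<epsilon>\<close> is kept for the norm of the noise. The other half raises the rate by the factor \<open>1 + \<epsilon>\<close>, so that the
union bound over \<open>n\<close> rows tends to zero.\<close>

lemma sbm_whp:
  fixes p q :: "nat \<Rightarrow> real"
  assumes hyp: "\<And>n. even n \<Longrightarrow> sign_vec n (z n) \<and> z n \<bullet> ones_vec n = 0 \<and>
              0 \<le> q n \<and> q n < p n \<and> p n \<le> 1 \<and> 4 \<le> r n"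
    and \<epsilon>: "0 < \<epsilon>" "\<epsilon> \<le> 1 / 12"
    and ev: "\<forall>\<^sub>F n in inf sequentially (principal {n. even n}).
             real n / ln (real n) *
               (sqrt (p n - (1 / (real (r n) - 1) + \<epsilon>) * (p n - q n))
                 - sqrt (q n + (1 / (real (r n) - 1) + \<epsilon>) * (p n - q n)))\<^sup>2 \<ge> 2"
  shows "((\<lambda>n. measure_pmf.prob (sbm_pmf n (p n) (q n) (z n))
              {A. \<forall>\<Delta>p. monotone_perturbation (z n) \<Delta>p \<longrightarrow>
                    property_R (A - ((p n + q n) / 2) \<cdot>\<^sub>m outer (ones_vec n) (ones_vec n) + \<Delta>p)
                      (r n) (z n)})
            \<longlongrightarrow> 1) (inf sequentially (principal {n. even n}))" (is "(?f \<longlongrightarrow> 1) ?F")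
proof (rule tendsto_sandwich[OF _ _ tendsto_mono[OF inf_le1 failure_rate_tendsto[OF \<epsilon>(1)]] tendsto_const])
  show "\<forall>\<^sub>F n in ?F. ?f n \<le> 1" by simp
  have seq: "eventually P ?F" if "eventually P sequentially" for P
    using that by (rule filter_leD[OF inf_le1])
  have even: "\<forall>\<^sub>F n in ?F. even n"
    by (simp add: eventually_inf_principal)
  from ev even seq[OF eventually_ln_ge[of 1]] seq[OF eventually_ln_ge[of "1350 * noise_const / \<epsilon>\<^sup>2"]]
    seq[OF eventually_gt_at_top[of 0]]
  show "\<forall>\<^sub>F n in ?F. 1 - 2 / real n - exp 1 * exp (- \<epsilon> * ln (real n)) \<le> ?f n"
  proof eventually_elim
    case (elim n)
    define L where "L = ln (real n)"
    define a where "a = 1 / (real (r n) - 1) + \<epsilon>"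
    define a' where "a' = 1 / (real (r n) - 1) + \<epsilon> / 2"
    define g where "g = (\<lambda>a. (sqrt (p n - a * (p n - q n)) - sqrt (q n + a * (p n - q n)))\<^sup>2)"
    have H: "sign_vec n (z n)" "z n \<bullet> ones_vec n = 0" "0 \<le> q n" "q n < p n" "p n \<le> 1" "4 \<le> r n"
      using hyp elim by auto
    have L1: "1 \<le> L" and n: "0 < n" and cond: "2 \<le> real n / L * g a"
      and L2: "1350 * noise_const / \<epsilon>\<^sup>2 \<le> L"
      using elim by (simp_all add: L_def g_def a_def)
    have Lg: "2 * L \<le> real n * g a" using cond L1 by (simp add: field_simps)
    have "1 / (real (r n) - 1) \<le> 1 / 3" using H by (simp add: field_simps)
    then have a: "a < 1 / 2" "a' < 1 / 2" using \<epsilon> by (auto simp: a_def a'_def)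
    have a'0: "0 < a'" using H \<epsilon> by (auto simp: a'_def intro: add_pos_pos)
    have G: "(1 + \<epsilon>) * g a \<le> g a'" "p n * g a \<le> (p n - q n)\<^sup>2"
      unfolding g_def using sqrt_gap_scale[OF H(3,4) a'0 _ a(1) \<epsilon>(1)] by (auto simp: a_def a'_def)
    define m where "m = real n * p n"
    have p0: "0 < p n" using H by simp
    have m0: "0 \<le> m" using p0 by (simp add: m_def)
    have key: "2 * L * m \<le> (real n * (p n - q n))\<^sup>2"
    proof -
      have "2 * L * m \<le> real n * g a * m" using Lg m0 by (rule mult_right_mono)
      also have "\<dots> = (real n)\<^sup>2 * (p n * g a)" by (simp add: m_def power2_eq_square)
      also have "\<dots> \<le> (real n)\<^sup>2 * (p n - q n)\<^sup>2" using G(2) by (intro mult_left_mono) auto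
      finally show ?thesis by (simp add: power_mult_distrib)
    qed
    have Lm: "2 * L \<le> m"
    proof -
      have "(p n - q n)\<^sup>2 \<le> (p n)\<^sup>2" using H by (intro power_mono) auto
      then have "p n * g a \<le> p n * p n" using G(2) by (simp add: power2_eq_square)
      then have "g a \<le> p n" using p0 by (rule mult_left_le_imp_le)
      then have "real n * g a \<le> m" unfolding m_def by (intro mult_left_mono) auto
      then show ?thesis using Lg by linarith
    qed
    define k where "k = nat \<lceil>m + 2 * L\<rceil>"
    have "0 \<le> m + 2 * L" using m0 L1 by linarith
    then have k: "m + 2 * L \<le> real k" "real k \<le> m + 2 * L + 1"
      unfolding k_def by linarith+
    have "0 < real k" using k(1) m0 L1 by linarith
    then have k0: "0 < k" "real n * p n \<le> real k"
      using k(1) L1 unfolding m_def by linarith+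
    have k3: "real k \<le> 3 * m" using k(2) Lm L1 by linarith
    have noise: "15 * sqrt (noise_const * real k) \<le> \<epsilon> / 2 * (real n * (p n - q n))"
    proof (rule power2_le_imp_le)
      have "1350 * noise_const \<le> \<epsilon>\<^sup>2 * L" using L2 \<epsilon> by (simp add: field_simps)
      then have "m * (1350 * noise_const) \<le> m * (\<epsilon>\<^sup>2 * L)"
        using m0 by (rule mult_left_mono)
      moreover have "225 * noise_const * real k \<le> 225 * noise_const * (3 * m)"
        using k3 noise_const_pos by (intro mult_left_mono) auto
      moreover have "\<epsilon>\<^sup>2 / 4 * (2 * L * m) \<le> \<epsilon>\<^sup>2 / 4 * (real n * (p n - q n))\<^sup>2"
        using key by (rule mult_left_mono) simp
      ultimately have "225 * noise_const * real k \<le> \<epsilon>\<^sup>2 / 4 * (real n * (p n - q n))\<^sup>2"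
        by (simp add: algebra_simps)
      then show "(15 * sqrt (noise_const * real k))\<^sup>2 \<le> (\<epsilon> / 2 * (real n * (p n - q n)))\<^sup>2"
        using noise_const_pos by (simp add: power_mult_distrib power_divide)
      show "0 \<le> \<epsilon> / 2 * (real n * (p n - q n))" using \<epsilon> H by simp
    qed
    have succ: "1 - 2 * real n * exp (- real k) - real n * exp (1 - real n / 2 * g a') \<le> ?f n"
      unfolding g_def
      by (rule sbm_success_probability[where \<eta> = "\<epsilon> / 2"])
        (use n H a \<epsilon> k0 noise in \<open>auto simp: a'_def\<close>)
    have "2 * real n * exp (- real k) \<le> 2 / real n"
      using n k(1) m0 by (intro exp_ceiling_bound) (auto simp: L_def)
    moreover have "real n * exp (1 - real n / 2 * g a') \<le> exp 1 * exp (- \<epsilon> * ln (real n))"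
    proof -
      have "(1 + \<epsilon>) * (2 * L) \<le> (1 + \<epsilon>) * (real n * g a)"
        using Lg \<epsilon> by (intro mult_left_mono) auto
      also have "\<dots> = real n * ((1 + \<epsilon>) * g a)" by simp
      also have "\<dots> \<le> real n * g a'" using G(1) by (intro mult_left_mono) auto
      finally have "1 - real n / 2 * g a' \<le> 1 - (1 + \<epsilon>) * L" by simp
      then have "real n * exp (1 - real n / 2 * g a') \<le> real n * exp (1 - (1 + \<epsilon>) * L)"
        by (intro mult_left_mono) auto
      also have "\<dots> = exp L * exp (1 - (1 + \<epsilon>) * L)"
        using n by (simp add: L_def)
      also have "\<dots> = exp 1 * exp (- \<epsilon> * ln (real n))"
        unfolding exp_add[symmetric] by (simp add: L_def algebra_simps)
      finally show ?thesis .
    qed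
    ultimately show ?case using succ by linarith
  qed
qed

section \<open>Benign landscapes for synchronization and clustering\<close>

theorem theorem5:
  shows
   "(\<forall>(n::nat) (r::nat) (z::real vec) (A::real mat) (\<Delta>::real mat) (\<rho>::real).
       0 < n \<and> sign_vec n z \<and> adjacency_mat n A \<and> connected_adj n A \<and>
       sym_mat n \<Delta> \<and> (\<forall>i<n. \<Delta> $$ (i, i) = 0) \<and>
       \<rho> = Max ((\<lambda>i. - z $ i * (\<Sum>j\<in>{..<n} - {i}. \<Delta> $$ (i, j) * z $ j)) ` {..<n}) \<and>
       ((4 \<le> r \<and>
         \<rho> + (real r + 11) / (real r - 3) * op_norm \<Delta>
           \<le> (real r - 3) / (real r - 1) * algebraic_connectivity A) \<or>
        (r = 3 \<and> \<Delta> = 0\<^sub>m n n))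
       \<longrightarrow> (\<forall>\<Delta>p. monotone_perturbation z \<Delta>p \<longrightarrow>
              property_R (diagm z * A * diagm z + \<Delta> + \<Delta>p) r z))
    \<and>
    (\<forall>(z::nat \<Rightarrow> real vec) (p::nat \<Rightarrow> real) (\<delta>::nat \<Rightarrow> real) (r::nat \<Rightarrow> nat).
       (\<forall>n. sign_vec n (z n) \<and> 0 \<le> p n \<and> p n \<le> 1 \<and> 0 < \<delta> n \<and> \<delta> n \<le> 1 \<and> 4 \<le> r n) \<and>
       ((\<exists>\<epsilon>::real. 0 < \<epsilon> \<and> \<epsilon> \<le> 1 / 3 \<and>
          (\<forall>\<^sub>F n in sequentially.
             real n * p n / ln (real n) *
               (1 - sqrt (1 - ((real (r n) - 3) / (real (r n) - 1) - \<epsilon>)\<^sup>2 * (\<delta> n)\<^sup>2)) \<ge> 1)) \<or>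
        (\<exists>\<epsilon>::real. 0 < \<epsilon> \<and>
          (\<forall>\<^sub>F n in sequentially.
             1 / \<delta> n \<le> (real (r n) - 3) / (real (r n) - 1) *
               sqrt (real n * p n / ((2 + \<epsilon>) * ln (real n))))))
       \<longrightarrow> (\<lambda>n. measure_pmf.prob (sync_pmf n (p n) (\<delta> n) (z n))
              {C. \<forall>\<Delta>p. monotone_perturbation (z n) \<Delta>p \<longrightarrow> property_R (C + \<Delta>p) (r n) (z n)})
            \<longlonglongrightarrow> 1)
    \<and>
    (\<forall>(n::nat) (r::nat) (z::real vec) (p::real) (q::real) (A::real mat).
       0 < n \<and> even n \<and> sign_vec n z \<and> z \<bullet> ones_vec n = 0 \<and>
       0 \<le> q \<and> q < p \<and> p \<le> 1 \<and> A \<in> set_pmf (sbm_pmf n p q z) \<and> 4 \<le> r \<and>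
       Min ((\<lambda>i. z $ i * (\<Sum>j\<in>{..<n} - {i}. A $$ (i, j) * z $ j)) ` {..<n})
         \<ge> (real r + 11) / (real r - 3) * op_norm (A - mean_mat n (sbm_pmf n p q z))
            + real n * (p - q) / (real r - 1)
       \<longrightarrow> (\<forall>\<Delta>p. monotone_perturbation z \<Delta>p \<longrightarrow>
              property_R (A - ((p + q) / 2) \<cdot>\<^sub>m outer (ones_vec n) (ones_vec n) + \<Delta>p) r z))
    \<and>
    (\<forall>(z::nat \<Rightarrow> real vec) (p::nat \<Rightarrow> real) (q::nat \<Rightarrow> real) (r::nat \<Rightarrow> nat).
       (\<forall>n. even n \<longrightarrow> sign_vec n (z n) \<and> z n \<bullet> ones_vec n = 0 \<and>
              0 \<le> q n \<and> q n < p n \<and> p n \<le> 1 \<and> 4 \<le> r n) \<and>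
       (\<exists>\<epsilon>::real. 0 < \<epsilon> \<and> \<epsilon> \<le> 1 / 12 \<and>
          (\<forall>\<^sub>F n in inf sequentially (principal {n. even n}).
             real n / ln (real n) *
               (sqrt (p n - (1 / (real (r n) - 1) + \<epsilon>) * (p n - q n))
                 - sqrt (q n + (1 / (real (r n) - 1) + \<epsilon>) * (p n - q n)))\<^sup>2 \<ge> 2))
       \<longrightarrow> ((\<lambda>n. measure_pmf.prob (sbm_pmf n (p n) (q n) (z n))
              {A. \<forall>\<Delta>p. monotone_perturbation (z n) \<Delta>p \<longrightarrow>
                    property_R (A - ((p n + q n) / 2) \<cdot>\<^sub>m outer (ones_vec n) (ones_vec n) + \<Delta>p)
                      (r n) (z n)})
            \<longlongrightarrow> 1) (inf sequentially (principal {n. even n})))"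
proof (intro conjI allI impI, goal_cases)
  case (1 n r z A \<Delta> \<rho> \<Delta>p)
  then show ?case
    by (elim conjE) (rule property_R_graph, assumption+, simp, assumption+)
next
  case (2 z p \<delta> r)
  then show ?case
    by (elim conjE) (rule sync_whp, simp_all)
next
  case (3 n r z p q A \<Delta>p)
  then show ?case
    by (elim conjE) (rule property_R_sbm)
next
  case (4 z p q r)
  then obtain \<epsilon> :: real where "0 < \<epsilon>" "\<epsilon> \<le> 1 / 12" and ev: "\<forall>\<^sub>F n in inf sequentially (principal {n. even n}).
      real n / ln (real n) *
         (sqrt (p n - (1 / (real (r n) - 1) + \<epsilon>) * (p n - q n))
           - sqrt (q n + (1 / (real (r n) - 1) + \<epsilon>) * (p n - q n)))\<^sup>2 \<ge> 2"
    by blast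
  with 4 show ?case
    by (intro sbm_whp[of z q p r \<epsilon>]) simp_all
qed

end
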